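(* Let $n\ge 2$, let $\Sigma$ be a surface diffeomorphic to a compact torus and let $\ell:\Sigma\to\mathbb{R}^{2n}$ be a smooth isotropic immersion. Then for every $\epsilon>0$ there exists a piecewise linear isotropic map $\hat\ell:\Sigma\to\mathbb{R}^{2n}$ such that $\|\ell(x)-\hat\ell(x)\|\le\epsilon$ for every $x\in\Sigma$. Furthermore, if $n\ge 3$, we may assume that $\hat\ell$ is a (piecewise linear) immersion. If $n=2$, we may assume that $\hat\ell$ is an immersion away from a finite union of embedded circles in $\Sigma$.
   Context: $\mathbb{R}^{2n}$ carries its Euclidean metric $g$ and standard symplectic form $\omega$. A smooth map $\ell:\Sigma\to\mathbb{R}^{2n}$ is isotropic if $\ell^*\omega=0$. A triangulation of $\mathbb{R}^2$ is a locally finite simplicial complex, with Euclidean points, segments and triangles, covering $\mathbb{R}^2$. A continuous map $f:\mathbb{R}^2\to\mathbb{R}^m$ is piecewise linear if, for some triangulation of $\mathbb{R}^2$, its restriction to each triangle is affine. The immersion $\ell$ induces the metric $\ell^*g$ on $\Sigma$; by uniformization there is a conformal covering map $p:\mathbb{R}^2\to\Sigma$ whose group of deck transformations is a lattice $\Gamma$ of $\mathbb{R}^2$ acting by translations. Triangulations of $\Sigma$ are those obtained as quotients of $\Gamma$-invariant triangulations of $\mathbb{R}^2$, and a map $f:\Sigma\to\mathbb{R}^m$ is piecewise linear if it lifts via $p$ to a piecewise linear map $\mathbb{R}^2\to\mathbb{R}^m$. A piecewise linear map $\hat\ell:\Sigma\to\mathbb{R}^{2n}$ is isotropic if the pullback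 of $\omega$ vanishes on each triangle of the triangulation subordinate to $\hat\ell$. A piecewise linear map is an immersion (resp. an immersion at a point) if it is locally injective (resp. injective in a neighborhood of that point). *)

theory Defs
  imports "HOL-Analysis.Analysis"
begin

section \<open>Smooth surfaces\<close>

text \<open>These two notions are only used for open sets \<open>X\<close>.\<close>

primrec higher_differentiable_on ::
  "'a::real_normed_vector set \<Rightarrow> ('a \<Rightarrow> 'b::real_normed_vector) \<Rightarrow> nat \<Rightarrow> bool" where
  "higher_differentiable_on X f 0 \<longleftrightarrow> continuous_on X f"
| "higher_differentiable_on X f (Suc k) \<longleftrightarrow>
     (\<forall>x\<in>X. f differentiable (at x)) \<and>
     (\<forall>v. higher_differentiable_on X (\<lambda>x. frechet_derivative f (at x) v) k)"

definition smooth_on :: "'a::real_normed_vector set \<Rightarrow> ('a \<Rightarrow> 'b::real_normed_vector) \<Rightarrow> bool" where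
  "smooth_on X f \<longleftrightarrow> (\<forall>k. higher_differentiable_on X f k)"

text \<open>A chart is a pair of its domain and its coordinate map; the values of the coordinate map
  outside of the domain are irrelevant. A surface is a subset \<open>S\<close> of a topological space, with the
  subspace topology, together with a smooth (not necessarily maximal) atlas.\<close>

type_synonym 's atlas = "('s set \<times> ('s \<Rightarrow> real^2)) set"

definition smooth_surface :: "'s::topological_space set \<Rightarrow> 's atlas \<Rightarrow> bool" where
  "smooth_surface S A \<longleftrightarrow>
     Hausdorff_space (top_of_set S) \<and> second_countable (top_of_set S) \<and>
     (\<Union>(U, \<phi>)\<in>A. U) = S \<and>
     (\<forall>(U, \<phi>)\<in>A. openin (top_of_set S) U \<and> open (\<phi> ` U) \<and>
        (\<exists>\<phi>'. homeomorphism U (\<phi> ` U) \<phi> \<phi>')) \<and>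
     (\<forall>(U, \<phi>)\<in>A. \<forall>(V, \<psi>)\<in>A. smooth_on (\<phi> ` (U \<inter> V)) (\<psi> \<circ> inv_into U \<phi>))"

definition smooth_map ::
  "'s::topological_space set \<Rightarrow> 's atlas \<Rightarrow> 't::topological_space set \<Rightarrow> 't atlas \<Rightarrow> ('s \<Rightarrow> 't) \<Rightarrow> bool" where
  "smooth_map S A T B f \<longleftrightarrow>
     continuous_on S f \<and> f ` S \<subseteq> T \<and>
     (\<forall>(U, \<phi>)\<in>A. \<forall>(V, \<psi>)\<in>B. smooth_on (\<phi> ` (U \<inter> f -` V)) (\<psi> \<circ> f \<circ> inv_into U \<phi>))"

definition diffeomorphic ::
  "'s::topological_space set \<Rightarrow> 's atlas \<Rightarrow> 't::topological_space set \<Rightarrow> 't atlas \<Rightarrow> bool" where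
  "diffeomorphic S A T B \<longleftrightarrow>
     (\<exists>f g. smooth_map S A T B f \<and> smooth_map T B S A g \<and>
        (\<forall>x\<in>S. g (f x) = x) \<and> (\<forall>y\<in>T. f (g y) = y))"

definition plane_atlas :: "(real^2) atlas" where
  "plane_atlas = {(UNIV, id)}"

text \<open>The charts of the torus are the local inverses of its universal covering map.\<close>

definition torus :: "(complex \<times> complex) set" where
  "torus = sphere 0 1 \<times> sphere 0 1"

definition torus_exp :: "real^2 \<Rightarrow> complex \<times> complex" where
  "torus_exp x = (cis (2 * pi * x$1), cis (2 * pi * x$2))"

definition torus_atlas :: "(complex \<times> complex) atlas" where
  "torus_atlas = {(torus_exp ` V, inv_into V torus_exp) | V. open V \<and> inj_on torus_exp V}"

section \<open>Smooth isotropic immersions\<close>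

text \<open>Pullback of a covariant 2-tensor with constant coefficients.\<close>

definition pullback ::
  "('b \<Rightarrow> 'b \<Rightarrow> real) \<Rightarrow> ('a::real_normed_vector \<Rightarrow> 'b::real_normed_vector) \<Rightarrow> 'a \<Rightarrow> 'a \<Rightarrow> 'a \<Rightarrow> real" where
  "pullback B f x u v = B (frechet_derivative f (at x) u) (frechet_derivative f (at x) v)"

text \<open>\<open>\<real>\<^sup>2\<^sup>n\<close> is represented as \<open>\<real>\<^sup>n \<times> \<real>\<^sup>n\<close>, whose norm and inner product are the Euclidean ones.\<close>

definition symplectic_form :: "(real^'n) \<times> (real^'n) \<Rightarrow> (real^'n) \<times> (real^'n) \<Rightarrow> real" where
  "symplectic_form z w = fst z \<bullet> snd w - snd z \<bullet> fst w"

definition smooth_function :: "'s atlas \<Rightarrow> ('s \<Rightarrow> 'b::real_normed_vector) \<Rightarrow> bool" where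
  "smooth_function A f \<longleftrightarrow> (\<forall>(U, \<phi>)\<in>A. smooth_on (\<phi> ` U) (f \<circ> inv_into U \<phi>))"

definition smooth_immersion :: "'s atlas \<Rightarrow> ('s \<Rightarrow> 'b::real_normed_vector) \<Rightarrow> bool" where
  "smooth_immersion A f \<longleftrightarrow> smooth_function A f \<and>
     (\<forall>(U, \<phi>)\<in>A. \<forall>y\<in>\<phi> ` U. inj (frechet_derivative (f \<circ> inv_into U \<phi>) (at y)))"

definition isotropic :: "'s atlas \<Rightarrow> ('s \<Rightarrow> (real^'n) \<times> (real^'n)) \<Rightarrow> bool" where
  "isotropic A f \<longleftrightarrow>
     (\<forall>(U, \<phi>)\<in>A. \<forall>y\<in>\<phi> ` U. \<forall>u v. pullback symplectic_form (f \<circ> inv_into U \<phi>) y u v = 0)"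

section \<open>Uniformization\<close>

definition plane_lattice :: "(real^2) set \<Rightarrow> bool" where
  "plane_lattice \<Gamma> \<longleftrightarrow> (\<exists>a b. a \<noteq> b \<and> independent {a, b} \<and>
     \<Gamma> = {of_int i *\<^sub>R a + of_int j *\<^sub>R b | i j. True})"

definition deck_transformations :: "('a::topological_space \<Rightarrow> 's) \<Rightarrow> ('a \<Rightarrow> 'a) set" where
  "deck_transformations p = {h. (\<exists>k. homeomorphism UNIV UNIV h k) \<and> p \<circ> h = p}"

text \<open>A covering map \<open>p\<close> of \<open>S\<close> by the plane that is conformal for the metric induced by \<open>f\<close> on \<open>S\<close>;
  the pullback of that metric by \<open>p\<close> is the pullback of the inner product by \<open>f \<circ> p\<close>.\<close>

definition conformal_covering ::
  "'s::topological_space set \<Rightarrow> 's atlas \<Rightarrow> ('s \<Rightarrow> 'b::real_inner) \<Rightarrow> (real^2 \<Rightarrow> 's) \<Rightarrow> bool" where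
  "conformal_covering S A f p \<longleftrightarrow>
     smooth_map UNIV plane_atlas S A p \<and> covering_space UNIV p S \<and>
     (\<forall>z. \<exists>c>0. \<forall>u v. pullback (\<bullet>) (f \<circ> p) z u v = c * (u \<bullet> v))"

definition uniformization ::
  "'s::topological_space set \<Rightarrow> 's atlas \<Rightarrow> ('s \<Rightarrow> 'b::real_inner) \<Rightarrow> (real^2 \<Rightarrow> 's) \<Rightarrow> (real^2) set \<Rightarrow> bool" where
  "uniformization S A f p \<Gamma> \<longleftrightarrow> conformal_covering S A f p \<and> plane_lattice \<Gamma> \<and>
     deck_transformations p = {(\<lambda>z. \<gamma> + z) | \<gamma>. \<gamma> \<in> \<Gamma>}"

section \<open>Piecewise linear maps\<close>

text \<open>The library's simplicial complexes are finite, here they are only locally finite. As there, the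
  empty set is a simplex (of dimension \<open>-1\<close>) and a face of each simplex.\<close>

definition plane_triangulation :: "(real^2) set set \<Rightarrow> bool" where
  "plane_triangulation \<T> \<longleftrightarrow>
     (\<forall>T\<in>\<T>. \<exists>k. k simplex T) \<and>
     (\<forall>F T. T \<in> \<T> \<and> F face_of T \<longrightarrow> F \<in> \<T>) \<and>
     (\<forall>T\<in>\<T>. \<forall>T'\<in>\<T>. (T \<inter> T') face_of T) \<and>
     (\<forall>x. \<exists>U. open U \<and> x \<in> U \<and> finite {T\<in>\<T>. T \<inter> U \<noteq> {}}) \<and>
     \<Union>\<T> = UNIV"

definition triangles :: "(real^2) set set \<Rightarrow> (real^2) set set" where
  "triangles \<T> = {T\<in>\<T>. 2 simplex T}"

definition affine_map_on :: "'a::real_vector set \<Rightarrow> ('a \<Rightarrow> 'b::real_vector) \<Rightarrow> bool" where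
  "affine_map_on X f \<longleftrightarrow> (\<exists>L b. linear L \<and> (\<forall>x\<in>X. f x = L x + b))"

definition subordinate :: "(real^2) set set \<Rightarrow> (real^2 \<Rightarrow> 'b::real_vector) \<Rightarrow> bool" where
  "subordinate \<T> f \<longleftrightarrow> plane_triangulation \<T> \<and> (\<forall>T\<in>triangles \<T>. affine_map_on T f)"

definition piecewise_linear :: "(real^2 \<Rightarrow> 'b::real_normed_vector) \<Rightarrow> bool" where
  "piecewise_linear f \<longleftrightarrow> continuous_on UNIV f \<and> (\<exists>\<T>. subordinate \<T> f)"

definition translation_invariant :: "(real^2) set \<Rightarrow> (real^2) set set \<Rightarrow> bool" where
  "translation_invariant \<Gamma> \<T> \<longleftrightarrow> (\<forall>\<gamma>\<in>\<Gamma>. \<forall>T\<in>\<T>. (\<lambda>x. \<gamma> + x) ` T \<in> \<T>)"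

text \<open>In the next two definitions \<open>p\<close> is a covering map of a surface by the plane and \<open>\<Gamma>\<close> is its
  lattice of deck transformations. Triangulations of the surface are represented by \<open>\<Gamma>\<close>-invariant
  triangulations of the plane.\<close>

definition pl_on_surface :: "(real^2 \<Rightarrow> 's) \<Rightarrow> ('s \<Rightarrow> 'b::real_normed_vector) \<Rightarrow> bool" where
  "pl_on_surface p f \<longleftrightarrow> piecewise_linear (f \<circ> p)"

text \<open>The pullback is constant on the interior of a triangle on which the map is affine.\<close>

definition pl_isotropic ::
  "(real^2 \<Rightarrow> 's) \<Rightarrow> (real^2) set \<Rightarrow> ('s \<Rightarrow> (real^'n) \<times> (real^'n)) \<Rightarrow> bool" where
  "pl_isotropic p \<Gamma> f \<longleftrightarrow> pl_on_surface p f \<and>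
     (\<exists>\<T>. subordinate \<T> (f \<circ> p) \<and> translation_invariant \<Gamma> \<T> \<and>
        (\<forall>T\<in>triangles \<T>. \<forall>x\<in>interior T. \<forall>u v. pullback symplectic_form (f \<circ> p) x u v = 0))"

definition pl_immersion_at :: "'s::topological_space set \<Rightarrow> ('s \<Rightarrow> 'b) \<Rightarrow> 's \<Rightarrow> bool" where
  "pl_immersion_at S f x \<longleftrightarrow> (\<exists>U. openin (top_of_set S) U \<and> x \<in> U \<and> inj_on f U)"

definition embedded_circle :: "'s::topological_space set \<Rightarrow> 's set \<Rightarrow> bool" where
  "embedded_circle S C \<longleftrightarrow> C \<subseteq> S \<and> C homeomorphic sphere (0::complex) 1"

end

theory Submission
  imports Defs
begin

text \<open>Write \<open>F = l \<circ> p\<close> in coordinates of the lattice, with partial derivatives \<open>e1, e2\<close>, complete these to a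
  symplectic frame \<open>e1, e2, f1, f2\<close>, and subdivide each square of a grid of mesh \<open>h\<close> by its diagonals. In
  the frame at a nearby point the approximation is, up to \<open>o(h)\<close>, the graph over the plane of a fixed
  periodic piecewise linear Lagrangian momentum, not the plane itself: at the vertex \<open>(i, j)\<close> the momentum
  is \<open>(-1)\<^sup>i f1\<close> for odd \<open>j\<close> and \<open>0\<close> for even \<open>j\<close>. All quadrilaterals of this model are skew, so that the
  isotropy equations, solved one after the other, are uniformly well conditioned linear systems. First the
  midpoint of each edge of the coarse grid of mesh \<open>2h\<close> is moved until the action of the broken edge is the
  integral over that edge of the closed form \<open>\<omega>(F, dF)\<close>; then each coarse square bounds an octagon of zero
  action, its centre is found such that the four small quadrilaterals have zero action, and finally
  the apex of the pyramid over each of these is found. Since the model is a graph, the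
  projection of the result along \<open>f1, f2\<close> is close to the identity on every triangle up to scaling, which gives
  local injectivity everywhere, even for \<open>n = 2\<close>.\<close>

section \<open>Symplectic linear algebra\<close>

text \<open>Flatness is the obstacle. The sides of a nearly flat quadrilateral span, after division
  by h, only the plane of \<open>e1\<close> and \<open>e2\<close>, so the three equations for a
  centre or an apex tend to a system of rank 2, and action errors of size o(h^2) may force
  displacements that are not o(h). With the momentum, three sides span \<open>e1\<close>,
  \<open>e2\<close>, \<open>f1\<close>, and the inverse system is controlled by a bound K of the
  frame.

  The equations are affine although areas are quadratic, because \<omega>(P - A, Q - A) has no term
  of degree 2 in A. Around a point there are four of them, and the fourth follows from the other
  three if the boundary polygon has action zero. This is why the coarse edges are corrected first:
  d(\<omega>(F, dF)) is twice the pullback of \<omega>, hence zero, so the integrals around a square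
  cancel; and each correction depends on its edge alone, so that adjacent squares agree. The model
  has momentum along \<open>f1\<close> at the vertices and along \<open>f2\<close> at the apexes, so
  two momentum directions suffice for every n.\<close>

lemma abs_symplectic_form_le: "\<bar>symplectic_form z w\<bar> \<le> 2 * (norm z * norm w)"
proof -
  have "\<bar>symplectic_form z w\<bar> \<le> \<bar>fst z \<bullet> snd w\<bar> + \<bar>snd z \<bullet> fst w\<bar>"
    by (simp add: symplectic_form_def)
  also have "\<dots> \<le> norm (fst z) * norm (snd w) + norm (snd z) * norm (fst w)"
    by (intro add_mono Cauchy_Schwarz_ineq2)
  also have "\<dots> \<le> norm z * norm w + norm z * norm w"
    using norm_fst_le[of "fst z" "snd z"] norm_fst_le[of "fst w" "snd w"]
      norm_snd_le[of "snd z" "fst z"] norm_snd_le[of "snd w" "fst w"]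
    by (intro add_mono mult_mono) auto
  finally show ?thesis by (simp add: mult.commute)
qed

lemma bounded_bilinear_symplectic_form:
  "bounded_bilinear (symplectic_form :: (real^'n) \<times> (real^'n) \<Rightarrow> _)"
proof -
  have *: "norm (symplectic_form z w) \<le> norm z * norm w * 2" for z w :: "(real^'n) \<times> (real^'n)"
    by (metis mult.commute real_norm_def abs_symplectic_form_le)
  show ?thesis
    by (standard; (rule exI[of _ 2], use * in blast)?)
      (auto simp: symplectic_form_def algebra_simps)
qed

interpretation symplectic: bounded_bilinear
  "symplectic_form :: (real^'n) \<times> (real^'n) \<Rightarrow> (real^'n) \<times> (real^'n) \<Rightarrow> real"
  by (rule bounded_bilinear_symplectic_form)

lemmas symplectic_simps =
  symplectic.add_left symplectic.add_right symplectic.diff_left symplectic.diff_right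
  symplectic.scaleR_left symplectic.scaleR_right symplectic.minus_left symplectic.minus_right
  symplectic.zero_left symplectic.zero_right

lemma symplectic_form_skew: "symplectic_form z w = - symplectic_form w z"
  by (simp add: symplectic_form_def inner_commute)

lemma symplectic_form_self [simp]: "symplectic_form z z = 0"
  by (simp add: symplectic_form_def inner_commute)

text \<open>Multiplication by i under z = x + iy. It produces momenta conjugate to given tangent
  vectors.\<close>

definition complex_structure :: "(real^'n) \<times> (real^'n) \<Rightarrow> (real^'n) \<times> (real^'n)" where
  "complex_structure z = (- snd z, fst z)"

lemma symplectic_form_complex_structure:
  "symplectic_form z (complex_structure w) = z \<bullet> w"
  "symplectic_form (complex_structure z) w = - (z \<bullet> w)"
  by (auto simp: symplectic_form_def complex_structure_def inner_prod_def)

text \<open>A Darboux basis of a 4-dimensional symplectic subspace. For n > 2 this is not a basis of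
  the whole space, but all corrections are made inside such subspaces.\<close>

definition symplectic_frame where
  "symplectic_frame e1 e2 f1 f2 \<longleftrightarrow>
     symplectic_form e1 e2 = 0 \<and> symplectic_form f1 f2 = 0 \<and>
     symplectic_form e1 f1 = 1 \<and> symplectic_form e2 f2 = 1 \<and>
     symplectic_form e1 f2 = 0 \<and> symplectic_form e2 f1 = 0"

lemma symplectic_frameD:
  assumes "symplectic_frame e1 e2 f1 f2"
  shows "symplectic_form e1 e2 = 0" "symplectic_form e2 e1 = 0"
    "symplectic_form f1 f2 = 0" "symplectic_form f2 f1 = 0"
    "symplectic_form e1 f1 = 1" "symplectic_form f1 e1 = - 1"
    "symplectic_form e2 f2 = 1" "symplectic_form f2 e2 = - 1"
    "symplectic_form e1 f2 = 0" "symplectic_form f2 e1 = 0"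
    "symplectic_form e2 f1 = 0" "symplectic_form f1 e2 = 0"
  using assms symplectic_form_skew[of e2 e1] symplectic_form_skew[of f2 f1]
    symplectic_form_skew[of f1 e1] symplectic_form_skew[of f2 e2]
    symplectic_form_skew[of f2 e1] symplectic_form_skew[of f1 e2]
  by (auto simp: symplectic_frame_def)

text \<open>The matrix is within 1/18 of the identity in each entry. Three entries per row change a
  coordinate by at most \<open>norm y / 6\<close>, and three coordinates change the vector by at
  most \<open>norm y / 2\<close>. Hence the map is injective, so surjective, and its inverse has
  norm at most 2.\<close>

lemma near_identity_solvable:
  fixes w U :: "3 \<Rightarrow> (real^'n) \<times> (real^'n)" and \<rho> :: "real^3"
  assumes "\<And>i j. \<bar>symplectic_form (w j) (U i) - (if i = j then 1 else 0)\<bar> \<le> 1/18"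
  shows "\<exists>y. (\<forall>i. symplectic_form (\<Sum>j\<in>UNIV. y$j *\<^sub>R w j) (U i) = \<rho>$i) \<and> norm y \<le> 2 * norm \<rho>"
proof -
  define f where "f y = (\<chi> i. symplectic_form (\<Sum>j\<in>UNIV. y$j *\<^sub>R w j) (U i))" for y :: "real^3"
  have lin: "linear f"
  proof (rule linearI)
    show "f (x + y) = f x + f y" for x y
      by (simp add: f_def vec_eq_iff scaleR_left_distrib sum.distrib symplectic.add_left)
    have "(\<Sum>j\<in>UNIV. (c * x$j) *\<^sub>R w j) = c *\<^sub>R (\<Sum>j\<in>UNIV. x$j *\<^sub>R w j)"
      for c and x :: "real^3" by (simp add: scaleR_sum_right)
    then show "f (c *\<^sub>R x) = c *\<^sub>R f x" for c x
      by (simp add: f_def vec_eq_iff symplectic.scaleR_left)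
  qed
  have close: "norm (f y - y) \<le> norm y / 2" for y
  proof -
    have c: "\<bar>(f y - y)$i\<bar> \<le> norm y / 6" for i
    proof -
      have "(f y - y)$i
          = (\<Sum>j\<in>UNIV. y$j * (symplectic_form (w j) (U i) - (if i = j then 1 else 0)))"
        by (simp add: f_def symplectic.sum_left symplectic_simps right_diff_distrib sum_subtractf
            mult_delta_right)
      also have "\<bar>\<dots>\<bar> \<le> (\<Sum>j\<in>(UNIV::3 set). norm y * (1/18))"
        by (rule order_trans[OF sum_abs], rule sum_mono)
           (simp only: abs_mult, intro mult_mono assms component_le_norm_cart abs_ge_zero norm_ge_zero)
      finally show ?thesis by simp
    qed
    have "norm (f y - y) \<le> (\<Sum>i\<in>UNIV. \<bar>(f y - y)$i\<bar>)" by (rule norm_le_l1_cart)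
    also have "\<dots> \<le> (\<Sum>i\<in>(UNIV::3 set). norm y / 6)" by (rule sum_mono) (rule c)
    finally show ?thesis by simp
  qed
  have "inj f"
    unfolding linear_injective_0[OF lin]
  proof (intro allI impI)
    fix y assume "f y = 0"
    then show "y = 0" using close[of y] by simp
  qed
  then obtain y where y: "f y = \<rho>"
    using linear_injective_imp_surjective[OF lin] by (metis surjD)
  have "norm y \<le> norm (f y) + norm (f y - y)"
    by (metis norm_triangle_sub norm_minus_commute)
  then have "norm y \<le> 2 * norm \<rho>" using close[of y] y by simp
  moreover have "\<forall>i. symplectic_form (\<Sum>j\<in>UNIV. y$j *\<^sub>R w j) (U i) = \<rho>$i"
    using y by (auto simp: f_def)
  ultimately show ?thesis by blast
qed

text \<open>The vectors - \<open>f1\<close>, - \<open>f2\<close>, \<open>e1\<close> are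
  \<omega>-dual to \<open>e1\<close>, \<open>e2\<close>, \<open>f1\<close>, so a solution is sought
  in their span, where the matrix of the system is close to the identity. The margin 1/36 becomes
  1/18 through the factor 2 in \<open>abs_symplectic_form_le\<close>; the factor 6 in the bound is 3
  summands times the norm 2 of the inverse.\<close>

lemma frame_solvable:
  assumes fr: "symplectic_frame e1 e2 f1 f2"
    and K: "norm e1 \<le> K" "norm f1 \<le> K" "norm f2 \<le> K"
    and U: "K * norm (U1 - e1) \<le> 1/36" "K * norm (U2 - e2) \<le> 1/36" "K * norm (U3 - f1) \<le> 1/36"
  shows "\<exists>y. symplectic_form y U1 = \<rho>1 \<and> symplectic_form y U2 = \<rho>2 \<and> symplectic_form y U3 = \<rho>3 \<and>
     norm y \<le> 6 * K * (\<bar>\<rho>1\<bar> + \<bar>\<rho>2\<bar> + \<bar>\<rho>3\<bar>)"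
proof -
  define w :: "3 \<Rightarrow> _" where "w j = (if j = 1 then - f1 else if j = 2 then - f2 else e1)" for j
  define U where "U j = (if j = 1 then U1 else if j = 2 then U2 else U3)" for j :: 3
  define u where "u j = (if j = 1 then e1 else if j = 2 then e2 else f1)" for j :: 3
  have K0: "0 \<le> K" using K(1) norm_ge_zero order_trans by blast
  have wn: "norm (w j) \<le> K" for j using K by (auto simp: w_def)
  have "\<bar>symplectic_form (w j) (U i) - (if i = j then 1 else 0)\<bar> \<le> 1/18" for i j
  proof -
    have "symplectic_form (w j) (u i) = (if i = j then 1 else 0)"
      using exhaust_3[of i] exhaust_3[of j] symplectic_frameD[OF fr]
      by (auto simp: w_def u_def symplectic_simps)
    then have "\<bar>symplectic_form (w j) (U i) - (if i = j then 1 else 0)\<bar>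
        = \<bar>symplectic_form (w j) (U i - u i)\<bar>" by (simp add: symplectic_simps)
    also have "\<dots> \<le> 2 * (norm (w j) * norm (U i - u i))" by (rule abs_symplectic_form_le)
    also have "\<dots> \<le> 2 * (K * norm (U i - u i))" by (intro mult_left_mono mult_right_mono wn) auto
    also have "\<dots> \<le> 2 * (1/36)"
      by (intro mult_left_mono) (use U in \<open>auto simp: U_def u_def\<close>)
    finally show ?thesis by simp
  qed
  then obtain y where
    y: "\<And>i. symplectic_form (\<Sum>j\<in>UNIV. y$j *\<^sub>R w j) (U i) = (vector [\<rho>1,\<rho>2,\<rho>3] :: real^3)$i"
    and yn: "norm y \<le> 2 * norm (vector [\<rho>1,\<rho>2,\<rho>3] :: real^3)"
    using near_identity_solvable[of w U "vector [\<rho>1,\<rho>2,\<rho>3]"] by blast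
  let ?s = "\<bar>\<rho>1\<bar> + \<bar>\<rho>2\<bar> + \<bar>\<rho>3\<bar>"
  have "norm (vector [\<rho>1,\<rho>2,\<rho>3] :: real^3) \<le> ?s"
    using norm_le_l1_cart[of "vector [\<rho>1,\<rho>2,\<rho>3] :: real^3"] by (simp only: sum_3 vector_3)
  then have yn': "norm y \<le> 2 * ?s" using yn by simp
  have "norm (\<Sum>j\<in>UNIV. y$j *\<^sub>R w j) \<le> (\<Sum>j\<in>(UNIV::3 set). (2 * ?s) * K)"
    by (intro order_trans[OF norm_sum] sum_mono)
       (simp only: norm_scaleR, intro mult_mono wn order_trans[OF component_le_norm_cart yn'], auto)
  then have "norm (\<Sum>j\<in>UNIV. y$j *\<^sub>R w j) \<le> 6 * K * ?s" by (simp add: algebra_simps)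
  then show ?thesis
    using y[of 1] y[of 2] y[of 3] unfolding vector_3 U_def
    by (intro exI[of _ "\<Sum>j\<in>UNIV. y$j *\<^sub>R w j"]) auto
qed

text \<open>\<open>V1\<close>, \<open>V2\<close>, \<open>V3\<close> are consecutive sides of a skew
  quadrilateral. The \<open>e1\<close> parts of \<open>V1\<close> and \<open>V3\<close> cancel in
  their sum, which leaves (\<alpha> + \<gamma>) times \<open>f1\<close>; skewness is the statement
  that this coefficient is 2 or - 2. Subtracting multiples of the recovered \<open>f1\<close> then
  yields \<open>e1\<close> and \<open>e2\<close>. These carry an error of up to 3 \<delta>, which is
  why \<delta> is limited by 1/108 and not by 1/36.\<close>

lemma skew_quad_solvable:
  assumes fr: "symplectic_frame e1 e2 f1 f2"
    and K: "1 \<le> K" "norm e1 \<le> K" "norm f1 \<le> K" "norm f2 \<le> K"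
    and V: "norm (V1 - (e1 + \<alpha> *\<^sub>R f1)) \<le> \<delta>" "norm (V2 - (e2 + \<beta> *\<^sub>R f1)) \<le> \<delta>"
      "norm (V3 - (- e1 + \<gamma> *\<^sub>R f1)) \<le> \<delta>"
    and \<kappa>: "\<bar>\<alpha> + \<gamma>\<bar> = 2" "\<bar>\<alpha>\<bar> \<le> 2" "\<bar>\<beta>\<bar> \<le> 2" and \<delta>: "K * \<delta> \<le> 1/108"
  shows "\<exists>y. symplectic_form y V1 = \<rho>1 \<and> symplectic_form y V2 = \<rho>2 \<and> symplectic_form y V3 = \<rho>3 \<and>
     norm y \<le> 24 * K * (\<bar>\<rho>1\<bar> + \<bar>\<rho>2\<bar> + \<bar>\<rho>3\<bar>)"
proof -
  define k where "k = 1 / (\<alpha> + \<gamma>)"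
  have k: "\<bar>k\<bar> = 1/2" "k * (\<alpha> + \<gamma>) = 1"
    using \<kappa> by (auto simp: k_def abs_divide)
  define U3 where "U3 = k *\<^sub>R (V1 + V3)"
  define U1 where "U1 = V1 - \<alpha> *\<^sub>R U3"
  define U2 where "U2 = V2 - \<beta> *\<^sub>R U3"
  define r3 where "r3 = k * (\<rho>1 + \<rho>3)"
  define r1 where "r1 = \<rho>1 - \<alpha> * r3"
  define r2 where "r2 = \<rho>2 - \<beta> * r3"
  have "U3 - f1 = k *\<^sub>R ((V1 - (e1 + \<alpha> *\<^sub>R f1)) + (V3 - (- e1 + \<gamma> *\<^sub>R f1)))"
  proof -
    have "k *\<^sub>R ((V1 - (e1 + \<alpha> *\<^sub>R f1)) + (V3 - (- e1 + \<gamma> *\<^sub>R f1))) = U3 - (k * (\<alpha> + \<gamma>)) *\<^sub>R f1"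
      by (simp add: U3_def algebra_simps)
    then show ?thesis by (simp add: k)
  qed
  then have "norm (U3 - f1) \<le> \<bar>k\<bar> * (\<delta> + \<delta>)"
    by (simp only: norm_scaleR) (intro mult_left_mono norm_triangle_mono V; simp)
  then have n3: "norm (U3 - f1) \<le> \<delta>" using k by simp
  have \<delta>0: "0 \<le> \<delta>" using n3 norm_ge_zero order_trans by blast
  have "U1 - e1 = (V1 - (e1 + \<alpha> *\<^sub>R f1)) - \<alpha> *\<^sub>R (U3 - f1)" by (simp add: U1_def algebra_simps)
  then have "norm (U1 - e1) \<le> \<delta> + \<bar>\<alpha>\<bar> * \<delta>"
    by (simp only:) (rule order_trans[OF norm_triangle_ineq4],
        auto intro!: add_mono V mult_left_mono n3)
  also have "\<dots> \<le> \<delta> + 2 * \<delta>" using \<kappa> \<delta>0 by (intro add_left_mono mult_right_mono)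
  finally have n1: "norm (U1 - e1) \<le> 3 * \<delta>" by simp
  have "U2 - e2 = (V2 - (e2 + \<beta> *\<^sub>R f1)) - \<beta> *\<^sub>R (U3 - f1)" by (simp add: U2_def algebra_simps)
  then have "norm (U2 - e2) \<le> \<delta> + \<bar>\<beta>\<bar> * \<delta>"
    by (simp only:) (rule order_trans[OF norm_triangle_ineq4],
        auto intro!: add_mono V mult_left_mono n3)
  also have "\<dots> \<le> \<delta> + 2 * \<delta>" using \<kappa> \<delta>0 by (intro add_left_mono mult_right_mono)
  finally have n2: "norm (U2 - e2) \<le> 3 * \<delta>" by simp
  have Km: "K * x \<le> 1/36" if "x \<le> 3 * \<delta>" for x
  proof -
    have "K * x \<le> K * (3 * \<delta>)" using K that by (intro mult_left_mono) auto
    then show ?thesis using \<delta> by simp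
  qed
  have "norm (U3 - f1) \<le> 3 * \<delta>" using n3 \<delta>0 by simp
  then obtain y where y: "symplectic_form y U1 = r1" "symplectic_form y U2 = r2"
      "symplectic_form y U3 = r3" "norm y \<le> 6 * K * (\<bar>r1\<bar> + \<bar>r2\<bar> + \<bar>r3\<bar>)"
    using frame_solvable[OF fr K(2-4), of U1 U2 U3 r1 r2 r3] Km n1 n2 by blast
  let ?s = "\<bar>\<rho>1\<bar> + \<bar>\<rho>2\<bar> + \<bar>\<rho>3\<bar>"
  have "\<bar>r3\<bar> = \<bar>\<rho>1 + \<rho>3\<bar> / 2" by (simp add: r3_def abs_mult k)
  also have "\<dots> \<le> (\<bar>\<rho>1\<bar> + \<bar>\<rho>3\<bar>) / 2" by (intro divide_right_mono abs_triangle_ineq) auto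
  finally have r3: "\<bar>r3\<bar> \<le> (\<bar>\<rho>1\<bar> + \<bar>\<rho>3\<bar>) / 2" .
  have "\<bar>\<alpha> * r3\<bar> \<le> 2 * \<bar>r3\<bar>" "\<bar>\<beta> * r3\<bar> \<le> 2 * \<bar>r3\<bar>"
    unfolding abs_mult using \<kappa> by (auto intro!: mult_right_mono)
  then have "\<bar>r1\<bar> + \<bar>r2\<bar> + \<bar>r3\<bar> \<le> 4 * ?s"
    using r3 abs_triangle_ineq4[of \<rho>1 "\<alpha> * r3"] abs_triangle_ineq4[of \<rho>2 "\<beta> * r3"]
    unfolding r1_def[symmetric] r2_def[symmetric] by argo
  then have "6 * K * (\<bar>r1\<bar> + \<bar>r2\<bar> + \<bar>r3\<bar>) \<le> 6 * K * (4 * ?s)"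
    using K by (intro mult_left_mono) auto
  then have yn: "norm y \<le> 24 * K * ?s" using y(4) by (simp add: algebra_simps)
  have V1: "V1 = U1 + \<alpha> *\<^sub>R U3" by (simp add: U1_def)
  have V2: "V2 = U2 + \<beta> *\<^sub>R U3" by (simp add: U2_def)
  have "k \<noteq> 0" using k by auto
  then have V3: "V3 = (1/k) *\<^sub>R U3 - V1" by (simp add: U3_def)
  have a1: "symplectic_form y V1 = \<rho>1" by (simp add: V1 symplectic_simps y r1_def)
  have a2: "symplectic_form y V2 = \<rho>2" by (simp add: V2 symplectic_simps y r2_def)
  have "symplectic_form y V3 = \<rho>3"
    by (simp only: V3 symplectic_simps a1 y) (use \<open>k \<noteq> 0\<close> in \<open>simp add: r3_def\<close>)
  then show ?thesis using a1 a2 yn by blast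
qed

text \<open>Half sums of two of the three sides recover \<open>e1\<close> (up to sign),
  \<open>e2\<close> and \<open>f1\<close>, without any loss in \<delta>.\<close>

lemma skew_diamond_solvable:
  assumes fr: "symplectic_frame e1 e2 f1 f2"
    and K: "1 \<le> K" "norm e1 \<le> K" "norm f1 \<le> K" "norm f2 \<le> K"
    and V: "norm (V1 - (e1 + e2 + f1)) \<le> \<delta>" "norm (V2 - (- e1 + e2 - f1)) \<le> \<delta>"
      "norm (V3 - (- e1 - e2 + f1)) \<le> \<delta>"
    and \<delta>: "K * \<delta> \<le> 1/36"
  shows "\<exists>y. symplectic_form y V1 = \<rho>1 \<and> symplectic_form y V2 = \<rho>2 \<and> symplectic_form y V3 = \<rho>3 \<and>
     norm y \<le> 24 * K * (\<bar>\<rho>1\<bar> + \<bar>\<rho>2\<bar> + \<bar>\<rho>3\<bar>)"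
proof -
  define U1 where "U1 = (-1/2) *\<^sub>R (V2 + V3)"
  define U2 where "U2 = (1/2) *\<^sub>R (V1 + V2)"
  define U3 where "U3 = (1/2) *\<^sub>R (V1 + V3)"
  have half: "(1/2) *\<^sub>R x + (1/2) *\<^sub>R x = x" for x :: "(real^'a) \<times> (real^'a)"
    by (simp add: scaleR_left_distrib[symmetric])
  have combine: "norm (c *\<^sub>R (x + y)) \<le> \<delta>" if "\<bar>c\<bar> = 1/2" "norm x \<le> \<delta>" "norm y \<le> \<delta>"
    for x y :: "(real^'a) \<times> (real^'a)" and c
    using that norm_triangle_ineq[of x y] by (simp only: norm_scaleR)
  have "U1 - e1 = (-1/2) *\<^sub>R ((V2 - (- e1 + e2 - f1)) + (V3 - (- e1 - e2 + f1)))"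
    using half[of e1] by (simp add: U1_def algebra_simps)
  then have n1: "norm (U1 - e1) \<le> \<delta>" by (simp only:) (rule combine; use V in simp)
  have "U2 - e2 = (1/2) *\<^sub>R ((V1 - (e1 + e2 + f1)) + (V2 - (- e1 + e2 - f1)))"
    using half[of e2] by (simp add: U2_def algebra_simps)
  then have n2: "norm (U2 - e2) \<le> \<delta>" by (simp only:) (rule combine; use V in simp)
  have "U3 - f1 = (1/2) *\<^sub>R ((V1 - (e1 + e2 + f1)) + (V3 - (- e1 - e2 + f1)))"
    using half[of f1] by (simp add: U3_def algebra_simps)
  then have n3: "norm (U3 - f1) \<le> \<delta>" by (simp only:) (rule combine; use V in simp)
  have Km: "K * x \<le> 1/36" if "x \<le> \<delta>" for x
  proof -
    have "K * x \<le> K * \<delta>" using K that by (intro mult_left_mono) auto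
    then show ?thesis using \<delta> by simp
  qed
  obtain y where y: "symplectic_form y U1 = - (\<rho>2 + \<rho>3)/2" "symplectic_form y U2 = (\<rho>1 + \<rho>2)/2"
      "symplectic_form y U3 = (\<rho>1 + \<rho>3)/2"
      "norm y \<le> 6 * K * (\<bar>- (\<rho>2 + \<rho>3)/2\<bar> + \<bar>(\<rho>1 + \<rho>2)/2\<bar> + \<bar>(\<rho>1 + \<rho>3)/2\<bar>)"
    using frame_solvable[OF fr K(2-4) Km[OF n1] Km[OF n2] Km[OF n3]] by blast
  let ?s = "\<bar>\<rho>1\<bar> + \<bar>\<rho>2\<bar> + \<bar>\<rho>3\<bar>"
  have "\<bar>- (\<rho>2 + \<rho>3)/2\<bar> + \<bar>(\<rho>1 + \<rho>2)/2\<bar> + \<bar>(\<rho>1 + \<rho>3)/2\<bar> \<le> 4 * ?s" by argo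
  then have "6 * K * (\<bar>- (\<rho>2 + \<rho>3)/2\<bar> + \<bar>(\<rho>1 + \<rho>2)/2\<bar> + \<bar>(\<rho>1 + \<rho>3)/2\<bar>) \<le> 6 * K * (4 * ?s)"
    using K by (intro mult_left_mono) auto
  then have yn: "norm y \<le> 24 * K * ?s" using y(4) by (simp add: algebra_simps)
  have "symplectic_form y V1 = \<rho>1 \<and> symplectic_form y V2 = \<rho>2 \<and> symplectic_form y V3 = \<rho>3"
    using y(1-3) by (simp add: U1_def U2_def U3_def symplectic_simps field_simps)
  then show ?thesis using yn by blast
qed

section \<open>The action of curves\<close>

lemma has_vector_derivative_symplectic_form:
  assumes "(c has_vector_derivative c') (at t within S)" "(d has_vector_derivative d') (at t within S)"
  shows "((\<lambda>t. symplectic_form (c t) (d t)) has_vector_derivative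
     (symplectic_form (c t) d' + symplectic_form c' (d t))) (at t within S)"
  by (rule symplectic.has_vector_derivative[OF assms])

lemma continuous_on_symplectic_form [continuous_intros]:
  "continuous_on S c \<Longrightarrow> continuous_on S d \<Longrightarrow> continuous_on S (\<lambda>t. symplectic_form (c t) (d t))"
  by (rule symplectic.continuous_on)

text \<open>Subtracting the chord leaves the integral of \<omega>(c(t) - c(a), c'(t)). To first
  order c(t) - c(a) is a multiple of c'(t), which \<omega> does not see, so the error is \<eta>
  times the square of the length. Action defects are later divided by h^2, and this order is what
  keeps them small.\<close>

lemma action_chord:
  fixes c c' :: "real \<Rightarrow> (real^'n) \<times> (real^'n)"
  assumes ab: "a \<le> b"
    and c: "\<And>t. (c has_vector_derivative c' t) (at t)" "continuous_on UNIV c'"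
    and K: "\<And>t. norm (c' t) \<le> K"
    and \<eta>: "\<And>t. t \<in> {a..b} \<Longrightarrow> norm (c a - c t - (a - t) *\<^sub>R c' t) \<le> \<eta> * (b - a)" "0 \<le> \<eta>"
  shows "\<bar>integral {a..b} (\<lambda>t. symplectic_form (c t) (c' t)) - symplectic_form (c a) (c b)\<bar>
    \<le> 2 * K * \<eta> * (b - a)^2"
proof -
  have contc: "continuous_on S c" for S
    by (meson c(1) continuous_at_imp_continuous_on has_vector_derivative_continuous)
  have contc': "continuous_on S c'" for S using c(2) continuous_on_subset by blast
  have "((\<lambda>t. symplectic_form (c a) (c' t)) has_integral
      symplectic_form (c a) (c b) - symplectic_form (c a) (c a)) {a..b}"
  proof (rule fundamental_theorem_of_calculus[OF ab])
    show "((\<lambda>t. symplectic_form (c a) (c t)) has_vector_derivative symplectic_form (c a) (c' t))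
        (at t within {a..b})" for t
      using has_vector_derivative_symplectic_form[OF has_vector_derivative_const[of "c a"]
          has_vector_derivative_at_within[OF c(1)]]
      by (simp add: symplectic_simps)
  qed
  then have "((\<lambda>t. symplectic_form (c a) (c' t)) has_integral symplectic_form (c a) (c b)) {a..b}"
    by simp
  moreover have "((\<lambda>t. symplectic_form (c t) (c' t)) has_integral
      integral {a..b} (\<lambda>t. symplectic_form (c t) (c' t))) {a..b}"
    by (intro integrable_integral integrable_continuous_real continuous_intros contc contc')
  ultimately have int: "((\<lambda>t. symplectic_form (c t) (c' t) - symplectic_form (c a) (c' t)) has_integral
      integral {a..b} (\<lambda>t. symplectic_form (c t) (c' t)) - symplectic_form (c a) (c b)) {a..b}"
    by (intro has_integral_diff)
  have K0: "0 \<le> K" using K[of 0] norm_ge_zero order_trans by blast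
  have "norm (symplectic_form (c t) (c' t) - symplectic_form (c a) (c' t)) \<le> 2 * K * \<eta> * (b - a)"
    if t: "t \<in> {a..b}" for t
  proof -
    have "symplectic_form (c t) (c' t) - symplectic_form (c a) (c' t)
        = - symplectic_form (c a - c t - (a - t) *\<^sub>R c' t) (c' t)"
      by (simp add: symplectic_simps)
    then have "norm (symplectic_form (c t) (c' t) - symplectic_form (c a) (c' t))
        \<le> 2 * (norm (c a - c t - (a - t) *\<^sub>R c' t) * norm (c' t))"
      by (simp only: norm_minus_cancel real_norm_def abs_minus_cancel) (rule abs_symplectic_form_le)
    also have "\<dots> \<le> 2 * ((\<eta> * (b - a)) * K)"
      by (intro mult_left_mono mult_mono \<eta>(1)[OF t] K mult_nonneg_nonneg \<eta>(2)) (use ab in auto)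
    finally show ?thesis by (simp add: mult_ac)
  qed
  then have "norm (integral {a..b} (\<lambda>t. symplectic_form (c t) (c' t)) - symplectic_form (c a) (c b))
      \<le> 2 * K * \<eta> * (b - a) * measure lborel {a..b}"
    using ab K0 \<eta>(2) by (intro has_integral_bound_real[OF _ finite.emptyI int]) auto
  then show ?thesis using ab by (simp add: power2_eq_square mult_ac)
qed

text \<open>A substitute for Stokes on the strip between two curves: the derivative of \<omega>(c,
  d) is the mixed part of \<omega>(d - c, d' + c'). No derivative across the strip occurs.\<close>

lemma action_strip:
  fixes c d c' d' :: "real \<Rightarrow> (real^'n) \<times> (real^'n)"
  assumes ab: "a \<le> b"
    and c: "\<And>t. (c has_vector_derivative c' t) (at t)" "continuous_on UNIV c'"
    and d: "\<And>t. (d has_vector_derivative d' t) (at t)" "continuous_on UNIV d'"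
  shows "((\<lambda>t. symplectic_form (d t - c t) (d' t + c' t)) has_integral
      (integral {a..b} (\<lambda>t. symplectic_form (d t) (d' t)) - integral {a..b} (\<lambda>t. symplectic_form (c t) (c' t))
        - (symplectic_form (c b) (d b) - symplectic_form (c a) (d a)))) {a..b}"
proof -
  have contc: "continuous_on S c" "continuous_on S d" for S
    by (meson c(1) d(1) continuous_at_imp_continuous_on has_vector_derivative_continuous)+
  have contc': "continuous_on S c'" "continuous_on S d'" for S
    using c(2) d(2) continuous_on_subset by blast+
  have 1: "((\<lambda>t. symplectic_form (c t) (d' t) + symplectic_form (c' t) (d t)) has_integral
      symplectic_form (c b) (d b) - symplectic_form (c a) (d a)) {a..b}"
    by (intro fundamental_theorem_of_calculus[OF ab]
        has_vector_derivative_at_within[OF has_vector_derivative_symplectic_form[OF c(1) d(1)]])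
  have 2: "((\<lambda>t. symplectic_form (g t) (g' t)) has_integral
      integral {a..b} (\<lambda>t. symplectic_form (g t) (g' t))) {a..b}"
    if "continuous_on {a..b} g" "continuous_on {a..b} g'" for g g' :: "real \<Rightarrow> (real^'n) \<times> (real^'n)"
    using that by (intro integrable_integral integrable_continuous_real continuous_on_symplectic_form)
  have eq: "symplectic_form (d t - c t) (d' t + c' t)
      = symplectic_form (d t) (d' t) - symplectic_form (c t) (c' t)
        - (symplectic_form (c t) (d' t) + symplectic_form (c' t) (d t))" for t
    using symplectic_form_skew[of "c' t" "d t"] by (simp add: symplectic_simps)
  show ?thesis
    unfolding eq by (rule has_integral_diff[OF has_integral_diff[OF 2[OF contc(2) contc'(2)] 2[OF contc(1) contc'(1)]] 1])
qed

section \<open>Periodic isotropic maps\<close>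

lemma abs_fst_le_norm: "\<bar>fst v\<bar> \<le> norm v" and abs_snd_le_norm: "\<bar>snd v\<bar> \<le> norm v"
  for v :: "real \<times> real"
  using norm_fst_le[of "fst v" "snd v"] norm_snd_le[of "snd v" "fst v"] by auto

text \<open>One and the same shift serves all points at distance at most 1 from x, so that a pair of
  close points can be moved into a fixed compact square together.\<close>

lemma periodic_compact_shift:
  fixes x :: "real \<times> real"
  obtains i j :: int where "\<And>y. norm (y - x) \<le> 1 \<Longrightarrow> y + (of_int i, of_int j) \<in> {-1..2} \<times> {-1..2}"
proof
  fix y assume y: "norm (y - x) \<le> 1"
  have "\<bar>fst (y - x)\<bar> \<le> 1" "\<bar>snd (y - x)\<bar> \<le> 1"
    using y order_trans[OF abs_fst_le_norm] order_trans[OF abs_snd_le_norm] by blast+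
  then show "y + (of_int (- \<lfloor>fst x\<rfloor>), of_int (- \<lfloor>snd x\<rfloor>)) \<in> {-1..2} \<times> {-1..2}"
    by (cases x; cases y; simp) linarith
qed

lemma periodic_bounded:
  fixes g :: "real \<times> real \<Rightarrow> 'a::real_normed_vector"
  assumes "continuous_on UNIV g" "\<And>x i j. g (x + (of_int i, of_int j)) = g x"
  shows "\<exists>K\<ge>1. \<forall>x. norm (g x) \<le> K"
proof -
  have "compact (g ` ({-1..2} \<times> {-1..2}))"
    by (intro compact_continuous_image continuous_on_subset[OF assms(1)] compact_Times) auto
  then obtain K where K: "\<And>z. z \<in> {-1..2} \<times> {-1..2} \<Longrightarrow> norm (g z) \<le> K"
    by (meson bounded_iff compact_imp_bounded imageI)
  have "norm (g x) \<le> max 1 K" for x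
  proof -
    obtain i j :: int where "x + (of_int i, of_int j) \<in> {-1..2} \<times> {-1..2}"
      using periodic_compact_shift[of x] by (metis diff_self norm_zero zero_le_one)
    from K[OF this] show ?thesis by (simp add: assms(2))
  qed
  then show ?thesis by (intro exI[of _ "max 1 K"]) auto
qed

lemma periodic_uniformly_continuous:
  fixes g :: "real \<times> real \<Rightarrow> 'a::real_normed_vector"
  assumes "continuous_on UNIV g" "\<And>x i j. g (x + (of_int i, of_int j)) = g x" "\<eta> > 0"
  shows "\<exists>r>0. \<forall>x y. norm (y - x) \<le> r \<longrightarrow> norm (g y - g x) \<le> \<eta>"
proof -
  have "uniformly_continuous_on ({-1..2} \<times> {-1..2}) g"
    by (intro compact_uniformly_continuous continuous_on_subset[OF assms(1)] compact_Times) auto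
  then obtain d where d: "d > 0" "\<And>x y. x \<in> {-1..2} \<times> {-1..2} \<Longrightarrow> y \<in> {-1..2} \<times> {-1..2}
      \<Longrightarrow> dist y x < d \<Longrightarrow> dist (g y) (g x) < \<eta>"
    unfolding uniformly_continuous_on_def using assms(3) by metis
  show ?thesis
  proof (intro exI[of _ "min (d/2) 1"] conjI allI impI)
    show "0 < min (d/2) 1" using d by auto
    fix x y :: "real \<times> real" assume xy: "norm (y - x) \<le> min (d/2) 1"
    obtain i j :: int where ij: "\<And>y. norm (y - x) \<le> 1 \<Longrightarrow> y + (of_int i, of_int j) \<in> {-1..2} \<times> {-1..2}"
      using periodic_compact_shift[of x] by blast
    have "dist (g (y + (of_int i, of_int j))) (g (x + (of_int i, of_int j))) < \<eta>"
      by (intro d ij) (use xy d in \<open>auto simp: dist_norm\<close>)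
    then show "norm (g y - g x) \<le> \<eta>" by (simp add: assms(2) dist_norm)
  qed
qed

text \<open>Only first derivatives of F enter, and \<open>f1\<close>, \<open>f2\<close> are merely
  continuous. All estimates are therefore of little-o type, by uniform continuity.\<close>

locale periodic_isotropic =
  fixes F e1 e2 f1 f2 :: "real \<times> real \<Rightarrow> (real^'n) \<times> (real^'n)"
  assumes deriv: "\<And>x. (F has_derivative (\<lambda>v. fst v *\<^sub>R e1 x + snd v *\<^sub>R e2 x)) (at x)"
    and cont: "continuous_on UNIV e1" "continuous_on UNIV e2" "continuous_on UNIV f1" "continuous_on UNIV f2"
    and periodic: "\<And>x i j. F (x + (of_int i, of_int j)) = F x"
      "\<And>x i j. e1 (x + (of_int i, of_int j)) = e1 x" "\<And>x i j. e2 (x + (of_int i, of_int j)) = e2 x"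
      "\<And>x i j. f1 (x + (of_int i, of_int j)) = f1 x" "\<And>x i j. f2 (x + (of_int i, of_int j)) = f2 x"
    and frame: "\<And>x. symplectic_frame (e1 x) (e2 x) (f1 x) (f2 x)"
begin

lemma cont_F: "continuous_on S F"
  by (meson deriv continuous_at_imp_continuous_on has_derivative_continuous)

lemma bound: "\<exists>K\<ge>1. \<forall>x. norm (F x) \<le> K \<and> norm (e1 x) \<le> K \<and> norm (e2 x) \<le> K \<and> norm (f1 x) \<le> K \<and> norm (f2 x) \<le> K"
proof -
  obtain K0 K1 K2 K3 K4 where K: "K0 \<ge> 1" "\<And>x. norm (F x) \<le> K0" "\<And>x. norm (e1 x) \<le> K1"
    "\<And>x. norm (e2 x) \<le> K2" "\<And>x. norm (f1 x) \<le> K3" "\<And>x. norm (f2 x) \<le> K4"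
    using periodic_bounded[OF cont_F periodic(1)] periodic_bounded[OF cont(1) periodic(2)]
      periodic_bounded[OF cont(2) periodic(3)] periodic_bounded[OF cont(3) periodic(4)]
      periodic_bounded[OF cont(4) periodic(5)] by metis
  let ?K = "Max {K0, K1, K2, K3, K4}"
  have "K0 \<le> ?K" "K1 \<le> ?K" "K2 \<le> ?K" "K3 \<le> ?K" "K4 \<le> ?K" by auto
  moreover have "1 \<le> ?K" using K(1) by (rule order_trans) auto
  ultimately show ?thesis using K(2-) by (intro exI[of _ ?K] conjI allI; blast intro: order_trans)
qed

lemma uniform:
  assumes "\<eta> > 0"
  shows "\<exists>r>0. \<forall>x y. norm (y - x) \<le> r \<longrightarrow> norm (e1 y - e1 x) \<le> \<eta> \<and> norm (e2 y - e2 x) \<le> \<eta>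
     \<and> norm (f1 y - f1 x) \<le> \<eta> \<and> norm (f2 y - f2 x) \<le> \<eta>"
proof -
  obtain r1 r2 r3 r4 where r: "r1 > 0" "\<And>x y. norm (y - x) \<le> r1 \<Longrightarrow> norm (e1 y - e1 x) \<le> \<eta>"
    "r2 > 0" "\<And>x y. norm (y - x) \<le> r2 \<Longrightarrow> norm (e2 y - e2 x) \<le> \<eta>"
    "r3 > 0" "\<And>x y. norm (y - x) \<le> r3 \<Longrightarrow> norm (f1 y - f1 x) \<le> \<eta>"
    "r4 > 0" "\<And>x y. norm (y - x) \<le> r4 \<Longrightarrow> norm (f2 y - f2 x) \<le> \<eta>"
    using periodic_uniformly_continuous[OF cont(1) periodic(2) assms]
      periodic_uniformly_continuous[OF cont(2) periodic(3) assms]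
      periodic_uniformly_continuous[OF cont(3) periodic(4) assms]
      periodic_uniformly_continuous[OF cont(4) periodic(5) assms] by metis
  let ?r = "min (min r1 r2) (min r3 r4)"
  show ?thesis by (intro exI[of _ ?r]) (use r in auto)
qed

lemma taylor:
  assumes "\<eta> > 0"
  shows "\<exists>r>0. \<forall>x y. norm (y - x) \<le> r \<longrightarrow>
     norm (F y - F x - (fst (y - x) *\<^sub>R e1 x + snd (y - x) *\<^sub>R e2 x)) \<le> \<eta> * norm (y - x)"
proof -
  obtain r where r: "r > 0" "\<And>x y. norm (y - x) \<le> r \<Longrightarrow> norm (e1 y - e1 x) \<le> \<eta>/2 \<and> norm (e2 y - e2 x) \<le> \<eta>/2"
    using uniform[of "\<eta>/2"] assms by auto
  show ?thesis
  proof (intro exI[of _ r] conjI allI impI r)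
    fix x y :: "real \<times> real" assume xy: "norm (y - x) \<le> r"
    \<comment> \<open>The mean value inequality is applied to F minus its linear part at x.\<close>
    define g where "g z = F z - (fst z *\<^sub>R e1 x + snd z *\<^sub>R e2 x)" for z
    define g' where "g' z v = fst v *\<^sub>R (e1 z - e1 x) + snd v *\<^sub>R (e2 z - e2 x)" for z v
    have "norm (g y - g x) \<le> \<eta> * norm (y - x)"
    proof (rule differentiable_bound[of "closed_segment x y"])
      show "(g has_derivative g' z) (at z within closed_segment x y)" for z
        unfolding g_def g'_def
        by (rule derivative_eq_intros has_derivative_at_withinI[OF deriv] refl | simp add: algebra_simps)+
      fix z assume z: "z \<in> closed_segment x y"
      then have "norm (z - x) \<le> r"
        using xy segment_bound(1)[OF z] by linarith
      note e = r(2)[OF this]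
      show "onorm (g' z) \<le> \<eta>"
      proof (rule onorm_le)
        fix v :: "real \<times> real"
        have "norm (g' z v) \<le> \<bar>fst v\<bar> * norm (e1 z - e1 x) + \<bar>snd v\<bar> * norm (e2 z - e2 x)"
          unfolding g'_def by (rule order_trans[OF norm_triangle_ineq]) simp
        also have "\<dots> \<le> norm v * (\<eta>/2) + norm v * (\<eta>/2)"
          using e by (intro add_mono mult_mono abs_fst_le_norm abs_snd_le_norm) auto
        finally show "norm (g' z v) \<le> \<eta> * norm v" by (simp add: algebra_simps)
      qed
    qed auto
    moreover have "g y - g x = F y - F x - (fst (y - x) *\<^sub>R e1 x + snd (y - x) *\<^sub>R e2 x)"
      by (simp add: g_def algebra_simps)
    ultimately show "norm (F y - F x - (fst (y - x) *\<^sub>R e1 x + snd (y - x) *\<^sub>R e2 x)) \<le> \<eta> * norm (y - x)"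
      by simp
  qed
qed

section \<open>Actions of coordinate segments and their closedness\<close>

lemma deriv_fst: "((\<lambda>s. F (s, t)) has_vector_derivative e1 (s, t)) (at s)"
proof -
  have "((\<lambda>s. (s, t)) has_derivative (\<lambda>s. (s, 0))) (at s)" by (auto intro!: derivative_eq_intros)
  from has_derivative_compose[OF this deriv] show ?thesis by (simp add: has_vector_derivative_def)
qed

lemma deriv_snd: "((\<lambda>t. F (s, t)) has_vector_derivative e2 (s, t)) (at t)"
proof -
  have "((\<lambda>t. (s, t)) has_derivative (\<lambda>t. (0, t))) (at t)" by (auto intro!: derivative_eq_intros)
  from has_derivative_compose[OF this deriv] show ?thesis by (simp add: has_vector_derivative_def)
qed

lemma cont_slice_F: "continuous_on S (\<lambda>s. F (s, t))" "continuous_on S (\<lambda>t. F (s, t))"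
  by (intro continuous_on_compose2[OF cont_F[of UNIV]] continuous_intros; simp)+

lemma cont_slice:
  "continuous_on S (\<lambda>s. e1 (s, t))" "continuous_on S (\<lambda>t. e1 (s, t))"
  "continuous_on S (\<lambda>s. e2 (s, t))" "continuous_on S (\<lambda>t. e2 (s, t))"
  by (intro continuous_on_compose2[OF cont(1)] continuous_on_compose2[OF cont(2)] continuous_intros; simp)+

definition hor_action where
  "hor_action s0 s1 t = integral {s0..s1} (\<lambda>s. symplectic_form (F (s, t)) (e1 (s, t)))"

definition ver_action where
  "ver_action s t0 t1 = integral {t0..t1} (\<lambda>t. symplectic_form (F (s, t)) (e2 (s, t)))"

lemma hor_action_chord:
  assumes "\<eta> > 0"
  obtains r where "r > 0" "\<And>s0 s1 t. s0 \<le> s1 \<Longrightarrow> s1 - s0 \<le> r \<Longrightarrow>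
    \<bar>hor_action s0 s1 t - symplectic_form (F (s0, t)) (F (s1, t))\<bar> \<le> \<eta> * (s1 - s0)^2"
proof -
  obtain K where K: "K \<ge> 1" "\<And>x. norm (e1 x) \<le> K" using bound by blast
  obtain r where r: "r > 0" "\<And>x y. norm (y - x) \<le> r \<Longrightarrow>
     norm (F y - F x - (fst (y - x) *\<^sub>R e1 x + snd (y - x) *\<^sub>R e2 x)) \<le> \<eta>/(2*K) * norm (y - x)"
    using taylor[of "\<eta>/(2*K)"] assms K by auto
  show ?thesis
  proof (rule that[OF r(1)])
    fix s0 s1 t :: real assume s: "s0 \<le> s1" "s1 - s0 \<le> r"
    have "norm (F (s0, t) - F (\<sigma>, t) - (s0 - \<sigma>) *\<^sub>R e1 (\<sigma>, t)) \<le> \<eta>/(2*K) * (s1 - s0)"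
      if "\<sigma> \<in> {s0..s1}" for \<sigma>
    proof -
      have "norm (F (s0, t) - F (\<sigma>, t) - (s0 - \<sigma>) *\<^sub>R e1 (\<sigma>, t)) \<le> \<eta>/(2*K) * \<bar>s0 - \<sigma>\<bar>"
        using r(2)[of "(s0, t)" "(\<sigma>, t)"] s that by simp
      also have "\<dots> \<le> \<eta>/(2*K) * (s1 - s0)" using that assms K by (intro mult_left_mono) auto
      finally show ?thesis .
    qed
    then show "\<bar>hor_action s0 s1 t - symplectic_form (F (s0, t)) (F (s1, t))\<bar> \<le> \<eta> * (s1 - s0)^2"
      using action_chord[OF s(1) deriv_fst cont_slice(1), of t K "\<eta>/(2*K)"] K assms
      by (simp add: hor_action_def)
  qed
qed

lemma ver_action_chord:
  assumes "\<eta> > 0"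
  obtains r where "r > 0" "\<And>s t0 t1. t0 \<le> t1 \<Longrightarrow> t1 - t0 \<le> r \<Longrightarrow>
    \<bar>ver_action s t0 t1 - symplectic_form (F (s, t0)) (F (s, t1))\<bar> \<le> \<eta> * (t1 - t0)^2"
proof -
  obtain K where K: "K \<ge> 1" "\<And>x. norm (e2 x) \<le> K" using bound by blast
  obtain r where r: "r > 0" "\<And>x y. norm (y - x) \<le> r \<Longrightarrow>
     norm (F y - F x - (fst (y - x) *\<^sub>R e1 x + snd (y - x) *\<^sub>R e2 x)) \<le> \<eta>/(2*K) * norm (y - x)"
    using taylor[of "\<eta>/(2*K)"] assms K by auto
  show ?thesis
  proof (rule that[OF r(1)])
    fix s t0 t1 :: real assume t: "t0 \<le> t1" "t1 - t0 \<le> r"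
    have "norm (F (s, t0) - F (s, \<tau>) - (t0 - \<tau>) *\<^sub>R e2 (s, \<tau>)) \<le> \<eta>/(2*K) * (t1 - t0)"
      if "\<tau> \<in> {t0..t1}" for \<tau>
    proof -
      have "norm (F (s, t0) - F (s, \<tau>) - (t0 - \<tau>) *\<^sub>R e2 (s, \<tau>)) \<le> \<eta>/(2*K) * \<bar>t0 - \<tau>\<bar>"
        using r(2)[of "(s, t0)" "(s, \<tau>)"] t that by simp
      also have "\<dots> \<le> \<eta>/(2*K) * (t1 - t0)" using that assms K by (intro mult_left_mono) auto
      finally show ?thesis .
    qed
    then show "\<bar>ver_action s t0 t1 - symplectic_form (F (s, t0)) (F (s, t1))\<bar> \<le> \<eta> * (t1 - t0)^2"
      using action_chord[OF t(1) deriv_snd cont_slice(4), of s K "\<eta>/(2*K)"] K assms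
      by (simp add: ver_action_def)
  qed
qed

text \<open>Infinitesimal Stokes for a map that is only C^1. \<open>action_strip\<close> expresses
  the difference of two vertical actions by end terms, which give the derivative, and an integral
  over a thin strip. By isotropy the latter is of smaller order than the width k of the
  strip.\<close>

lemma ver_action_deriv:
  assumes t: "t0 \<le> t1"
  shows "((\<lambda>s. ver_action s t0 t1) has_real_derivative
     (symplectic_form (F (s, t1)) (e1 (s, t1)) - symplectic_form (F (s, t0)) (e1 (s, t0)))) (at s)"
  unfolding has_field_derivative_def has_derivative_at_alt
proof (intro conjI allI impI bounded_linear_mult_right)
  let ?D = "symplectic_form (F (s, t1)) (e1 (s, t1)) - symplectic_form (F (s, t0)) (e1 (s, t0))"
  fix e :: real assume "e > 0"
  obtain K where K: "K \<ge> 1" "\<And>x. norm (F x) \<le> K" "\<And>x. norm (e1 x) \<le> K" "\<And>x. norm (e2 x) \<le> K"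
    using bound by blast
  \<comment> \<open>The strip integral contributes 6 K (t1 - t0), each of the two end terms 2
    K.\<close>
  define C where "C = 4 * K + 6 * K * (t1 - t0)"
  define \<eta> where "\<eta> = e / C"
  have C: "C > 0" using K t by (auto simp: C_def intro!: add_pos_nonneg)
  have \<eta>: "\<eta> > 0" "\<eta> * C = e" using \<open>e > 0\<close> C by (auto simp: \<eta>_def)
  obtain r1 where r1: "r1 > 0" "\<And>x y. norm (y - x) \<le> r1 \<Longrightarrow>
     norm (F y - F x - (fst (y - x) *\<^sub>R e1 x + snd (y - x) *\<^sub>R e2 x)) \<le> \<eta> * norm (y - x)"
    using taylor[OF \<eta>(1)] by blast
  obtain r2 where r2: "r2 > 0" "\<And>x y. norm (y - x) \<le> r2 \<Longrightarrow> norm (e2 y - e2 x) \<le> \<eta>"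
    using uniform[OF \<eta>(1)] by blast
  show "\<exists>d>0. \<forall>y. norm (y - s) < d \<longrightarrow>
     norm (ver_action y t0 t1 - ver_action s t0 t1 - ?D * (y - s)) \<le> e * norm (y - s)"
  proof (intro exI[of _ "min r1 r2"] conjI allI impI)
    show "0 < min r1 r2" using r1 r2 by simp
    fix y assume y: "norm (y - s) < min r1 r2"
    define k where "k = y - s"
    have R1: "norm (F (y, t) - F (s, t) - k *\<^sub>R e1 (s, t)) \<le> \<eta> * \<bar>k\<bar>" for t
      using r1(2)[of "(y, t)" "(s, t)"] y by (simp add: k_def)
    have R2: "norm (e2 (y, t) - e2 (s, t)) \<le> \<eta>" for t
      using r2(2)[of "(y, t)" "(s, t)"] y by simp
    have R3: "\<bar>symplectic_form (F (s, t)) (F (y, t)) - k * symplectic_form (F (s, t)) (e1 (s, t))\<bar>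
        \<le> 2 * K * \<eta> * \<bar>k\<bar>" for t
    proof -
      have "symplectic_form (F (s, t)) (F (y, t)) - k * symplectic_form (F (s, t)) (e1 (s, t))
          = symplectic_form (F (s, t)) (F (y, t) - F (s, t) - k *\<^sub>R e1 (s, t))"
        by (simp add: symplectic_simps)
      also have "\<bar>\<dots>\<bar> \<le> 2 * (K * (\<eta> * \<bar>k\<bar>))"
        by (rule order_trans[OF abs_symplectic_form_le])
          (intro mult_left_mono mult_mono K R1; use K in simp)
      finally show ?thesis by (simp add: mult_ac)
    qed
    have R4: "norm (symplectic_form (F (y, t) - F (s, t)) (e2 (y, t) + e2 (s, t))) \<le> 6 * K * \<eta> * \<bar>k\<bar>" for t
    proof -
      let ?R1 = "F (y, t) - F (s, t) - k *\<^sub>R e1 (s, t)" and ?R2 = "e2 (y, t) - e2 (s, t)"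
      \<comment> \<open>Isotropy enters here: \<omega>(e1, e2) vanishes at (s, t), so the sum of the
        two values of \<open>e2\<close> may be replaced by their difference.\<close>
      have "symplectic_form (F (y, t) - F (s, t)) (e2 (y, t) + e2 (s, t))
          = symplectic_form ?R1 (e2 (y, t) + e2 (s, t)) + k * symplectic_form (e1 (s, t)) ?R2"
        by (simp add: symplectic_simps symplectic_frameD[OF frame] algebra_simps)
      also have "norm \<dots> \<le> 2 * (norm ?R1 * norm (e2 (y, t) + e2 (s, t))) + \<bar>k\<bar> * (2 * (norm (e1 (s, t)) * norm ?R2))"
        unfolding real_norm_def
        by (intro order_trans[OF abs_triangle_ineq] add_mono abs_symplectic_form_le)
          (simp add: abs_mult mult_left_mono abs_symplectic_form_le)
      also have "\<dots> \<le> 2 * ((\<eta> * \<bar>k\<bar>) * (K + K)) + \<bar>k\<bar> * (2 * (K * \<eta>))"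
        using K(1) \<eta>(1) by (intro add_mono mult_left_mono mult_mono R1 R2 K norm_triangle_mono) auto
      finally show ?thesis by (simp add: algebra_simps)
    qed
    let ?I = "ver_action y t0 t1 - ver_action s t0 t1 - (symplectic_form (F (s, t1)) (F (y, t1))
       - symplectic_form (F (s, t0)) (F (y, t0)))"
    have "((\<lambda>t. symplectic_form (F (y, t) - F (s, t)) (e2 (y, t) + e2 (s, t))) has_integral ?I) {t0..t1}"
      unfolding ver_action_def by (rule action_strip[OF t deriv_snd cont_slice(4) deriv_snd cont_slice(4)])
    then have "norm ?I \<le> 6 * K * \<eta> * \<bar>k\<bar> * measure lborel {t0..t1}"
      using K(1) \<eta>(1) by (intro has_integral_bound_real[OF _ finite.emptyI _ R4]) auto
    then have I: "\<bar>?I\<bar> \<le> 6 * K * \<eta> * \<bar>k\<bar> * (t1 - t0)" using t by simp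
    have "ver_action y t0 t1 - ver_action s t0 t1 - ?D * (y - s) = ?I
      + (symplectic_form (F (s, t1)) (F (y, t1)) - k * symplectic_form (F (s, t1)) (e1 (s, t1)))
      - (symplectic_form (F (s, t0)) (F (y, t0)) - k * symplectic_form (F (s, t0)) (e1 (s, t0)))"
      by (simp add: k_def algebra_simps)
    then have "norm (ver_action y t0 t1 - ver_action s t0 t1 - ?D * (y - s))
        \<le> 6 * K * \<eta> * \<bar>k\<bar> * (t1 - t0) + 2 * K * \<eta> * \<bar>k\<bar> + 2 * K * \<eta> * \<bar>k\<bar>"
      using I R3[of t1] R3[of t0] unfolding real_norm_def by argo
    also have "\<dots> = \<eta> * C * \<bar>k\<bar>" by (simp add: C_def algebra_simps)
    finally show "norm (ver_action y t0 t1 - ver_action s t0 t1 - ?D * (y - s)) \<le> e * norm (y - s)"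
      by (simp add: \<eta> k_def)
  qed
qed

text \<open>Closedness of \<omega>(F, dF) over a rectangle: as a function of the right end s the
  circulation, apart from the left edge, has derivative zero, and at \<open>s0\<close> it consists
  of the left edge alone.\<close>

lemma action_closed:
  assumes "s0 \<le> s1" "t0 \<le> t1"
  shows "hor_action s0 s1 t0 + ver_action s1 t0 t1 = hor_action s0 s1 t1 + ver_action s0 t0 t1"
proof -
  define \<Phi> where "\<Phi> s = hor_action s0 s t0 + ver_action s t0 t1 - hor_action s0 s t1" for s
  have hor: "((\<lambda>s. hor_action s0 s t) has_real_derivative symplectic_form (F (s, t)) (e1 (s, t)))
      (at s within {s0..s1})" if "s \<in> {s0..s1}" for s t
    unfolding hor_action_def
    by (rule integral_has_real_derivative[OF _ that])
      (rule continuous_on_symplectic_form[OF cont_slice_F(1) cont_slice(1)])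
  have "(\<Phi> has_real_derivative 0) (at s within {s0..s1})" if "s \<in> {s0..s1}" for s
  proof -
    have "(\<Phi> has_real_derivative (symplectic_form (F (s, t0)) (e1 (s, t0))
        + (symplectic_form (F (s, t1)) (e1 (s, t1)) - symplectic_form (F (s, t0)) (e1 (s, t0)))
        - symplectic_form (F (s, t1)) (e1 (s, t1)))) (at s within {s0..s1})"
      unfolding \<Phi>_def
      by (intro DERIV_add DERIV_diff hor that DERIV_subset[OF ver_action_deriv] assms) auto
    then show ?thesis by simp
  qed
  then obtain c where "\<And>s. s \<in> {s0..s1} \<Longrightarrow> \<Phi> s = c"
    using has_field_derivative_zero_constant[of "{s0..s1}" \<Phi>] by auto
  then have "\<Phi> s1 = \<Phi> s0" using assms by auto
  then show ?thesis by (simp add: \<Phi>_def hor_action_def)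
qed

lemma hor_action_periodic:
  "hor_action (s0 + of_int i) (s1 + of_int i) (t + of_int j) = hor_action s0 s1 t"
proof -
  have "integral {s0 + of_int i..s1 + of_int i} (\<lambda>s. symplectic_form (F (s, t + of_int j)) (e1 (s, t + of_int j)))
      = integral {s0..s1} ((\<lambda>s. symplectic_form (F (s, t + of_int j)) (e1 (s, t + of_int j))) \<circ> (\<lambda>s. s + of_int i))"
    by (rule integral_shift[symmetric]) (rule continuous_on_symplectic_form[OF cont_slice_F(1) cont_slice(1)])
  also have "\<dots> = hor_action s0 s1 t"
    unfolding hor_action_def
    by (rule integral_cong) (simp add: periodic(1,2)[of "(s, t)" i j for s, simplified])
  finally show ?thesis by (simp add: hor_action_def)
qed

lemma ver_action_periodic:
  "ver_action (s + of_int i) (t0 + of_int j) (t1 + of_int j) = ver_action s t0 t1"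
proof -
  have "integral {t0 + of_int j..t1 + of_int j} (\<lambda>t. symplectic_form (F (s + of_int i, t)) (e2 (s + of_int i, t)))
      = integral {t0..t1} ((\<lambda>t. symplectic_form (F (s + of_int i, t)) (e2 (s + of_int i, t))) \<circ> (\<lambda>t. t + of_int j))"
    by (rule integral_shift[symmetric]) (rule continuous_on_symplectic_form[OF cont_slice_F(2) cont_slice(4)])
  also have "\<dots> = ver_action s t0 t1"
    unfolding ver_action_def
    by (rule integral_cong) (simp add: periodic(1,3)[of "(s, t)" i j for t, simplified])
  finally show ?thesis by (simp add: ver_action_def)
qed

end

section \<open>Solving the isotropy equations near the model\<close>

text \<open>The isotropy equations hold exactly in the model. This bounds their residuals at points
  within \<eta> of the model, which are the right-hand sides of the linear systems.\<close>

lemma symplectic_form_near_zero: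
  assumes "symplectic_form A0 B0 = 0" "norm (A - A0) \<le> \<eta>" "norm (B - B0) \<le> \<eta>"
    "norm A0 \<le> L" "norm B0 \<le> L" "\<eta> \<le> 1"
  shows "\<bar>symplectic_form A B\<bar> \<le> (4 * L + 2) * \<eta>"
proof -
  have \<eta>0: "0 \<le> \<eta>" "0 \<le> L" using assms norm_ge_zero order_trans by blast+
  have "norm B \<le> norm B0 + norm (B - B0)" by (metis norm_triangle_sub)
  then have B: "norm B \<le> L + 1" using assms by linarith
  have "symplectic_form A B = symplectic_form (A - A0) B + symplectic_form A0 (B - B0)"
    using assms(1) by (simp add: symplectic_simps)
  also have "\<bar>\<dots>\<bar> \<le> 2 * (norm (A - A0) * norm B) + 2 * (norm A0 * norm (B - B0))"
    by (intro order_trans[OF abs_triangle_ineq] add_mono abs_symplectic_form_le)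
  also have "\<dots> \<le> 2 * (\<eta> * (L + 1)) + 2 * (L * \<eta>)"
    using \<eta>0 by (intro add_mono mult_left_mono mult_mono assms B) auto
  finally show ?thesis by (simp add: algebra_simps)
qed

text \<open>In a frame at the midpoint the edge runs from about - e to e, and the midpoint m may
  move along g. The term quadratic in t vanishes, so t solves a scalar equation whose coefficient
  \<omega>(g, Y - X) is close to - 2, hence at most - 1. The numerator is bounded by (8 K + 3)
  \<eta>, which gives 11 K \<eta>, and \<open>norm g\<close> contributes the other factor K.\<close>

lemma edge_adjustment:
  fixes e m g :: "(real^'n) \<times> (real^'n)"
  assumes K: "1 \<le> K" "norm e \<le> K" "norm m \<le> K" "norm g \<le> K"
    and em: "symplectic_form e m = 0" "symplectic_form g e = - 1"
    and X: "norm (X + e) \<le> \<eta>" "norm (Y - e) \<le> \<eta>" and a: "\<bar>a\<bar> \<le> \<eta>" and \<eta>: "4 * K * \<eta> \<le> 1"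
    and t: "t = (a + symplectic_form (X - m) (Y - m)) / symplectic_form g (Y - X)"
  shows "symplectic_form (X - (m + t *\<^sub>R g)) (Y - (m + t *\<^sub>R g)) = - a"
    and "norm (t *\<^sub>R g) \<le> 11 * K^2 * \<eta>"
proof -
  have \<eta>0: "0 \<le> \<eta>" using a by linarith
  have "\<eta> \<le> K * \<eta>" using K \<eta>0 mult_right_mono[of 1 K \<eta>] by simp
  then have \<eta>1: "\<eta> \<le> 1" using \<eta> by linarith
  have "norm ((Y - X) - 2 *\<^sub>R e) \<le> norm (Y - e) + norm (X + e)"
  proof -
    have "(Y - X) - 2 *\<^sub>R e = (Y - e) - (X + e)" by (simp add: scaleR_2)
    then show ?thesis by (simp only: norm_triangle_ineq4)
  qed
  then have n: "norm ((Y - X) - 2 *\<^sub>R e) \<le> 2 * \<eta>" using X by linarith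
  have "symplectic_form g (Y - X) = - 2 + symplectic_form g ((Y - X) - 2 *\<^sub>R e)"
    using em(2) by (simp add: symplectic_simps)
  moreover have "\<bar>symplectic_form g ((Y - X) - 2 *\<^sub>R e)\<bar> \<le> 2 * (K * (2 * \<eta>))"
    using K \<eta>0 by (intro order_trans[OF abs_symplectic_form_le] mult_left_mono mult_mono n) auto
  ultimately have g: "symplectic_form g (Y - X) \<le> - 1" using \<eta> by (simp add: abs_le_iff)
  have me: "symplectic_form m e = 0" using em symplectic_form_skew[of m e] by simp
  have "\<bar>symplectic_form (X - m) (Y - m)\<bar> \<le> (4 * (2 * K) + 2) * \<eta>"
  proof (rule symplectic_form_near_zero)
    show "symplectic_form (- e - m) (e - m) = 0" by (simp add: symplectic_simps em me)
    show "norm (X - m - (- e - m)) \<le> \<eta>" "norm (Y - m - (e - m)) \<le> \<eta>" using X by simp_all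
    show "norm (- e - m) \<le> 2 * K" "norm (e - m) \<le> 2 * K"
      using K norm_triangle_ineq4[of "- e" m] norm_triangle_ineq4[of e m] by simp_all
  qed (rule \<eta>1)
  then have num: "\<bar>a + symplectic_form (X - m) (Y - m)\<bar> \<le> 11 * K * \<eta>"
    using a \<open>\<eta> \<le> K * \<eta>\<close> abs_triangle_ineq[of a "symplectic_form (X - m) (Y - m)"]
    by (simp only: distrib_right)
  have "\<bar>t\<bar> \<le> \<bar>a + symplectic_form (X - m) (Y - m)\<bar>"
    using g divide_left_mono[of 1 "\<bar>symplectic_form g (Y - X)\<bar>" "\<bar>a + symplectic_form (X - m) (Y - m)\<bar>"]
    by (simp add: t abs_divide)
  then have "\<bar>t\<bar> \<le> 11 * K * \<eta>" using num by linarith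
  then have "\<bar>t\<bar> * norm g \<le> 11 * K * \<eta> * K" using K \<eta>0 by (intro mult_mono) auto
  then show "norm (t *\<^sub>R g) \<le> 11 * K^2 * \<eta>" by (simp add: power2_eq_square mult_ac)
  have "t * symplectic_form g (Y - X) = a + symplectic_form (X - m) (Y - m)"
    unfolding t using g by simp
  then have "t * symplectic_form g Y - t * symplectic_form g X = a + symplectic_form (X - m) (Y - m)"
    by (simp add: symplectic_simps algebra_simps)
  then show "symplectic_form (X - (m + t *\<^sub>R g)) (Y - (m + t *\<^sub>R g)) = - a"
    using symplectic_form_skew[of X g] symplectic_form_skew[of m g]
    by (simp add: symplectic_simps algebra_simps)
qed

lemma norm_combination_le:
  fixes e1 e2 f1 f2 :: "'a::real_normed_vector"
  assumes "norm e1 \<le> K" "norm e2 \<le> K" "norm f1 \<le> K" "norm f2 \<le> K"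
    "\<bar>a\<bar> + \<bar>b\<bar> + \<bar>c\<bar> + \<bar>d\<bar> \<le> m" "0 \<le> K"
  shows "norm (a *\<^sub>R e1 + b *\<^sub>R e2 + c *\<^sub>R f1 + d *\<^sub>R f2) \<le> m * K"
proof -
  have "norm (a *\<^sub>R e1 + b *\<^sub>R e2 + c *\<^sub>R f1 + d *\<^sub>R f2)
      \<le> norm (a *\<^sub>R e1) + norm (b *\<^sub>R e2) + norm (c *\<^sub>R f1) + norm (d *\<^sub>R f2)"
    by (intro order_trans[OF norm_triangle_ineq] add_mono order_refl)
  also have "\<dots> \<le> \<bar>a\<bar> * K + \<bar>b\<bar> * K + \<bar>c\<bar> * K + \<bar>d\<bar> * K"
    unfolding norm_scaleR by (intro add_mono mult_left_mono assms) auto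
  also have "\<dots> = (\<bar>a\<bar> + \<bar>b\<bar> + \<bar>c\<bar> + \<bar>d\<bar>) * K" by (simp add: algebra_simps)
  also have "\<dots> \<le> m * K" using assms by (intro mult_right_mono)
  finally show ?thesis .
qed

text \<open>Coordinates in a Darboux frame: (a, b) is the position, (p, q) the momentum.\<close>

definition frame_point ::
  "'a::real_vector \<Rightarrow> 'a \<Rightarrow> 'a \<Rightarrow> 'a \<Rightarrow> real \<Rightarrow> real \<Rightarrow> real \<Rightarrow> real \<Rightarrow> 'a" where
  "frame_point e1 e2 f1 f2 a b p q = a *\<^sub>R e1 + b *\<^sub>R e2 + p *\<^sub>R f1 + q *\<^sub>R f2"

lemma frame_point_diff:
  "frame_point e1 e2 f1 f2 a b p q - frame_point e1 e2 f1 f2 a' b' p' q'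
    = frame_point e1 e2 f1 f2 (a - a') (b - b') (p - p') (q - q')"
  by (simp add: frame_point_def scaleR_left_diff_distrib)

lemma symplectic_form_frame_point:
  assumes "symplectic_frame e1 e2 f1 f2"
  shows "symplectic_form (frame_point e1 e2 f1 f2 a b p q) (frame_point e1 e2 f1 f2 a' b' p' q')
    = a * p' + b * q' - p * a' - q * b'"
  unfolding frame_point_def
  by (simp add: symplectic_simps symplectic_frameD[OF assms] algebra_simps)

lemma norm_diff_near:
  fixes A B :: "'a::real_normed_vector"
  assumes "norm (A - A0) \<le> \<eta>" "norm (B - B0) \<le> \<eta>"
  shows "norm ((A - B) - (A0 - B0)) \<le> 2 * \<eta>"
proof -
  have "(A - B) - (A0 - B0) = (A - A0) - (B - B0)" by simp
  then show ?thesis using norm_triangle_ineq4[of "A - A0" "B - B0"] assms by (simp only:)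
qed

text \<open>The action of a quadrilateral is \<omega> of its two diagonals. For the quadrilateral
  with corners C, M (k - 1), X k, M k, indices mod 4, the diagonals are C - X k and M k - M (k - 1),
  so its equation is affine in C. The sides M k - M (k - 1) of the diamond of midpoints sum to zero;
  hence adding the four equations eliminates C, and what remains is \<open>closed\<close>, the
  vanishing of the action of the octagon. Three equations are solved, starting from the model
  centre.\<close>

lemma diamond_centre:
  fixes X M :: "nat \<Rightarrow> (real^'n) \<times> (real^'n)"
  assumes fr: "symplectic_frame e1 e2 f1 f2"
    and K: "1 \<le> K" "norm e1 \<le> K" "norm e2 \<le> K" "norm f1 \<le> K" "norm f2 \<le> K"
    and M: "norm (M 0 - frame_point e1 e2 f1 f2 0 (-1) 0 0) \<le> \<eta>"
      "norm (M 1 - frame_point e1 e2 f1 f2 1 0 1 0) \<le> \<eta>"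
      "norm (M 2 - frame_point e1 e2 f1 f2 0 1 0 0) \<le> \<eta>"
      "norm (M 3 - frame_point e1 e2 f1 f2 (-1) 0 1 0) \<le> \<eta>"
    and X: "norm (X 1 - frame_point e1 e2 f1 f2 1 (-1) 0 0) \<le> \<eta>"
      "norm (X 2 - frame_point e1 e2 f1 f2 1 1 0 0) \<le> \<eta>"
      "norm (X 3 - frame_point e1 e2 f1 f2 (-1) 1 0 0) \<le> \<eta>"
    and closed: "symplectic_form (X 0) (M 0 - M 3) + symplectic_form (X 1) (M 1 - M 0)
      + symplectic_form (X 2) (M 2 - M 1) + symplectic_form (X 3) (M 3 - M 2) = 0"
    and \<eta>: "72 * K * \<eta> \<le> 1"
  shows "\<exists>C. norm (C - frame_point e1 e2 f1 f2 0 0 (-1) 0) \<le> 2016 * K^2 * \<eta> \<and>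
     symplectic_form (C - X 0) (M 0 - M 3) = 0 \<and> symplectic_form (C - X 1) (M 1 - M 0) = 0 \<and>
     symplectic_form (C - X 2) (M 2 - M 1) = 0 \<and> symplectic_form (C - X 3) (M 3 - M 2) = 0"
proof -
  let ?P = "frame_point e1 e2 f1 f2"
  define C0 where "C0 = ?P 0 0 (-1) 0"
  have \<eta>0: "0 \<le> \<eta>" using M(1) norm_ge_zero order_trans by blast
  have "\<eta> \<le> K * \<eta>" using K \<eta>0 mult_right_mono[of 1 K \<eta>] by simp
  then have \<eta>1: "2 * \<eta> \<le> 1" using \<eta> by linarith
  have nP: "norm (?P a b p q) \<le> 3 * K" if "\<bar>a\<bar> + \<bar>b\<bar> + \<bar>p\<bar> + \<bar>q\<bar> \<le> 3" for a b p q
    unfolding frame_point_def by (rule norm_combination_le[OF K(2-5) that]) (use K in simp)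
  note dM = norm_diff_near[OF M(2) M(1)] norm_diff_near[OF M(3) M(2)] norm_diff_near[OF M(4) M(3)]
  have C0': "norm (C0 - ?P 0 0 (-1) 0) \<le> \<eta>" using \<eta>0 by (simp add: C0_def)
  note dX = norm_diff_near[OF C0' X(1)] norm_diff_near[OF C0' X(2)] norm_diff_near[OF C0' X(3)]
  note s = symplectic_form_near_zero[OF _ dX(1) dM(1) _ _ \<eta>1, of "3 * K"]
    symplectic_form_near_zero[OF _ dX(2) dM(2) _ _ \<eta>1, of "3 * K"]
    symplectic_form_near_zero[OF _ dX(3) dM(3) _ _ \<eta>1, of "3 * K"]
  have small: "\<bar>symplectic_form (C0 - X 1) (M 1 - M 0)\<bar> \<le> (4 * (3 * K) + 2) * (2 * \<eta>)"
    "\<bar>symplectic_form (C0 - X 2) (M 2 - M 1)\<bar> \<le> (4 * (3 * K) + 2) * (2 * \<eta>)"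
    "\<bar>symplectic_form (C0 - X 3) (M 3 - M 2)\<bar> \<le> (4 * (3 * K) + 2) * (2 * \<eta>)"
    by (rule s; simp only: frame_point_diff symplectic_form_frame_point[OF fr]; (rule nP)?; simp)+
  have V: "norm (M 1 - M 0 - (e1 + e2 + f1)) \<le> 2 * \<eta>" "norm (M 2 - M 1 - (- e1 + e2 - f1)) \<le> 2 * \<eta>"
      "norm (M 3 - M 2 - (- e1 - e2 + f1)) \<le> 2 * \<eta>"
    using dM by (simp_all add: frame_point_def algebra_simps)
  have "K * (2 * \<eta>) \<le> 1/36" using \<eta> by simp
  from skew_diamond_solvable[OF fr K(1,2,4,5) V this]
  obtain y where y: "symplectic_form y (M 1 - M 0) = - symplectic_form (C0 - X 1) (M 1 - M 0)"
    "symplectic_form y (M 2 - M 1) = - symplectic_form (C0 - X 2) (M 2 - M 1)"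
    "symplectic_form y (M 3 - M 2) = - symplectic_form (C0 - X 3) (M 3 - M 2)"
    "norm y \<le> 24 * K * (\<bar>- symplectic_form (C0 - X 1) (M 1 - M 0)\<bar>
       + \<bar>- symplectic_form (C0 - X 2) (M 2 - M 1)\<bar> + \<bar>- symplectic_form (C0 - X 3) (M 3 - M 2)\<bar>)"
    by blast
  note y(4)
  also have "24 * K * (\<bar>- symplectic_form (C0 - X 1) (M 1 - M 0)\<bar>
       + \<bar>- symplectic_form (C0 - X 2) (M 2 - M 1)\<bar> + \<bar>- symplectic_form (C0 - X 3) (M 3 - M 2)\<bar>)
    \<le> 24 * K * ((4 * (3 * K) + 2) * (2 * \<eta>) + (4 * (3 * K) + 2) * (2 * \<eta>) + (4 * (3 * K) + 2) * (2 * \<eta>))"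
    unfolding abs_minus_cancel using K(1) by (intro mult_left_mono add_mono small) auto
  \<comment> \<open>144 is 24 times three residuals times the factor 2 of
    \<open>norm_diff_near\<close>. With 12 K + 2 \<le> 14 K this gives 2016 = 144 * 14.\<close>
  also have "\<dots> = 144 * ((12 * K + 2) * (K * \<eta>))" by (simp add: algebra_simps)
  also have "\<dots> \<le> 144 * ((14 * K) * (K * \<eta>))"
    using K(1) \<eta>0 by (intro mult_left_mono mult_right_mono) auto
  finally have ny: "norm y \<le> 2016 * K^2 * \<eta>" by (simp add: power2_eq_square mult_ac)
  have e1: "symplectic_form (C0 + y - X 1) (M 1 - M 0) = 0"
    and e2: "symplectic_form (C0 + y - X 2) (M 2 - M 1) = 0"
    and e3: "symplectic_form (C0 + y - X 3) (M 3 - M 2) = 0"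
    using y(1-3) by (simp_all add: symplectic_simps)
  \<comment> \<open>The fourth equation is the negative of the sum of the other three, by
    \<open>closed\<close>.\<close>
  have "symplectic_form (C0 + y - X 0) (M 0 - M 3) = 0"
    using e1 e2 e3 closed by (simp add: symplectic_simps algebra_simps)
  then show ?thesis using ny e1 e2 e3
    by (intro exI[of _ "C0 + y"]) (simp add: C0_def)
qed

text \<open>In the model the lower and upper side of the cell span isotropic triangles with the apex
  for every momentum q along \<open>f2\<close>, while the left and right side force q = (a - b)/2.
  The sides are \<open>e1\<close> + 2 a \<open>f1\<close>, \<open>e2\<close> + (b - a)
  \<open>f1\<close>, - \<open>e1\<close> - 2 b \<open>f1\<close>, so the skewness required by
  \<open>skew_quad_solvable\<close> is |2 (a - b)| = 2. The equation of the fourth side follows from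
  \<open>closed\<close>, since the sum of all four is the action of the quadrilateral, whatever the
  apex.\<close>

lemma quad_apex:
  fixes D :: "nat \<Rightarrow> (real^'n) \<times> (real^'n)"
  assumes fr: "symplectic_frame e1 e2 f1 f2"
    and K: "1 \<le> K" "norm e1 \<le> K" "norm e2 \<le> K" "norm f1 \<le> K" "norm f2 \<le> K"
    and D: "norm (D 0 - frame_point e1 e2 f1 f2 (-1/2) (-1/2) (-a) 0) \<le> \<eta>"
      "norm (D 1 - frame_point e1 e2 f1 f2 (1/2) (-1/2) a 0) \<le> \<eta>"
      "norm (D 2 - frame_point e1 e2 f1 f2 (1/2) (1/2) b 0) \<le> \<eta>"
      "norm (D 3 - frame_point e1 e2 f1 f2 (-1/2) (1/2) (-b) 0) \<le> \<eta>"
    and ab: "\<bar>a\<bar> \<le> 1" "\<bar>b\<bar> \<le> 1" "\<bar>a - b\<bar> = 1"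
    and closed: "symplectic_form (D 2 - D 0) (D 3 - D 1) = 0"
    and \<eta>: "216 * K * \<eta> \<le> 1"
  shows "\<exists>A. norm (A - frame_point e1 e2 f1 f2 0 0 0 ((a - b)/2)) \<le> 2016 * K^2 * \<eta> \<and>
     symplectic_form (D 0 - A) (D 1 - A) = 0 \<and> symplectic_form (D 1 - A) (D 2 - A) = 0 \<and>
     symplectic_form (D 2 - A) (D 3 - A) = 0 \<and> symplectic_form (D 3 - A) (D 0 - A) = 0"
proof -
  let ?P = "frame_point e1 e2 f1 f2"
  define C0 where "C0 = ?P 0 0 0 ((a - b)/2)"
  have \<eta>0: "0 \<le> \<eta>" using D(1) norm_ge_zero order_trans by blast
  have "\<eta> \<le> K * \<eta>" using K \<eta>0 mult_right_mono[of 1 K \<eta>] by simp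
  then have \<eta>1: "2 * \<eta> \<le> 1" using \<eta> by linarith
  have nP: "norm (?P a b p q) \<le> 3 * K" if "\<bar>a\<bar> + \<bar>b\<bar> + \<bar>p\<bar> + \<bar>q\<bar> \<le> 3" for a b p q
    unfolding frame_point_def by (rule norm_combination_le[OF K(2-5) that]) (use K in simp)
  note dM = norm_diff_near[OF D(2) D(1)] norm_diff_near[OF D(3) D(2)] norm_diff_near[OF D(4) D(3)]
  have C0': "norm (C0 - ?P 0 0 0 ((a - b)/2)) \<le> \<eta>" using \<eta>0 by (simp add: C0_def)
  note dX = norm_diff_near[OF C0' D(1)] norm_diff_near[OF C0' D(2)] norm_diff_near[OF C0' D(3)]
  note s = symplectic_form_near_zero[OF _ dX(1) dM(1) _ _ \<eta>1, of "3 * K"]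
    symplectic_form_near_zero[OF _ dX(2) dM(2) _ _ \<eta>1, of "3 * K"]
    symplectic_form_near_zero[OF _ dX(3) dM(3) _ _ \<eta>1, of "3 * K"]
  have ab': "\<bar>(a - b)/2\<bar> = 1/2" "\<bar>a + a\<bar> \<le> 2" "\<bar>b + b\<bar> \<le> 2" using ab by auto
  have small: "\<bar>symplectic_form (C0 - D 0) (D 1 - D 0)\<bar> \<le> (4 * (3 * K) + 2) * (2 * \<eta>)"
    by (rule s(1); simp only: frame_point_diff symplectic_form_frame_point[OF fr]; (rule nP)?)
      (use ab ab' in \<open>auto simp: field_simps\<close>)
  have small': "\<bar>symplectic_form (C0 - D 1) (D 2 - D 1)\<bar> \<le> (4 * (3 * K) + 2) * (2 * \<eta>)"
    by (rule s(2); simp only: frame_point_diff symplectic_form_frame_point[OF fr]; (rule nP)?)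
      (use ab ab' in \<open>auto simp: field_simps\<close>)
  have small'': "\<bar>symplectic_form (C0 - D 2) (D 3 - D 2)\<bar> \<le> (4 * (3 * K) + 2) * (2 * \<eta>)"
    by (rule s(3); simp only: frame_point_diff symplectic_form_frame_point[OF fr]; (rule nP)?)
      (use ab ab' in \<open>auto simp: field_simps\<close>)
  have V: "norm (D 1 - D 0 - (e1 + (2 * a) *\<^sub>R f1)) \<le> 2 * \<eta>"
      "norm (D 2 - D 1 - (e2 + (b - a) *\<^sub>R f1)) \<le> 2 * \<eta>"
      "norm (D 3 - D 2 - (- e1 + (- 2 * b) *\<^sub>R f1)) \<le> 2 * \<eta>"
    using dM by (simp_all add: frame_point_diff) (simp_all add: frame_point_def)
  have "K * (2 * \<eta>) \<le> 1/108" using \<eta> by simp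
  moreover have "\<bar>2 * a + - 2 * b\<bar> = 2" "\<bar>2 * a\<bar> \<le> 2" "\<bar>b - a\<bar> \<le> 2"
    using ab by argo+
  ultimately obtain y where y: "symplectic_form y (D 1 - D 0) = - symplectic_form (C0 - D 0) (D 1 - D 0)"
    "symplectic_form y (D 2 - D 1) = - symplectic_form (C0 - D 1) (D 2 - D 1)"
    "symplectic_form y (D 3 - D 2) = - symplectic_form (C0 - D 2) (D 3 - D 2)"
    "norm y \<le> 24 * K * (\<bar>- symplectic_form (C0 - D 0) (D 1 - D 0)\<bar>
       + \<bar>- symplectic_form (C0 - D 1) (D 2 - D 1)\<bar> + \<bar>- symplectic_form (C0 - D 2) (D 3 - D 2)\<bar>)"
    using skew_quad_solvable[OF fr K(1,2,4,5) V] by blast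
  note y(4)
  also have "24 * K * (\<bar>- symplectic_form (C0 - D 0) (D 1 - D 0)\<bar>
       + \<bar>- symplectic_form (C0 - D 1) (D 2 - D 1)\<bar> + \<bar>- symplectic_form (C0 - D 2) (D 3 - D 2)\<bar>)
    \<le> 24 * K * ((4 * (3 * K) + 2) * (2 * \<eta>) + (4 * (3 * K) + 2) * (2 * \<eta>) + (4 * (3 * K) + 2) * (2 * \<eta>))"
    unfolding abs_minus_cancel using K(1) by (intro mult_left_mono add_mono small small' small'') auto
  also have "\<dots> = 144 * ((12 * K + 2) * (K * \<eta>))" by (simp add: algebra_simps)
  also have "\<dots> \<le> 144 * ((14 * K) * (K * \<eta>))"
    using K(1) \<eta>0 by (intro mult_left_mono mult_right_mono) auto
  finally have ny: "norm y \<le> 2016 * K^2 * \<eta>" by (simp add: power2_eq_square mult_ac)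
  define A where "A = C0 + y"
  \<comment> \<open>This form exhibits the condition on a side as affine in the apex A.\<close>
  have side: "symplectic_form (P - A) (Q - A) = - symplectic_form (A - P) (Q - P)" for P Q
    using symplectic_form_skew[of P A] by (simp add: symplectic_simps)
  have e: "symplectic_form (A - D 0) (D 1 - D 0) = 0" "symplectic_form (A - D 1) (D 2 - D 1) = 0"
    "symplectic_form (A - D 2) (D 3 - D 2) = 0"
    using y(1-3) by (simp_all add: A_def symplectic_simps)
  have "symplectic_form (A - D 3) (D 0 - D 3) = 0"
    using e closed symplectic_form_skew[of "D 0" "D 3"] symplectic_form_skew[of "D 2" "D 1"]
     symplectic_form_skew[of "D 1" "D 0"] symplectic_form_skew[of "D 3" "D 2"]
    by (simp add: symplectic_simps algebra_simps)
  then show ?thesis using ny e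
    by (intro exI[of _ A]) (simp only: side, simp add: A_def C0_def)
qed

section \<open>Isotropic approximation on the vertices of a fine grid\<close>

context periodic_isotropic
begin

definition scaled where
  "scaled h x Y = (1 / h) *\<^sub>R (Y - F x)"

text \<open>Y has position (a, b) and momentum (p, q) up to \<eta>, when seen from F x in the frame
  at x and in units of h. In these units the model does not depend on h.\<close>

definition near where
  "near h x \<eta> a b p q Y \<longleftrightarrow> norm (scaled h x Y - frame_point (e1 x) (e2 x) (f1 x) (f2 x) a b p q) \<le> \<eta>"

lemma near_mono: "near h x \<eta> a b p q Y \<Longrightarrow> \<eta> \<le> \<eta>' \<Longrightarrow> near h x \<eta>' a b p q Y"
  by (simp add: near_def)

lemma near_self: "0 \<le> \<eta> \<Longrightarrow> near h x \<eta> 0 0 0 0 (F x)"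
  by (simp add: near_def scaled_def frame_point_def)

lemma scaled_diff: "scaled h x A - scaled h x B = (1 / h) *\<^sub>R (A - B)"
  by (simp add: scaled_def scaleR_diff_right[symmetric] del: scaleR_diff_right)

text \<open>Change of base point. Each vertex is constructed in the frame at its own parameter, but
  a linear system couples several vertices and needs them in one frame. Over distances of order h
  the frame is constant up to o(1), and F is affine up to o(h).\<close>

lemma near_shift:
  assumes "\<eta> > 0"
  obtains r where "r > 0" "\<And>h x a b p q Y. h > 0 \<Longrightarrow> h \<le> r \<Longrightarrow>
     \<bar>a\<bar> \<le> 3 \<Longrightarrow> \<bar>b\<bar> \<le> 3 \<Longrightarrow> \<bar>p\<bar> \<le> 1 \<Longrightarrow> \<bar>q\<bar> \<le> 1 \<Longrightarrow>
     near h (x + h *\<^sub>R (a, b)) \<eta> 0 0 p q Y \<Longrightarrow> near h x (2 * \<eta>) a b p q Y"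
proof -
  \<comment> \<open>The Taylor error counts 6 \<delta>, because the position has norm at most 6, and
    the variation of \<open>f1\<close> and of \<open>f2\<close> counts \<delta> each; together with
    the given \<eta> this is 2 \<eta>.\<close>
  define \<delta> where "\<delta> = \<eta> / 8"
  have \<delta>: "\<delta> > 0" using assms by (simp add: \<delta>_def)
  obtain r1 where r1: "r1 > 0" "\<And>x y. norm (y - x) \<le> r1 \<Longrightarrow>
     norm (F y - F x - (fst (y - x) *\<^sub>R e1 x + snd (y - x) *\<^sub>R e2 x)) \<le> \<delta> * norm (y - x)"
    using taylor[OF \<delta>] by blast
  obtain r2 where r2: "r2 > 0" "\<And>x y. norm (y - x) \<le> r2 \<Longrightarrow> norm (f1 y - f1 x) \<le> \<delta> \<and> norm (f2 y - f2 x) \<le> \<delta>"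
    using uniform[OF \<delta>] by blast
  show ?thesis
  proof (rule that[of "min r1 r2 / 6"])
    show "min r1 r2 / 6 > 0" using r1(1) r2(1) by simp
    fix h a b p q :: real and x Y
    assume h: "0 < h" "h \<le> min r1 r2 / 6" and ab: "\<bar>a\<bar> \<le> 3" "\<bar>b\<bar> \<le> 3" and pq: "\<bar>p\<bar> \<le> 1" "\<bar>q\<bar> \<le> 1"
      and nr: "near h (x + h *\<^sub>R (a, b)) \<eta> 0 0 p q Y"
    define z where "z = x + h *\<^sub>R (a, b)"
    have "norm (a, b) \<le> 6" using norm_Pair_le[of a b] ab by simp
    then have nz: "norm (z - x) \<le> h * 6" using h(1) by (simp add: z_def del: scaleR_Pair)
    then have nz': "norm (z - x) \<le> r1" "norm (z - x) \<le> r2" using h by linarith+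
    have "norm (F z - F x - (h *\<^sub>R (a *\<^sub>R e1 x + b *\<^sub>R e2 x))) \<le> \<delta> * norm (z - x)"
      using r1(2)[OF nz'(1)] by (simp add: z_def scaleR_add_right)
    also have "\<dots> \<le> \<delta> * (h * 6)" using \<delta> nz by (intro mult_left_mono) auto
    finally have T: "norm (F z - F x - (h *\<^sub>R (a *\<^sub>R e1 x + b *\<^sub>R e2 x))) \<le> h * (6 * \<delta>)"
      by (simp only: mult_ac)
    define T where "T = (1/h) *\<^sub>R (F z - F x - (h *\<^sub>R (a *\<^sub>R e1 x + b *\<^sub>R e2 x)))"
    have nT: "norm T \<le> 6 * \<delta>"
      using T h(1) by (simp add: T_def divide_le_eq mult.commute)
    define S where "S = scaled h z Y - (p *\<^sub>R f1 z + q *\<^sub>R f2 z)"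
    have nS: "norm S \<le> \<eta>" using nr by (simp add: near_def frame_point_def S_def z_def)
    have U: "norm (p *\<^sub>R (f1 z - f1 x)) \<le> \<delta>" "norm (q *\<^sub>R (f2 z - f2 x)) \<le> \<delta>"
      using r2(2)[OF nz'(2)] pq mult_mono[of "\<bar>p\<bar>" 1 "norm (f1 z - f1 x)" \<delta>]
        mult_mono[of "\<bar>q\<bar>" 1 "norm (f2 z - f2 x)" \<delta>] by simp_all
    have sc: "scaled h x Y = scaled h z Y + (1/h) *\<^sub>R (F z - F x)"
      by (simp add: scaled_def scaleR_diff_right)
    have "scaled h x Y - frame_point (e1 x) (e2 x) (f1 x) (f2 x) a b p q
        = S + T + p *\<^sub>R (f1 z - f1 x) + q *\<^sub>R (f2 z - f2 x)"
      using h(1) by (simp add: sc S_def T_def frame_point_def scaleR_diff_right scaleR_add_right algebra_simps)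
    also have "norm \<dots> \<le> \<eta> + 6 * \<delta> + \<delta> + \<delta>"
      by (intro norm_triangle_mono nS nT U)
    finally show "near h x (2 * \<eta>) a b p q Y" by (simp add: near_def \<delta>_def)
  qed
qed

section \<open>Midpoints, centres and apexes\<close>

definition edge_point where
  "edge_point h z a X Y m g = F z + h *\<^sub>R (m + (((a - symplectic_form X Y) / h^2
      + symplectic_form (scaled h z X - m) (scaled h z Y - m))
       / symplectic_form g (scaled h z Y - scaled h z X)) *\<^sub>R g)"

text \<open>The expansion \<omega>(X - M, Y - M) = \<omega>(X, Y) - (\<omega>(X, M) + \<omega>(M,
  Y)) turns the prescribed action of the broken edge into the hypothesis of
  \<open>edge_adjustment\<close>, after division by h^2. The defect of the chord is o(h^2), so it
  remains small.\<close>

lemma edge_point: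
  assumes h: "0 < h" and K: "1 \<le> K" "norm e \<le> K" "norm m \<le> K" "norm g \<le> K"
    and em: "symplectic_form e m = 0" "symplectic_form g e = - 1"
    and XY: "norm (scaled h z X + e) \<le> \<eta>" "norm (scaled h z Y - e) \<le> \<eta>"
    and a: "\<bar>a - symplectic_form X Y\<bar> \<le> \<eta> * h^2" and \<eta>: "4 * K * \<eta> \<le> 1"
  shows "norm (scaled h z (edge_point h z a X Y m g) - m) \<le> 11 * K^2 * \<eta>"
    and "symplectic_form X (edge_point h z a X Y m g) + symplectic_form (edge_point h z a X Y m g) Y = a"
proof -
  let ?X = "scaled h z X" and ?Y = "scaled h z Y"
  define \<alpha> where "\<alpha> = (a - symplectic_form X Y) / h^2"
  define t where "t = (\<alpha> + symplectic_form (?X - m) (?Y - m)) / symplectic_form g (?Y - ?X)"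
  define M where "M = edge_point h z a X Y m g"
  have M: "M = F z + h *\<^sub>R (m + t *\<^sub>R g)" by (simp add: M_def edge_point_def t_def \<alpha>_def)
  then have sM: "scaled h z M = m + t *\<^sub>R g" using h by (simp add: scaled_def)
  have "\<bar>\<alpha>\<bar> \<le> \<eta>" using a h by (simp add: \<alpha>_def abs_divide divide_le_eq)
  note ea = edge_adjustment[OF K em XY this \<eta> t_def]
  show "norm (scaled h z (edge_point h z a X Y m g) - m) \<le> 11 * K^2 * \<eta>"
    using ea(2) sM by (simp add: M_def)
  have "symplectic_form (?X - scaled h z M) (?Y - scaled h z M) = - \<alpha>" using ea(1) sM by simp
  then have "symplectic_form (X - M) (Y - M) / h^2 = - \<alpha>"
    by (simp add: scaled_diff symplectic.scaleR_left symplectic.scaleR_right power2_eq_square)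
  then have "symplectic_form (X - M) (Y - M) = symplectic_form X Y - a"
    using h by (simp add: \<alpha>_def field_simps)
  then show "symplectic_form X (edge_point h z a X Y m g) + symplectic_form (edge_point h z a X Y m g) Y = a"
    by (simp add: symplectic_simps M_def)
qed

text \<open>The midpoint moves along the momentum conjugate to the direction of the edge:
  \<open>f1\<close> for a horizontal edge, \<open>f2\<close> for a vertical one. The unperturbed
  midpoint has momentum 0 on a horizontal and \<open>f1\<close> on a vertical edge, as the model
  prescribes.\<close>

definition hor_mid where
  "hor_mid h z = edge_point h z (hor_action (fst z - h) (fst z + h) (snd z))
     (F (z + (- h, 0))) (F (z + (h, 0))) 0 (f1 z)"

definition ver_mid where
  "ver_mid h z = edge_point h z (ver_action (fst z) (snd z - h) (snd z + h))
     (F (z + (0, - h))) (F (z + (0, h))) (f1 z) (f2 z)"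

lemma midpoints:
  assumes "\<eta> > 0"
  obtains r where "r > 0"
    "\<And>h z. h > 0 \<Longrightarrow> h \<le> r \<Longrightarrow> near h z \<eta> 0 0 0 0 (hor_mid h z)"
    "\<And>h z. h > 0 \<Longrightarrow> h \<le> r \<Longrightarrow>
      symplectic_form (F (z + (- h, 0))) (hor_mid h z) + symplectic_form (hor_mid h z) (F (z + (h, 0)))
        = hor_action (fst z - h) (fst z + h) (snd z)"
    "\<And>h z. h > 0 \<Longrightarrow> h \<le> r \<Longrightarrow> near h z \<eta> 0 0 1 0 (ver_mid h z)"
    "\<And>h z. h > 0 \<Longrightarrow> h \<le> r \<Longrightarrow>
      symplectic_form (F (z + (0, - h))) (ver_mid h z) + symplectic_form (ver_mid h z) (F (z + (0, h)))
        = ver_action (fst z) (snd z - h) (snd z + h)"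
proof -
  obtain K where K: "K \<ge> 1" "\<And>x. norm (e1 x) \<le> K" "\<And>x. norm (e2 x) \<le> K" "\<And>x. norm (f1 x) \<le> K" "\<And>x. norm (f2 x) \<le> K"
    using bound by blast
  define \<delta> where "\<delta> = min (\<eta> / (11 * K^2)) (1 / (4 * K))"
  have "\<delta> \<le> \<eta> / (11 * K^2)" "\<delta> \<le> 1 / (4 * K)" by (simp_all add: \<delta>_def)
  then have \<delta>: "\<delta> > 0" "11 * K^2 * \<delta> \<le> \<eta>" "4 * K * \<delta> \<le> 1"
    using assms K(1) by (simp add: \<delta>_def, simp_all add: le_divide_eq mult.commute)
  have \<delta>2: "\<delta> / 2 > 0" "\<delta> / 4 > 0" using \<delta> by simp_all
  obtain r1 where r1: "r1 > 0" "\<And>h x a b p q Y. h > 0 \<Longrightarrow> h \<le> r1 \<Longrightarrow> \<bar>a\<bar> \<le> 3 \<Longrightarrow> \<bar>b\<bar> \<le> 3 \<Longrightarrow> \<bar>p\<bar> \<le> 1 \<Longrightarrow> \<bar>q\<bar> \<le> 1 \<Longrightarrow>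
     near h (x + h *\<^sub>R (a, b)) (\<delta>/2) 0 0 p q Y \<Longrightarrow> near h x (2 * (\<delta>/2)) a b p q Y"
    by (fact near_shift[OF \<delta>2(1)])
  obtain r2 where r2: "r2 > 0" "\<And>s0 s1 t. s0 \<le> s1 \<Longrightarrow> s1 - s0 \<le> r2 \<Longrightarrow>
    \<bar>hor_action s0 s1 t - symplectic_form (F (s0, t)) (F (s1, t))\<bar> \<le> \<delta>/4 * (s1 - s0)^2"
    by (fact hor_action_chord[OF \<delta>2(2)])
  obtain r3 where r3: "r3 > 0" "\<And>s t0 t1. t0 \<le> t1 \<Longrightarrow> t1 - t0 \<le> r3 \<Longrightarrow>
    \<bar>ver_action s t0 t1 - symplectic_form (F (s, t0)) (F (s, t1))\<bar> \<le> \<delta>/4 * (t1 - t0)^2"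
    by (fact ver_action_chord[OF \<delta>2(2)])
  let ?r = "min r1 (min (r2/2) (r3/2))"
  have main: "near h z \<eta> 0 0 0 0 (hor_mid h z)"
    "symplectic_form (F (z + (- h, 0))) (hor_mid h z) + symplectic_form (hor_mid h z) (F (z + (h, 0)))
        = hor_action (fst z - h) (fst z + h) (snd z)"
    "near h z \<eta> 0 0 1 0 (ver_mid h z)"
    "symplectic_form (F (z + (0, - h))) (ver_mid h z) + symplectic_form (ver_mid h z) (F (z + (0, h)))
        = ver_action (fst z) (snd z - h) (snd z + h)" if h: "h > 0" "h \<le> ?r" for h z
  proof -
    have n: "near h z \<delta> a b 0 0 (F (z + h *\<^sub>R (a, b)))" if "\<bar>a\<bar> \<le> 3" "\<bar>b\<bar> \<le> 3" for a b
      using r1(2)[OF h(1) _ that, of 0 0 z] near_self[of "\<delta>/2"] \<delta> h(2) by simp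
    have X: "norm (scaled h z (F (z + (- h, 0))) + e1 z) \<le> \<delta>" "norm (scaled h z (F (z + (h, 0))) - e1 z) \<le> \<delta>"
      "norm (scaled h z (F (z + (0, - h))) + e2 z) \<le> \<delta>" "norm (scaled h z (F (z + (0, h))) - e2 z) \<le> \<delta>"
      using n[of "- 1" 0] n[of 1 0] n[of 0 "- 1"] n[of 0 1] by (simp_all add: near_def frame_point_def)
    have a1: "\<bar>hor_action (fst z - h) (fst z + h) (snd z) - symplectic_form (F (z + (- h, 0))) (F (z + (h, 0)))\<bar> \<le> \<delta> * h^2"
      using r2(2)[of "fst z - h" "fst z + h" "snd z"] h by (cases z) (simp add: power2_eq_square)
    have a2: "\<bar>ver_action (fst z) (snd z - h) (snd z + h) - symplectic_form (F (z + (0, - h))) (F (z + (0, h)))\<bar> \<le> \<delta> * h^2"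
      using r3(2)[of "snd z - h" "snd z + h" "fst z"] h by (cases z) (simp add: power2_eq_square)
    note fr = symplectic_frameD[OF frame[of z]]
    have z: "norm 0 \<le> K" "symplectic_form (e1 z) 0 = 0" using K(1) by (simp_all add: symplectic_simps)
    note H = edge_point[OF h(1) K(1) K(2) z(1) K(4) z(2) fr(6) X(1,2) a1 \<delta>(3)]
    note V = edge_point[OF h(1) K(1) K(3) K(4) K(5) fr(11) fr(8) X(3,4) a2 \<delta>(3)]
    show "near h z \<eta> 0 0 0 0 (hor_mid h z)" "near h z \<eta> 0 0 1 0 (ver_mid h z)"
      using H(1) V(1) \<delta>(2) by (simp_all add: near_def frame_point_def hor_mid_def[symmetric] ver_mid_def[symmetric])
    show "symplectic_form (F (z + (- h, 0))) (hor_mid h z) + symplectic_form (hor_mid h z) (F (z + (h, 0)))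
        = hor_action (fst z - h) (fst z + h) (snd z)"
      "symplectic_form (F (z + (0, - h))) (ver_mid h z) + symplectic_form (ver_mid h z) (F (z + (0, h)))
        = ver_action (fst z) (snd z - h) (snd z + h)"
      using H(2) V(2) by (simp_all only: hor_mid_def ver_mid_def)
  qed
  have "?r > 0" using r1(1) r2(1) r3(1) by simp
  from that[OF this main] show ?thesis .
qed

definition is_centre where
  "is_centre \<eta> h z C \<longleftrightarrow> near h z \<eta> 0 0 (- 1) 0 C \<and>
     symplectic_form (C - F (z + (- h, - h))) (hor_mid h (z + (0, - h)) - ver_mid h (z + (- h, 0))) = 0 \<and>
     symplectic_form (C - F (z + (h, - h))) (ver_mid h (z + (h, 0)) - hor_mid h (z + (0, - h))) = 0 \<and>
     symplectic_form (C - F (z + (h, h))) (hor_mid h (z + (0, h)) - ver_mid h (z + (h, 0))) = 0 \<and>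
     symplectic_form (C - F (z + (- h, h))) (ver_mid h (z + (- h, 0)) - hor_mid h (z + (0, h))) = 0"

text \<open>Choosing from a predicate that mentions z only through periodic data makes the centre
  periodic, although it is not unique.\<close>

definition "centre \<eta> h z = (SOME C. is_centre \<eta> h z C)"

lemma centre:
  assumes "\<eta> > 0"
  obtains r where "r > 0" "\<And>h z. h > 0 \<Longrightarrow> h \<le> r \<Longrightarrow> is_centre \<eta> h z (centre \<eta> h z)"
proof -
  obtain K where K: "K \<ge> 1" "\<And>x. norm (e1 x) \<le> K" "\<And>x. norm (e2 x) \<le> K" "\<And>x. norm (f1 x) \<le> K" "\<And>x. norm (f2 x) \<le> K"
    using bound by blast
  define \<delta> where "\<delta> = min (\<eta> / (2016 * K^2)) (1 / (72 * K))"
  have "\<delta> \<le> \<eta> / (2016 * K^2)" "\<delta> \<le> 1 / (72 * K)" by (simp_all add: \<delta>_def)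
  then have \<delta>: "\<delta> > 0" "2016 * K^2 * \<delta> \<le> \<eta>" "72 * K * \<delta> \<le> 1"
    using assms K(1) by (simp add: \<delta>_def, simp_all add: le_divide_eq mult.commute)
  have \<delta>2: "\<delta> / 2 > 0" using \<delta> by simp
  obtain r1 where r1: "r1 > 0" "\<And>h x a b p q Y. h > 0 \<Longrightarrow> h \<le> r1 \<Longrightarrow> \<bar>a\<bar> \<le> 3 \<Longrightarrow> \<bar>b\<bar> \<le> 3 \<Longrightarrow> \<bar>p\<bar> \<le> 1 \<Longrightarrow> \<bar>q\<bar> \<le> 1 \<Longrightarrow>
     near h (x + h *\<^sub>R (a, b)) (\<delta>/2) 0 0 p q Y \<Longrightarrow> near h x (2 * (\<delta>/2)) a b p q Y"
    by (fact near_shift[OF \<delta>2])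
  obtain r2 where r2: "r2 > 0"
    and hor: "\<And>h z. h > 0 \<Longrightarrow> h \<le> r2 \<Longrightarrow> near h z (\<delta>/2) 0 0 0 0 (hor_mid h z)"
      "\<And>h z. h > 0 \<Longrightarrow> h \<le> r2 \<Longrightarrow>
        symplectic_form (F (z + (- h, 0))) (hor_mid h z) + symplectic_form (hor_mid h z) (F (z + (h, 0)))
        = hor_action (fst z - h) (fst z + h) (snd z)"
    and ver: "\<And>h z. h > 0 \<Longrightarrow> h \<le> r2 \<Longrightarrow> near h z (\<delta>/2) 0 0 1 0 (ver_mid h z)"
      "\<And>h z. h > 0 \<Longrightarrow> h \<le> r2 \<Longrightarrow>
        symplectic_form (F (z + (0, - h))) (ver_mid h z) + symplectic_form (ver_mid h z) (F (z + (0, h)))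
        = ver_action (fst z) (snd z - h) (snd z + h)"
    by (fact midpoints[OF \<delta>2])
  have main: "is_centre \<eta> h z (centre \<eta> h z)" if h: "h > 0" "h \<le> min r1 r2" for h z
  proof -
    have hr: "h \<le> r1" "h \<le> r2" using h by auto
    define X where "X k = F (z + ([(- h, - h), (h, - h), (h, h), (- h, h)] ! k))" for k :: nat
    define M where "M k = ([hor_mid h (z + (0, - h)), ver_mid h (z + (h, 0)),
        hor_mid h (z + (0, h)), ver_mid h (z + (- h, 0))] ! k)" for k :: nat
    have sX: "X 0 = F (z + (- h, - h))" "X 1 = F (z + (h, - h))" "X 2 = F (z + (h, h))" "X 3 = F (z + (- h, h))"
      by (simp_all add: X_def)
    have sM: "M 0 = hor_mid h (z + (0, - h))" "M 1 = ver_mid h (z + (h, 0))"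
        "M 2 = hor_mid h (z + (0, h))" "M 3 = ver_mid h (z + (- h, 0))"
      by (simp_all add: M_def)
    note sh = r1(2)[OF h(1) hr(1), simplified]
    \<comment> \<open>The corners of a coarse square are points of F itself, so they have momentum
      zero.\<close>
    have near_corner: "near h z \<delta> a b 0 0 (F (z + h *\<^sub>R (a, b)))" if "\<bar>a\<bar> \<le> 3" "\<bar>b\<bar> \<le> 3" for a b
      using sh[of a b 0 0 z] near_self[of "\<delta>/2"] \<delta> that by simp
    have nX: "near h z \<delta> 1 (-1) 0 0 (X 1)" "near h z \<delta> 1 1 0 0 (X 2)" "near h z \<delta> (-1) 1 0 0 (X 3)"
      using near_corner[of 1 "-1"] near_corner[of 1 1] near_corner[of "-1" 1] by (simp_all add: sX del: One_nat_def)
    have nM: "near h z \<delta> 0 (-1) 0 0 (M 0)" "near h z \<delta> 1 0 1 0 (M 1)" "near h z \<delta> 0 1 0 0 (M 2)"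
      "near h z \<delta> (-1) 0 1 0 (M 3)"
      using sh[of 0 "-1" 0 0 z "M 0"] hor(1)[OF h(1) hr(2), of "z + (0, - h)"]
        sh[of 1 0 1 0 z "M 1"] ver(1)[OF h(1) hr(2), of "z + (h, 0)"]
        sh[of 0 1 0 0 z "M 2"] hor(1)[OF h(1) hr(2), of "z + (0, h)"]
        sh[of "-1" 0 1 0 z "M 3"] ver(1)[OF h(1) hr(2), of "z + (- h, 0)"]
      by (simp_all add: sM del: One_nat_def)
    have pts: "z + (0, - h) + (- h, 0) = z + (- h, - h)" "z + (0, - h) + (h, 0) = z + (h, - h)"
      "z + (0, h) + (- h, 0) = z + (- h, h)" "z + (0, h) + (h, 0) = z + (h, h)"
      "z + (- h, 0) + (0, - h) = z + (- h, - h)" "z + (- h, 0) + (0, h) = z + (- h, h)"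
      "z + (h, 0) + (0, - h) = z + (h, - h)" "z + (h, 0) + (0, h) = z + (h, h)"
      by (simp_all add: add.assoc)
    have acts: "symplectic_form (X 0) (M 0) + symplectic_form (M 0) (X 1) = hor_action (fst z - h) (fst z + h) (snd z - h)"
      "symplectic_form (X 3) (M 2) + symplectic_form (M 2) (X 2) = hor_action (fst z - h) (fst z + h) (snd z + h)"
      "symplectic_form (X 1) (M 1) + symplectic_form (M 1) (X 2) = ver_action (fst z + h) (snd z - h) (snd z + h)"
      "symplectic_form (X 0) (M 3) + symplectic_form (M 3) (X 3) = ver_action (fst z - h) (snd z - h) (snd z + h)"
      using hor(2)[OF h(1) hr(2), of "z + (0, - h)"] hor(2)[OF h(1) hr(2), of "z + (0, h)"]
        ver(2)[OF h(1) hr(2), of "z + (h, 0)"] ver(2)[OF h(1) hr(2), of "z + (- h, 0)"]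
      unfolding pts sX[symmetric] sM[symmetric] by simp_all
    have "hor_action (fst z - h) (fst z + h) (snd z - h) + ver_action (fst z + h) (snd z - h) (snd z + h)
       = hor_action (fst z - h) (fst z + h) (snd z + h) + ver_action (fst z - h) (snd z - h) (snd z + h)"
      using h(1) by (intro action_closed) auto
    then have cl: "symplectic_form (X 0) (M 0 - M 3) + symplectic_form (X 1) (M 1 - M 0)
      + symplectic_form (X 2) (M 2 - M 1) + symplectic_form (X 3) (M 3 - M 2) = 0"
      using acts symplectic_form_skew[of "M 0" "X 1"] symplectic_form_skew[of "M 2" "X 2"]
        symplectic_form_skew[of "M 1" "X 2"] symplectic_form_skew[of "M 3" "X 3"]
      by (simp add: symplectic_simps del: One_nat_def)
    define X' where "X' k = scaled h z (X k)" for k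
    define M' where "M' k = scaled h z (M k)" for k
    have XM: "X' k = (1/h) *\<^sub>R (X k - F z)" "M' k - M' l = (1/h) *\<^sub>R (M k - M l)" for k l
      by (simp_all add: X'_def M'_def scaled_diff) (simp add: scaled_def)
    have "symplectic_form (X' 0) (M' 0 - M' 3) + symplectic_form (X' 1) (M' 1 - M' 0)
      + symplectic_form (X' 2) (M' 2 - M' 1) + symplectic_form (X' 3) (M' 3 - M' 2)
      = (1/h) * (1/h) * (symplectic_form (X 0) (M 0 - M 3) + symplectic_form (X 1) (M 1 - M 0)
      + symplectic_form (X 2) (M 2 - M 1) + symplectic_form (X 3) (M 3 - M 2))"
      unfolding XM by (simp only: symplectic.scaleR_left symplectic.scaleR_right symplectic.diff_left
          symplectic.diff_right) (simp add: algebra_simps)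
    then have cl': "symplectic_form (X' 0) (M' 0 - M' 3) + symplectic_form (X' 1) (M' 1 - M' 0)
      + symplectic_form (X' 2) (M' 2 - M' 1) + symplectic_form (X' 3) (M' 3 - M' 2) = 0"
      unfolding cl by simp
    obtain C' where C': "norm (C' - frame_point (e1 z) (e2 z) (f1 z) (f2 z) 0 0 (-1) 0) \<le> 2016 * K^2 * \<delta>"
     "symplectic_form (C' - X' 0) (M' 0 - M' 3) = 0" "symplectic_form (C' - X' 1) (M' 1 - M' 0) = 0"
     "symplectic_form (C' - X' 2) (M' 2 - M' 1) = 0" "symplectic_form (C' - X' 3) (M' 3 - M' 2) = 0"
      using diamond_centre[OF frame K nM[unfolded near_def, folded M'_def] nX[unfolded near_def, folded X'_def] cl' \<delta>(3)]
      by blast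
    define C where "C = F z + h *\<^sub>R C'"
    have "scaled h z C = C'" using h(1) by (simp add: C_def scaled_def)
    then have CX: "C' - X' k = (1/h) *\<^sub>R (C - X k)" for k
      by (metis X'_def scaled_diff)
    have "near h z \<eta> 0 0 (-1) 0 C"
      using C'(1) \<delta>(2) \<open>scaled h z C = C'\<close> by (simp add: near_def)
    moreover have "symplectic_form (C - X 0) (M 0 - M 3) = 0" "symplectic_form (C - X 1) (M 1 - M 0) = 0"
     "symplectic_form (C - X 2) (M 2 - M 1) = 0" "symplectic_form (C - X 3) (M 3 - M 2) = 0"
      using C'(2-5) h(1) unfolding CX XM(2) by (simp_all only: symplectic.scaleR_left symplectic.scaleR_right) simp_all
    ultimately have "is_centre \<eta> h z C"
      unfolding is_centre_def sX[symmetric] sM[symmetric] by blast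
    then show ?thesis unfolding centre_def by (rule someI)
  qed
  have "min r1 r2 > 0" using r1(1) r2(1) by simp
  from that[OF this main] show ?thesis .
qed

text \<open>Even-even points are corners of the coarse grid, even-odd and odd-even points the
  midpoints of its edges, odd-odd points its centres.\<close>

definition vertex where
  "vertex \<eta> h i j = (let z = (h * of_int i, h * of_int j) in
     if even i then (if even j then F z else ver_mid h z)
     else (if even j then hor_mid h z else centre \<eta> h z))"

definition momentum :: "int \<Rightarrow> int \<Rightarrow> real" where
  "momentum i j = (if even j then 0 else if even i then 1 else - 1)"

definition cell_centre :: "real \<Rightarrow> int \<Rightarrow> int \<Rightarrow> real \<times> real" where
  "cell_centre h i j = (h * (of_int i + 1/2), h * (of_int j + 1/2))"

definition is_apex where
  "is_apex \<eta> h i j X A \<longleftrightarrow>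
     near h (cell_centre h i j) \<eta> 0 0 0 ((momentum (i + 1) j - momentum (i + 1) (j + 1)) / 2) A \<and>
     symplectic_form (X i j - A) (X (i + 1) j - A) = 0 \<and>
     symplectic_form (X (i + 1) j - A) (X (i + 1) (j + 1) - A) = 0 \<and>
     symplectic_form (X (i + 1) (j + 1) - A) (X i (j + 1) - A) = 0 \<and>
     symplectic_form (X i (j + 1) - A) (X i j - A) = 0"

lemma vertices:
  assumes "\<eta> > 0"
  obtains r where "r > 0"
    "\<And>h i j. h > 0 \<Longrightarrow> h \<le> r \<Longrightarrow> near h (h * of_int i, h * of_int j) \<eta> 0 0 (momentum i j) 0 (vertex \<eta> h i j)"
    "\<And>h i j. h > 0 \<Longrightarrow> h \<le> r \<Longrightarrow>
      symplectic_form (vertex \<eta> h (i + 1) (j + 1) - vertex \<eta> h i j) (vertex \<eta> h i (j + 1) - vertex \<eta> h (i + 1) j) = 0"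
proof -
  obtain r1 where r1: "r1 > 0"
    and nm: "\<And>h z. h > 0 \<Longrightarrow> h \<le> r1 \<Longrightarrow> near h z \<eta> 0 0 0 0 (hor_mid h z)"
      "\<And>h z. h > 0 \<Longrightarrow> h \<le> r1 \<Longrightarrow>
        symplectic_form (F (z + (- h, 0))) (hor_mid h z) + symplectic_form (hor_mid h z) (F (z + (h, 0)))
          = hor_action (fst z - h) (fst z + h) (snd z)"
      "\<And>h z. h > 0 \<Longrightarrow> h \<le> r1 \<Longrightarrow> near h z \<eta> 0 0 1 0 (ver_mid h z)"
      "\<And>h z. h > 0 \<Longrightarrow> h \<le> r1 \<Longrightarrow>
        symplectic_form (F (z + (0, - h))) (ver_mid h z) + symplectic_form (ver_mid h z) (F (z + (0, h)))
          = ver_action (fst z) (snd z - h) (snd z + h)"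
    by (fact midpoints[OF assms])
  obtain r2 where r2: "r2 > 0" and c: "\<And>h z. h > 0 \<Longrightarrow> h \<le> r2 \<Longrightarrow> is_centre \<eta> h z (centre \<eta> h z)"
    by (fact centre[OF assms])
  have 1: "near h (h * of_int i, h * of_int j) \<eta> 0 0 (momentum i j) 0 (vertex \<eta> h i j)"
    if h: "h > 0" "h \<le> min r1 r2" for h i j
    using h nm(1,3) c[unfolded is_centre_def] near_self assms by (auto simp: vertex_def momentum_def Let_def)
  have 2: "symplectic_form (vertex \<eta> h (i + 1) (j + 1) - vertex \<eta> h i j)
      (vertex \<eta> h i (j + 1) - vertex \<eta> h (i + 1) j) = 0" if h: "h > 0" "h \<le> min r1 r2" for h i j
  proof -
    \<comment> \<open>The only odd-odd corner of the cell. The cell is one of the four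
      quadrilaterals around that centre, and its diagonals are those of \<open>is_centre\<close> up
      to sign and order.\<close>
    let ?z = "(h * of_int (if even i then i + 1 else i), h * of_int (if even j then j + 1 else j))"
    have "is_centre \<eta> h ?z (centre \<eta> h ?z)" using c h by simp
    note eqs = this[unfolded is_centre_def, THEN conjunct2]
    have swap: "symplectic_form P Q = 0 \<longleftrightarrow> symplectic_form Q P = 0" for P Q :: "(real^'n) \<times> (real^'n)"
      using symplectic_form_skew[of P Q] by auto
    from eqs eqs[unfolded swap[of "centre _ _ _ - _"]] show ?thesis
      by (cases "even i"; cases "even j")
        (simp_all add: vertex_def Let_def algebra_simps symplectic_simps)
  qed
  have "min r1 r2 > 0" using r1 r2 by simp
  from that[OF this 1 2] show ?thesis .
qed

definition "apex \<eta> \<delta> h i j = (SOME A. is_apex \<eta> h i j (vertex \<delta> h) A)"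

text \<open>Two tolerances are needed, since solving for the apex amplifies the error of the
  vertices by 2016 K^2; \<open>vertex\<close> takes the smaller one, because its centres are chosen
  relative to it.\<close>

lemma apex:
  assumes "\<eta> > 0"
  obtains \<delta> r where "\<delta> > 0" "\<delta> \<le> \<eta>" "r > 0"
    "\<And>h i j. h > 0 \<Longrightarrow> h \<le> r \<Longrightarrow> near h (h * of_int i, h * of_int j) \<delta> 0 0 (momentum i j) 0 (vertex \<delta> h i j)"
    "\<And>h i j. h > 0 \<Longrightarrow> h \<le> r \<Longrightarrow> is_apex \<eta> h i j (vertex \<delta> h) (apex \<eta> \<delta> h i j)"
proof -
  obtain K where K: "K \<ge> 1" "\<And>x. norm (e1 x) \<le> K" "\<And>x. norm (e2 x) \<le> K" "\<And>x. norm (f1 x) \<le> K" "\<And>x. norm (f2 x) \<le> K"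
    using bound by blast
  define \<delta> where "\<delta> = min \<eta> (min (\<eta> / (2016 * K^2)) (1 / (216 * K)))"
  have "\<delta> \<le> \<eta> / (2016 * K^2)" "\<delta> \<le> 1 / (216 * K)" "\<delta> \<le> \<eta>" by (simp_all add: \<delta>_def)
  then have \<delta>: "\<delta> > 0" "2016 * K^2 * \<delta> \<le> \<eta>" "216 * K * \<delta> \<le> 1" "\<delta> \<le> \<eta>"
    using assms K(1) by (simp add: \<delta>_def, simp_all add: le_divide_eq mult.commute)
  have \<delta>2: "\<delta> / 2 > 0" using \<delta> by simp
  obtain r1 where r1: "r1 > 0" "\<And>h x a b p q Y. h > 0 \<Longrightarrow> h \<le> r1 \<Longrightarrow> \<bar>a\<bar> \<le> 3 \<Longrightarrow> \<bar>b\<bar> \<le> 3 \<Longrightarrow> \<bar>p\<bar> \<le> 1 \<Longrightarrow> \<bar>q\<bar> \<le> 1 \<Longrightarrow>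
     near h (x + h *\<^sub>R (a, b)) (\<delta>/2) 0 0 p q Y \<Longrightarrow> near h x (2 * (\<delta>/2)) a b p q Y"
    by (fact near_shift[OF \<delta>2])
  obtain r2 where r2: "r2 > 0"
    and v: "\<And>h i j. h > 0 \<Longrightarrow> h \<le> r2 \<Longrightarrow>
      near h (h * of_int i, h * of_int j) (\<delta>/2) 0 0 (momentum i j) 0 (vertex (\<delta>/2) h i j)"
     "\<And>h i j. h > 0 \<Longrightarrow> h \<le> r2 \<Longrightarrow>
      symplectic_form (vertex (\<delta>/2) h (i + 1) (j + 1) - vertex (\<delta>/2) h i j) (vertex (\<delta>/2) h i (j + 1) - vertex (\<delta>/2) h (i + 1) j) = 0"
    by (fact vertices[OF \<delta>2])
  have main: "is_apex \<eta> h i j (vertex (\<delta>/2) h) (apex \<eta> (\<delta>/2) h i j)" if h: "h > 0" "h \<le> min r1 r2" for h i j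
  proof -
    have hr: "h \<le> r1" "h \<le> r2" using h by auto
    define z where "z = cell_centre h i j"
    let ?X = "vertex (\<delta>/2) h"
    define D where "D k = [?X i j, ?X (i + 1) j, ?X (i + 1) (j + 1), ?X i (j + 1)] ! k" for k :: nat
    have sD: "D 0 = ?X i j" "D 1 = ?X (i + 1) j" "D 2 = ?X (i + 1) (j + 1)" "D 3 = ?X i (j + 1)"
      by (simp_all add: D_def)
    define a where "a = momentum (i + 1) j"
    define b where "b = momentum (i + 1) (j + 1)"
    \<comment> \<open>The momentum changes sign from column to column, and exactly one of the rows j
      and j + 1 carries momentum. This is the skewness of the cell.\<close>
    have ab: "momentum i j = - a" "momentum i (j + 1) = - b" "\<bar>a\<bar> \<le> 1" "\<bar>b\<bar> \<le> 1" "\<bar>a - b\<bar> = 1"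
      by (auto simp: momentum_def a_def b_def)
    note sh = r1(2)[OF h(1) hr(1), simplified]
    have pts: "z + h *\<^sub>R (-1/2, -1/2) = (h * of_int i, h * of_int j)"
      "z + h *\<^sub>R (1/2, -1/2) = (h * of_int (i + 1), h * of_int j)"
      "z + h *\<^sub>R (1/2, 1/2) = (h * of_int (i + 1), h * of_int (j + 1))"
      "z + h *\<^sub>R (-1/2, 1/2) = (h * of_int i, h * of_int (j + 1))"
      by (simp_all add: z_def cell_centre_def algebra_simps)
    have nD: "near h z \<delta> (-1/2) (-1/2) (-a) 0 (D 0)" "near h z \<delta> (1/2) (-1/2) a 0 (D 1)"
      "near h z \<delta> (1/2) (1/2) b 0 (D 2)" "near h z \<delta> (-1/2) (1/2) (-b) 0 (D 3)"
      using v(1)[OF h(1) hr(2), of i j] v(1)[OF h(1) hr(2), of "i + 1" j]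
        v(1)[OF h(1) hr(2), of "i + 1" "j + 1"] v(1)[OF h(1) hr(2), of i "j + 1"]
      unfolding sD pts[symmetric] ab(1,2) a_def[symmetric] b_def[symmetric]
      by (intro sh; (assumption)?; use ab in simp)+
    define D' where "D' k = scaled h z (D k)" for k
    have DD: "D' k - D' l = (1/h) *\<^sub>R (D k - D l)" for k l by (simp add: D'_def scaled_diff)
    have "symplectic_form (D' 2 - D' 0) (D' 3 - D' 1) = 0"
      unfolding DD symplectic.scaleR_left symplectic.scaleR_right
      using v(2)[OF h(1) hr(2), of i j] unfolding sD by simp
    from quad_apex[OF frame K nD[unfolded near_def, folded D'_def] ab(3-5) this \<delta>(3)]
    obtain A' where A': "norm (A' - frame_point (e1 z) (e2 z) (f1 z) (f2 z) 0 0 0 ((a - b)/2)) \<le> 2016 * K^2 * \<delta>"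
     "symplectic_form (D' 0 - A') (D' 1 - A') = 0" "symplectic_form (D' 1 - A') (D' 2 - A') = 0"
     "symplectic_form (D' 2 - A') (D' 3 - A') = 0" "symplectic_form (D' 3 - A') (D' 0 - A') = 0"
      by blast
    define A where "A = F z + h *\<^sub>R A'"
    have sA: "scaled h z A = A'" using h(1) by (simp add: A_def scaled_def)
    have DA: "D' k - A' = (1/h) *\<^sub>R (D k - A)" for k
      by (simp add: D'_def sA[symmetric] scaled_diff)
    have "near h z \<eta> 0 0 0 ((a - b)/2) A"
      using A'(1) \<delta>(2) sA by (simp add: near_def)
    moreover have "symplectic_form (D 0 - A) (D 1 - A) = 0" "symplectic_form (D 1 - A) (D 2 - A) = 0"
     "symplectic_form (D 2 - A) (D 3 - A) = 0" "symplectic_form (D 3 - A) (D 0 - A) = 0"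
      using A'(2-5) h(1) unfolding DA by (simp_all only: symplectic.scaleR_left symplectic.scaleR_right) simp_all
    ultimately have "is_apex \<eta> h i j ?X A"
      unfolding is_apex_def sD[symmetric] a_def[symmetric] b_def[symmetric] z_def[symmetric] by blast
    then show ?thesis unfolding apex_def by (rule someI)
  qed
  have "min r1 r2 > 0" "\<delta> / 2 \<le> \<eta>" using r1(1) r2 \<delta> by simp_all
  moreover have "near h (h * of_int i, h * of_int j) (\<delta>/2) 0 0 (momentum i j) 0 (vertex (\<delta>/2) h i j)"
    if "h > 0" "h \<le> min r1 r2" for h i j using v(1) that by simp
  ultimately show ?thesis using that[OF \<delta>2 _ _ _ main] by blast
qed

section \<open>Periodicity of the construction\<close>

lemma periodic_add:
  "F (z + (of_int i, of_int j) + w) = F (z + w)"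
  using periodic(1)[of "z + w" i j] by (simp add: add_ac)

lemma scaled_periodic: "scaled h (z + (of_int i, of_int j)) Y = scaled h z Y"
  by (simp add: scaled_def periodic)

lemma mid_periodic:
  "hor_mid h (z + (of_int i, of_int j)) = hor_mid h z"
  "ver_mid h (z + (of_int i, of_int j)) = ver_mid h z"
proof -
  have "fst (z + (of_int i, of_int j)) = fst z + of_int i" "snd (z + (of_int i, of_int j)) = snd z + of_int j"
    by simp_all
  moreover have "x + of_int k - h = x - h + of_int k" "x + of_int k + h = x + h + of_int k" for x and k :: int
    by simp_all
  ultimately show "hor_mid h (z + (of_int i, of_int j)) = hor_mid h z"
    "ver_mid h (z + (of_int i, of_int j)) = ver_mid h z"
    by (simp_all only: hor_mid_def ver_mid_def edge_point_def periodic_add periodic scaled_periodic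
        hor_action_periodic ver_action_periodic)
qed

lemma mid_periodic_add:
  "hor_mid h (z + (of_int i, of_int j) + w) = hor_mid h (z + w)"
  "ver_mid h (z + (of_int i, of_int j) + w) = ver_mid h (z + w)"
  using mid_periodic[of h "z + w" i j] by (simp_all add: add_ac)

lemma near_periodic: "near h (z + (of_int i, of_int j)) \<eta> a b p q Y = near h z \<eta> a b p q Y"
  by (simp add: near_def scaled_periodic periodic)

lemma centre_periodic: "centre \<eta> h (z + (of_int i, of_int j)) = centre \<eta> h z"
  by (simp add: centre_def is_centre_def mid_periodic_add periodic_add near_periodic)

text \<open>The number m of grid steps per period must be even, since the role of a vertex depends
  on the parities of its indices.\<close>

lemma vertex_periodic:
  assumes "h * of_int m = 1" "even m"
  shows "vertex \<eta> h (i + m * k) (j + m * l) = vertex \<eta> h i j"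
proof -
  have "h * of_int (i + m * k) = h * of_int i + of_int k" for i k
    using assms(1) by (simp add: distrib_left mult.assoc[symmetric])
  then have "(h * of_int (i + m * k), h * of_int (j + m * l)) = (h * of_int i, h * of_int j) + (of_int k, of_int l)"
    by simp
  then show ?thesis
    unfolding vertex_def Let_def
    by (simp only: periodic mid_periodic centre_periodic even_add even_mult_iff assms(2) simp_thms)
qed

lemma apex_periodic:
  assumes "h * of_int m = 1" "even m"
  shows "apex \<eta> \<delta> h (i + m * k) (j + m * l) = apex \<eta> \<delta> h i j"
proof -
  have "h * (of_int (i + m * k) + 1/2) = h * (of_int i + 1/2) + of_int k" for i k
    using assms(1) by (simp add: distrib_left mult.assoc[symmetric])
  then have c: "cell_centre h (i + m * k) (j + m * l) = cell_centre h i j + (of_int k, of_int l)"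
    by (simp add: cell_centre_def)
  have v: "vertex \<delta> h (i + m * k + 1) (j + m * l) = vertex \<delta> h (i + 1) j"
    "vertex \<delta> h (i + m * k + 1) (j + m * l + 1) = vertex \<delta> h (i + 1) (j + 1)"
    "vertex \<delta> h (i + m * k) (j + m * l + 1) = vertex \<delta> h i (j + 1)"
    using vertex_periodic[OF assms, of \<delta> "i + 1" k j l] vertex_periodic[OF assms, of \<delta> "i + 1" k "j + 1" l]
      vertex_periodic[OF assms, of \<delta> i k "j + 1" l] by (simp_all add: add_ac)
  have mo: "momentum (i + m * k + 1) (j + m * l) = momentum (i + 1) j"
    "momentum (i + m * k + 1) (j + m * l + 1) = momentum (i + 1) (j + 1)"
    using assms(2) by (simp_all add: momentum_def)
  show ?thesis
    unfolding apex_def is_apex_def by (simp only: c v mo near_periodic vertex_periodic[OF assms])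
qed

end

text \<open>The interface to the combinatorial part: frames and momenta disappear. The last clause
  retains what injectivity requires: near each vertex some linear projection maps the grid almost to
  the standard grid, up to a translation.\<close>

lemma (in periodic_isotropic) grid_approximation:
  assumes "\<eta> > 0"
  obtains h :: real and m :: int and X A :: "int \<Rightarrow> int \<Rightarrow> (real^'n) \<times> (real^'n)" where
    "h > 0" "h * of_int m = 1"
    "\<And>i j k l. X (i + m * k) (j + m * l) = X i j" "\<And>i j k l. A (i + m * k) (j + m * l) = A i j"
    "\<And>i j. symplectic_form (X i j - A i j) (X (i + 1) j - A i j) = 0"
    "\<And>i j. symplectic_form (X (i + 1) j - A i j) (X (i + 1) (j + 1) - A i j) = 0"
    "\<And>i j. symplectic_form (X (i + 1) (j + 1) - A i j) (X i (j + 1) - A i j) = 0"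
    "\<And>i j. symplectic_form (X i (j + 1) - A i j) (X i j - A i j) = 0"
    "\<And>i j. norm (X i j - F (h * of_int i, h * of_int j)) \<le> \<eta>"
    "\<And>i j. norm (A i j - F (cell_centre h i j)) \<le> \<eta>"
    "\<And>z w. norm (z - w) \<le> 2 * h \<Longrightarrow> norm (F z - F w) \<le> \<eta>"
    "\<And>i0 j0. \<exists>L c. linear L \<and> (\<forall>i j. \<bar>i - i0\<bar> \<le> 2 \<longrightarrow> \<bar>j - j0\<bar> \<le> 2 \<longrightarrow>
       norm (L (X i j) - c - (real_of_int i, real_of_int j)) \<le> \<eta> \<and>
       norm (L (A i j) - c - (real_of_int i + 1/2, real_of_int j + 1/2)) \<le> \<eta>)"
proof -
  obtain K where K: "K \<ge> 1" "\<And>x. norm (e1 x) \<le> K" "\<And>x. norm (e2 x) \<le> K" "\<And>x. norm (f1 x) \<le> K" "\<And>x. norm (f2 x) \<le> K"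
    using bound by blast
  define \<epsilon> where "\<epsilon> = min 1 (\<eta> / (8 * K))"
  have "\<epsilon> \<le> 1" "\<epsilon> \<le> \<eta> / (8 * K)" by (simp_all add: \<epsilon>_def)
  then have \<epsilon>: "\<epsilon> > 0" "\<epsilon> \<le> 1" "8 * K * \<epsilon> \<le> \<eta>"
    using assms K(1) by (simp add: \<epsilon>_def, simp_all add: le_divide_eq mult.commute)
  obtain \<delta> r1 where \<delta>: "\<delta> > 0" "\<delta> \<le> \<epsilon>" and r1: "r1 > 0"
    and v: "\<And>h i j. h > 0 \<Longrightarrow> h \<le> r1 \<Longrightarrow> near h (h * of_int i, h * of_int j) \<delta> 0 0 (momentum i j) 0 (vertex \<delta> h i j)"
    and a: "\<And>h i j. h > 0 \<Longrightarrow> h \<le> r1 \<Longrightarrow> is_apex \<epsilon> h i j (vertex \<delta> h) (apex \<epsilon> \<delta> h i j)"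
    by (fact apex[OF \<epsilon>(1)])
  obtain r2 where r2: "r2 > 0" and sh: "\<And>h x a b p q Y. h > 0 \<Longrightarrow> h \<le> r2 \<Longrightarrow>
     \<bar>a\<bar> \<le> 3 \<Longrightarrow> \<bar>b\<bar> \<le> 3 \<Longrightarrow> \<bar>p\<bar> \<le> 1 \<Longrightarrow> \<bar>q\<bar> \<le> 1 \<Longrightarrow>
     near h (x + h *\<^sub>R (a, b)) \<epsilon> 0 0 p q Y \<Longrightarrow> near h x (2 * \<epsilon>) a b p q Y"
    by (fact near_shift[OF \<epsilon>(1)])
  obtain r3 where r3: "r3 > 0" and uc: "\<And>x y. norm (y - x) \<le> r3 \<Longrightarrow> norm (F y - F x) \<le> \<eta>"
    using periodic_uniformly_continuous[OF cont_F periodic(1) assms] by blast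
  define r where "r = min (min r1 r2) (min (r3 / 2) (\<eta> / (3 * K)))"
  have r: "r > 0" "r \<le> r1" "r \<le> r2" "r \<le> r3 / 2" "r \<le> \<eta> / (3 * K)"
    using r1 r2 r3 assms K(1) by (simp_all add: r_def)
  obtain N :: nat where N: "N > 0" "inverse (of_nat N) < r"
    using ex_inverse_of_nat_less[OF r(1)] by blast
  \<comment> \<open>Even, so that the pattern of parities is periodic.\<close>
  define m :: int where "m = 2 * int N"
  define h where "h = 1 / real_of_int m"
  have m: "m > 0" "even m" using N by (simp_all add: m_def)
  then have h: "h > 0" "h * of_int m = 1" by (simp_all add: h_def)
  have "h \<le> inverse (of_nat N)" using N by (simp add: h_def m_def field_simps)
  then have hr: "h \<le> r1" "h \<le> r2" "2 * h \<le> r3" "h \<le> \<eta> / (3 * K)" using N r by linarith+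
  define X where "X = vertex \<delta> h"
  define A where "A = apex \<epsilon> \<delta> h"
  define q where "q i j = (momentum (i + 1) j - momentum (i + 1) (j + 1)) / 2" for i j
  have mom: "\<bar>momentum i j\<bar> \<le> 1" "\<bar>q i j\<bar> \<le> 1" for i j
    by (auto simp: momentum_def q_def)
  have nX: "near h (h * of_int i, h * of_int j) \<epsilon> 0 0 (momentum i j) 0 (X i j)" for i j
    using near_mono[OF v[OF h(1) hr(1)] \<delta>(2)] by (simp add: X_def)
  have ap: "is_apex \<epsilon> h i j X (A i j)" for i j
    using a[OF h(1) hr(1)] by (simp add: X_def A_def)
  then have nA: "near h (cell_centre h i j) \<epsilon> 0 0 0 (q i j) (A i j)" for i j
    by (simp add: is_apex_def q_def)
  have close: "norm (Y - F x) \<le> \<eta>" if "near h x \<epsilon> 0 0 p q Y" "\<bar>p\<bar> + \<bar>q\<bar> \<le> 2" for x p q Y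
  proof -
    have "norm (scaled h x Y) \<le> norm (frame_point (e1 x) (e2 x) (f1 x) (f2 x) 0 0 p q)
        + norm (scaled h x Y - frame_point (e1 x) (e2 x) (f1 x) (f2 x) 0 0 p q)"
      by (rule norm_triangle_sub)
    also have "\<dots> \<le> 2 * K + \<epsilon>"
    proof (rule add_mono)
      show "norm (frame_point (e1 x) (e2 x) (f1 x) (f2 x) 0 0 p q) \<le> 2 * K"
        unfolding frame_point_def by (rule norm_combination_le) (use K that in auto)
    qed (use that in \<open>simp add: near_def\<close>)
    also have "\<dots> \<le> 3 * K" using \<epsilon>(2) K(1) by simp
    finally have "norm (Y - F x) \<le> h * (3 * K)"
      using h(1) by (simp add: scaled_def divide_le_eq mult.commute)
    also have "\<dots> \<le> \<eta>" using hr(4) K(1) by (simp add: le_divide_eq)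
    finally show ?thesis .
  qed
  have proj: "\<exists>L c. linear L \<and> (\<forall>i j. \<bar>i - i0\<bar> \<le> 2 \<longrightarrow> \<bar>j - j0\<bar> \<le> 2 \<longrightarrow>
       norm (L (X i j) - c - (real_of_int i, real_of_int j)) \<le> \<eta> \<and>
       norm (L (A i j) - c - (real_of_int i + 1/2, real_of_int j + 1/2)) \<le> \<eta>)" for i0 j0
  proof -
    define x where "x = (h * of_int i0, h * of_int j0)"
    \<comment> \<open>Pairing with \<open>f1\<close> and \<open>f2\<close> annihilates both momenta
      and reads off the position; division by h makes the grid standard. The total error is 2 * 2 *
      (2 \<epsilon> K) = 8 K \<epsilon>.\<close>
    define L where "L Y = (1/h) *\<^sub>R (symplectic_form Y (f1 x), symplectic_form Y (f2 x))" for Y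
    define c where "c = L (F x) - (of_int i0, of_int j0)"
    have lin: "linear L"
      by (rule linearI) (simp_all add: L_def symplectic_simps algebra_simps add_divide_distrib)
    have key: "norm (L Y - c - (of_int i0 + a, of_int j0 + b)) \<le> \<eta>" if "near h x (2 * \<epsilon>) a b p q Y" for Y a b p q
    proof -
      let ?S = "scaled h x Y - frame_point (e1 x) (e2 x) (f1 x) (f2 x) a b p q"
      have eq: "L Y - c - (of_int i0 + a, of_int j0 + b) = (symplectic_form ?S (f1 x), symplectic_form ?S (f2 x))"
        by (simp add: L_def c_def scaled_def frame_point_def symplectic_simps symplectic_frameD[OF frame]
            algebra_simps diff_divide_distrib)
      have "norm (L Y - c - (of_int i0 + a, of_int j0 + b)) \<le> \<bar>symplectic_form ?S (f1 x)\<bar> + \<bar>symplectic_form ?S (f2 x)\<bar>"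
        unfolding eq
        using norm_Pair_le[of "symplectic_form ?S (f1 x)" "symplectic_form ?S (f2 x)"] by (simp only: real_norm_def)
      also have "\<dots> \<le> 2 * (norm ?S * norm (f1 x)) + 2 * (norm ?S * norm (f2 x))"
        by (rule add_mono[OF abs_symplectic_form_le abs_symplectic_form_le])
      also have "\<dots> \<le> 2 * (2 * \<epsilon> * K) + 2 * (2 * \<epsilon> * K)"
      proof -
        have "norm ?S \<le> 2 * \<epsilon>" using that by (simp only: near_def)
        then have "norm ?S * norm (f x) \<le> 2 * \<epsilon> * K" if "norm (f x) \<le> K" for f :: "_ \<Rightarrow> (real^'n) \<times> (real^'n)"
          using that \<epsilon>(1) by (intro mult_mono) simp_all
        then show ?thesis using K(4,5)[of x] by (intro add_mono mult_left_mono) simp_all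
      qed
      also have "\<dots> \<le> \<eta>" using \<epsilon>(3) by (simp add: mult_ac)
      finally show ?thesis .
    qed
    have pts: "(h * of_int i, h * of_int j) = x + h *\<^sub>R (of_int (i - i0), of_int (j - j0))"
      "cell_centre h i j = x + h *\<^sub>R (of_int (i - i0) + 1/2, of_int (j - j0) + 1/2)" for i j
      by (simp_all add: x_def cell_centre_def right_diff_distrib distrib_left)
    have "norm (L (X i j) - c - (real_of_int i, real_of_int j)) \<le> \<eta> \<and>
       norm (L (A i j) - c - (of_int i + 1/2, of_int j + 1/2)) \<le> \<eta>"
      if ij: "\<bar>i - i0\<bar> \<le> 2" "\<bar>j - j0\<bar> \<le> 2" for i j
    proof -
      have b: "\<bar>real_of_int (i - i0)\<bar> \<le> 2" "\<bar>real_of_int (j - j0)\<bar> \<le> 2"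
        using ij by (simp_all only: of_int_abs[symmetric] of_int_le_numeral_iff)
      then have b': "\<bar>real_of_int (i - i0)\<bar> \<le> 3" "\<bar>real_of_int (j - j0)\<bar> \<le> 3"
        "\<bar>real_of_int (i - i0) + 1/2\<bar> \<le> 3" "\<bar>real_of_int (j - j0) + 1/2\<bar> \<le> 3" by linarith+
      have "near h x (2 * \<epsilon>) (of_int (i - i0)) (of_int (j - j0)) (momentum i j) 0 (X i j)"
        by (rule sh[OF h(1) hr(2) b'(1,2) mom(1) _ nX[of i j, unfolded pts]]) simp
      moreover have "near h x (2 * \<epsilon>) (of_int (i - i0) + 1/2) (of_int (j - j0) + 1/2) 0 (q i j) (A i j)"
        by (rule sh[OF h(1) hr(2) b'(3,4) _ mom(2) nA[of i j, unfolded pts]]) simp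
      ultimately show ?thesis
        using key[of "of_int (i - i0)" "of_int (j - j0)"] key[of "of_int (i - i0) + 1/2" "of_int (j - j0) + 1/2"]
        by (simp add: algebra_simps)
    qed
    then show ?thesis using lin by blast
  qed
  show ?thesis
  proof (rule that[of h m X A, OF h])
    show "X (i + m * k) (j + m * l) = X i j" "A (i + m * k) (j + m * l) = A i j" for i j k l
      using vertex_periodic[OF h(2) m(2)] apex_periodic[OF h(2) m(2)] by (simp_all add: X_def A_def)
    show "symplectic_form (X i j - A i j) (X (i + 1) j - A i j) = 0"
      "symplectic_form (X (i + 1) j - A i j) (X (i + 1) (j + 1) - A i j) = 0"
      "symplectic_form (X (i + 1) (j + 1) - A i j) (X i (j + 1) - A i j) = 0"
      "symplectic_form (X i (j + 1) - A i j) (X i j - A i j) = 0" for i j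
      using ap[of i j] unfolding is_apex_def by blast+
    show "norm (X i j - F (h * of_int i, h * of_int j)) \<le> \<eta>" for i j
      using close[OF nX[of i j]] mom(1)[of i j] by simp
    show "norm (A i j - F (cell_centre h i j)) \<le> \<eta>" for i j
      using close[OF nA[of i j]] mom(2)[of i j] by simp
    show "norm (F z - F w) \<le> \<eta>" if "norm (z - w) \<le> 2 * h" for z w
      using uc[of z w] that hr(3) by simp
  qed (rule proj)
qed

section \<open>Piecewise linear interpolation on the grid\<close>

text \<open>The five coefficients are the hat functions of the corners and the centre of a unit
  square cut by both diagonals, in one formula for all four triangles.\<close>

definition cell_interpolation ::
  "(int \<Rightarrow> int \<Rightarrow> 'b::real_vector) \<Rightarrow> (int \<Rightarrow> int \<Rightarrow> 'b) \<Rightarrow> int \<Rightarrow> int \<Rightarrow> real \<times> real \<Rightarrow> 'b" where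
  "cell_interpolation X A i j z = (let u = fst z - of_int i; v = snd z - of_int j in
     max 0 (1 - u - v) *\<^sub>R X i j + max 0 (u - v) *\<^sub>R X (i + 1) j
   + max 0 (u + v - 1) *\<^sub>R X (i + 1) (j + 1) + max 0 (v - u) *\<^sub>R X i (j + 1)
   + (2 * min (min u (1 - u)) (min v (1 - v))) *\<^sub>R A i j)"

definition interpolation where
  "interpolation X A z = cell_interpolation X A \<lfloor>fst z\<rfloor> \<lfloor>snd z\<rfloor> z"

lemma cell_interpolation_right:
  assumes "fst z = of_int i + 1" "of_int j \<le> snd z" "snd z \<le> of_int j + 1"
  shows "cell_interpolation X A i j z = cell_interpolation X A (i + 1) j z"
  using assms by (simp add: cell_interpolation_def Let_def max_def min_def)

lemma cell_interpolation_top: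
  assumes "snd z = of_int j + 1" "of_int i \<le> fst z" "fst z \<le> of_int i + 1"
  shows "cell_interpolation X A i j z = cell_interpolation X A i (j + 1) z"
proof -
  define u where "u = fst z - of_int i"
  have "0 \<le> u" "u \<le> 1" using assms by (simp_all add: u_def)
  then have "max 0 (- u) = 0" "max 0 (u - 1) = 0" "max 0 u = u" "max 0 (1 - u) = 1 - u" "min (min u (1 - u)) 0 = 0"
    by (auto simp: max_def min_def)
  then show ?thesis
    using assms(1) by (simp add: cell_interpolation_def Let_def u_def[symmetric] add.commute)
qed

text \<open>\<open>interpolation\<close> selects its cell by rounding down; since formulas of
  adjacent cells agree on the common edge, any closed cell containing z may be used.\<close>

lemma interpolation_cell:
  assumes z: "of_int i \<le> fst z" "fst z \<le> of_int i + 1" "of_int j \<le> snd z" "snd z \<le> of_int j + 1"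
  shows "interpolation X A z = cell_interpolation X A i j z"
proof -
  have fl: "\<lfloor>x\<rfloor> = k \<or> x = of_int k + 1 \<and> \<lfloor>x\<rfloor> = k + 1" if "of_int k \<le> x" "x \<le> of_int k + 1" for x :: real and k
    using that by (cases "x = of_int k + 1") (auto simp: floor_eq_iff)
  have "cell_interpolation X A i j z = cell_interpolation X A \<lfloor>fst z\<rfloor> j z"
    using fl[OF z(1,2)] cell_interpolation_right[OF _ z(3,4)] by metis
  also have "\<dots> = cell_interpolation X A \<lfloor>fst z\<rfloor> \<lfloor>snd z\<rfloor> z"
    using fl[OF z(3,4)] cell_interpolation_top[of z j "\<lfloor>fst z\<rfloor>" X A] floor_correct[of "fst z"] by auto
  finally show ?thesis by (simp add: interpolation_def)
qed

text \<open>The triangles cut out by the diagonals of the unit squares are the chambers of the four families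
  of lines \<open>s \<in> \<int>\<close>, \<open>t \<in> \<int>\<close>, \<open>s + t \<in> \<int>\<close>, \<open>s - t \<in> \<int>\<close>.\<close>

definition chamber :: "int \<Rightarrow> int \<Rightarrow> int \<Rightarrow> int \<Rightarrow> (real \<times> real) set" where
  "chamber i j c d = {z. fst z \<in> {of_int i..of_int i + 1} \<and> snd z \<in> {of_int j..of_int j + 1} \<and>
     fst z + snd z \<in> {of_int c..of_int c + 1} \<and> fst z - snd z \<in> {of_int d..of_int d + 1}}"

text \<open>In the cell (i, j) the slabs c, d select one of the four triangles: lower (i + j, i -
  j), right (i + j + 1, i - j), upper (i + j + 1, i - j - 1), left (i + j, i - j - 1).\<close>

definition chamber_index :: "int \<Rightarrow> int \<Rightarrow> int \<Rightarrow> int \<Rightarrow> bool" where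
  "chamber_index i j c d \<longleftrightarrow> c \<in> {i + j, i + j + 1} \<and> d \<in> {i - j - 1, i - j}"

lemma chamber_covers:
  "\<exists>i j c d. chamber_index i j c d \<and> z \<in> chamber i j c d \<and> i = \<lfloor>fst z\<rfloor> \<and> j = \<lfloor>snd z\<rfloor>"
proof -
  let ?i = "\<lfloor>fst z\<rfloor>" and ?j = "\<lfloor>snd z\<rfloor>" and ?c = "\<lfloor>fst z + snd z\<rfloor>" and ?d = "\<lfloor>fst z - snd z\<rfloor>"
  have "chamber_index ?i ?j ?c ?d" unfolding chamber_index_def insert_iff empty_iff by linarith
  moreover have "z \<in> chamber ?i ?j ?c ?d" unfolding chamber_def mem_Collect_eq atLeastAtMost_iff by linarith
  ultimately show ?thesis by blast
qed

text \<open>The two partial derivatives on the triangle. Along the grid side this is the difference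
  of its ends; across it, the apex minus the midpoint of the side, up to sign, divided by the height
  1/2.\<close>

definition chamber_gradient where
  "chamber_gradient X A i j c d =
    (if c = i + j then
      (if d = i - j then (X (i + 1) j - X i j, 2 *\<^sub>R A i j - X i j - X (i + 1) j)
       else (2 *\<^sub>R A i j - X i j - X i (j + 1), X i (j + 1) - X i j))
     else
      (if d = i - j then (X (i + 1) j + X (i + 1) (j + 1) - 2 *\<^sub>R A i j, X (i + 1) (j + 1) - X (i + 1) j)
       else (X (i + 1) (j + 1) - X i (j + 1), X (i + 1) (j + 1) + X i (j + 1) - 2 *\<^sub>R A i j)))"

lemma interpolation_affine:
  assumes "chamber_index i j c d" "z \<in> chamber i j c d"
  shows "interpolation X A z = A i j + (fst z - of_int i - 1/2) *\<^sub>R fst (chamber_gradient X A i j c d)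
     + (snd z - of_int j - 1/2) *\<^sub>R snd (chamber_gradient X A i j c d)"
proof -
  define u where "u = fst z - of_int i"
  define v where "v = snd z - of_int j"
  have z: "of_int i \<le> fst z" "fst z \<le> of_int i + 1" "of_int j \<le> snd z" "snd z \<le> of_int j + 1"
    using assms(2) by (auto simp: chamber_def)
  have uv: "0 \<le> u" "u \<le> 1" "0 \<le> v" "v \<le> 1" using z by (auto simp: u_def v_def)
  have I: "interpolation X A z = max 0 (1 - u - v) *\<^sub>R X i j + max 0 (u - v) *\<^sub>R X (i + 1) j
   + max 0 (u + v - 1) *\<^sub>R X (i + 1) (j + 1) + max 0 (v - u) *\<^sub>R X i (j + 1)
   + (2 * min (min u (1 - u)) (min v (1 - v))) *\<^sub>R A i j"
    unfolding interpolation_cell[OF z] cell_interpolation_def u_def v_def Let_def ..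
  have half: "(1/2) *\<^sub>R x + (1/2) *\<^sub>R x = x" "(1/2) *\<^sub>R x + ((1/2) *\<^sub>R x + y) = x + y" for x y :: 'a
    by (simp_all add: add.assoc[symmetric] scaleR_left_distrib[symmetric])
  consider "c = i + j" "d = i - j" "u + v \<le> 1" "v \<le> u" | "c = i + j" "d \<noteq> i - j" "u + v \<le> 1" "u \<le> v"
    | "c \<noteq> i + j" "d = i - j" "1 \<le> u + v" "v \<le> u" | "c \<noteq> i + j" "d \<noteq> i - j" "1 \<le> u + v" "u \<le> v"
    using assms unfolding chamber_index_def chamber_def u_def v_def by auto
  then show ?thesis
  proof cases
    case 1
    then have "max 0 (1 - u - v) = 1 - u - v" "max 0 (u - v) = u - v" "max 0 (u + v - 1) = 0"
      "max 0 (v - u) = 0" "min (min u (1 - u)) (min v (1 - v)) = v" using uv by (auto simp: max_def min_def)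
    then show ?thesis
      unfolding I u_def[symmetric] v_def[symmetric] using 1
      by (simp add: chamber_gradient_def scaleR_add_left scaleR_diff_left scaleR_add_right scaleR_diff_right)
        (simp add: algebra_simps half scaleR_2)
  next
    case 2
    then have "max 0 (1 - u - v) = 1 - u - v" "max 0 (u - v) = 0" "max 0 (u + v - 1) = 0"
      "max 0 (v - u) = v - u" "min (min u (1 - u)) (min v (1 - v)) = u" using uv by (auto simp: max_def min_def)
    then show ?thesis
      unfolding I u_def[symmetric] v_def[symmetric] using 2
      by (simp add: chamber_gradient_def scaleR_add_left scaleR_diff_left scaleR_add_right scaleR_diff_right)
        (simp add: algebra_simps half scaleR_2)
  next
    case 3
    then have "max 0 (1 - u - v) = 0" "max 0 (u - v) = u - v" "max 0 (u + v - 1) = u + v - 1"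
      "max 0 (v - u) = 0" "min (min u (1 - u)) (min v (1 - v)) = 1 - u" using uv by (auto simp: max_def min_def)
    then show ?thesis
      unfolding I u_def[symmetric] v_def[symmetric] using 3
      by (simp add: chamber_gradient_def scaleR_add_left scaleR_diff_left scaleR_add_right scaleR_diff_right)
        (simp add: algebra_simps half scaleR_2)
  next
    case 4
    then have "max 0 (1 - u - v) = 0" "max 0 (u - v) = 0" "max 0 (u + v - 1) = u + v - 1"
      "max 0 (v - u) = v - u" "min (min u (1 - u)) (min v (1 - v)) = 1 - v" using uv by (auto simp: max_def min_def)
    then show ?thesis
      unfolding I u_def[symmetric] v_def[symmetric] using 4
      by (simp add: chamber_gradient_def scaleR_add_left scaleR_diff_left scaleR_add_right scaleR_diff_right)
        (simp add: algebra_simps half scaleR_2)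
  qed
qed

definition nearby_chambers :: "int \<Rightarrow> int \<Rightarrow> (int \<times> int \<times> int \<times> int) set" where
  "nearby_chambers i0 j0 = {(i, j, c, d). i \<in> {i0 - 1..i0 + 1} \<and> j \<in> {j0 - 1..j0 + 1} \<and> chamber_index i j c d}"

lemma finite_nearby_chambers: "finite (nearby_chambers i0 j0)"
proof (rule finite_subset)
  show "nearby_chambers i0 j0 \<subseteq> {i0 - 1..i0 + 1} \<times> {j0 - 1..j0 + 1}
      \<times> {i0 + j0 - 2..i0 + j0 + 3} \<times> {i0 - j0 - 3..i0 - j0 + 2}"
    by (auto simp: nearby_chambers_def chamber_index_def)
qed auto

text \<open>An open neighbourhood of the closed cell, wide enough to contain all cells that touch it
  up to boundary points. Its closed chambers have corners with indices at distance at most 2 from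
  (i0, j0).\<close>

definition window :: "int \<Rightarrow> int \<Rightarrow> (real \<times> real) set" where
  "window i0 j0 = {of_int i0 - 1<..<of_int i0 + 2} \<times> {of_int j0 - 1<..<of_int j0 + 2}"

lemma window_subset: "window i0 j0 \<subseteq> (\<Union>(i, j, c, d)\<in>nearby_chambers i0 j0. chamber i j c d)"
proof
  fix z assume z: "z \<in> window i0 j0"
  obtain i j c d where *: "chamber_index i j c d" "z \<in> chamber i j c d" "i = \<lfloor>fst z\<rfloor>" "j = \<lfloor>snd z\<rfloor>"
    using chamber_covers by blast
  have "i \<in> {i0 - 1..i0 + 1}" "j \<in> {j0 - 1..j0 + 1}"
    using z unfolding *(3,4) window_def by (auto simp: le_floor_iff floor_le_iff)
  then show "z \<in> (\<Union>(i, j, c, d)\<in>nearby_chambers i0 j0. chamber i j c d)"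
    using *(1,2) unfolding nearby_chambers_def by blast
qed

lemma open_window: "open (window i0 j0)"
  unfolding window_def by (intro open_Times open_greaterThanLessThan)

lemma convex_window: "convex (window i0 j0)"
  unfolding window_def by (intro convex_Times) auto

lemma in_window: "z \<in> window \<lfloor>fst z\<rfloor> \<lfloor>snd z\<rfloor>"
  unfolding window_def mem_Times_iff greaterThanLessThan_iff by linarith

lemma closed_chamber: "closed (chamber i j c d)"
  unfolding chamber_def atLeastAtMost_iff
  by (intro closed_Collect_conj closed_Collect_le continuous_intros)

lemma interpolation_continuous:
  fixes X A :: "int \<Rightarrow> int \<Rightarrow> 'b::real_normed_vector"
  shows "continuous_on UNIV (interpolation X A)"
proof (rule continuous_at_imp_continuous_on, rule ballI)
  fix z0 :: "real \<times> real"
  let ?I = "nearby_chambers \<lfloor>fst z0\<rfloor> \<lfloor>snd z0\<rfloor>" and ?W = "window \<lfloor>fst z0\<rfloor> \<lfloor>snd z0\<rfloor>"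
  have "continuous_on (\<Union>I\<in>?I. case I of (i, j, c, d) \<Rightarrow> chamber i j c d) (interpolation X A)"
  proof (rule continuous_on_closed_Union[OF finite_nearby_chambers])
    fix I assume I: "I \<in> ?I"
    obtain i j c d where [simp]: "I = (i, j, c, d)" by (cases I)
    show "closed (case I of (i, j, c, d) \<Rightarrow> chamber i j c d)" by (simp add: closed_chamber)
    have "chamber_index i j c d" using I by (simp add: nearby_chambers_def)
    then have "interpolation X A z = A i j + (fst z - of_int i - 1/2) *\<^sub>R fst (chamber_gradient X A i j c d)
     + (snd z - of_int j - 1/2) *\<^sub>R snd (chamber_gradient X A i j c d)" if "z \<in> chamber i j c d" for z
      using interpolation_affine that by blast
    then show "continuous_on (case I of (i, j, c, d) \<Rightarrow> chamber i j c d) (interpolation X A)"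
      by (simp cong: continuous_on_cong) (intro continuous_intros)
  qed
  then have "continuous_on ?W (interpolation X A)"
    using window_subset by (rule continuous_on_subset)
  then show "isCont (interpolation X A) z0"
    using open_window in_window by (simp add: continuous_on_eq_continuous_at)
qed

text \<open>Without errors the projected gradients would be the standard basis. The factor 4 comes
  from the derivative across a side, in which the apex counts twice and two vertices once
  each.\<close>

lemma chamber_gradient_projection:
  fixes X A :: "int \<Rightarrow> int \<Rightarrow> 'b::real_normed_vector"
  assumes L: "linear L"
    and X: "\<And>k l. k \<in> {i, i + 1} \<Longrightarrow> l \<in> {j, j + 1} \<Longrightarrow> norm (L (X k l) - c0 - (real_of_int k, real_of_int l)) \<le> \<eta>"
    and A: "norm (L (A i j) - c0 - (real_of_int i + 1/2, real_of_int j + 1/2)) \<le> \<eta>"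
  shows "norm (L (fst (chamber_gradient X A i j c d)) - (1, 0)) \<le> 4 * \<eta>"
    and "norm (L (snd (chamber_gradient X A i j c d)) - (0, 1)) \<le> 4 * \<eta>"
proof -
  define E where "E k l = L (X k l) - c0 - (of_int k, of_int l)" for k l
  define EA where "EA = L (A i j) - c0 - (real_of_int i + 1/2, real_of_int j + 1/2)"
  have E: "norm (E i j) \<le> \<eta>" "norm (E (i + 1) j) \<le> \<eta>" "norm (E i (j + 1)) \<le> \<eta>" "norm (E (i + 1) (j + 1)) \<le> \<eta>"
    "norm EA \<le> \<eta>"
    using X[of i j] X[of "i + 1" j] X[of i "j + 1"] X[of "i + 1" "j + 1"] A by (simp_all add: E_def EA_def)
  have LX: "L (X k l) = E k l + c0 + (of_int k, of_int l)" for k l by (simp add: E_def)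
  have LA: "L (A i j) = EA + c0 + (of_int i + 1/2, of_int j + 1/2)" by (simp add: EA_def)
  have n2: "norm (x - y) \<le> 4 * \<eta>" if "norm x \<le> \<eta>" "norm y \<le> \<eta>" for x y :: "real \<times> real"
    using that norm_triangle_ineq4[of x y] norm_ge_zero[of x] by linarith
  have n4: "norm (2 *\<^sub>R x - y - w) \<le> 4 * \<eta>" if "norm x \<le> \<eta>" "norm y \<le> \<eta>" "norm w \<le> \<eta>" for x y w :: "real \<times> real"
    using that norm_triangle_ineq4[of "2 *\<^sub>R x - y" w] norm_triangle_ineq4[of "2 *\<^sub>R x" y] by simp
  have n4': "norm (y + w - 2 *\<^sub>R x) \<le> 4 * \<eta>" if "norm x \<le> \<eta>" "norm y \<le> \<eta>" "norm w \<le> \<eta>" for x y w :: "real \<times> real"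
    using that norm_triangle_ineq4[of "y + w" "2 *\<^sub>R x"] norm_triangle_ineq[of y w] by simp
  have
    "L (X (i + 1) j - X i j) - (1, 0) = E (i + 1) j - E i j"
    "L (X (i + 1) (j + 1) - X i (j + 1)) - (1, 0) = E (i + 1) (j + 1) - E i (j + 1)"
    "L (X i (j + 1) - X i j) - (0, 1) = E i (j + 1) - E i j"
    "L (X (i + 1) (j + 1) - X (i + 1) j) - (0, 1) = E (i + 1) (j + 1) - E (i + 1) j"
    "L (2 *\<^sub>R A i j - X i j - X (i + 1) j) - (0, 1) = 2 *\<^sub>R EA - E i j - E (i + 1) j"
    "L (2 *\<^sub>R A i j - X i j - X i (j + 1)) - (1, 0) = 2 *\<^sub>R EA - E i j - E i (j + 1)"
    "L (X (i + 1) j + X (i + 1) (j + 1) - 2 *\<^sub>R A i j) - (1, 0) = E (i + 1) j + E (i + 1) (j + 1) - 2 *\<^sub>R EA"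
    "L (X (i + 1) (j + 1) + X i (j + 1) - 2 *\<^sub>R A i j) - (0, 1) = E (i + 1) (j + 1) + E i (j + 1) - 2 *\<^sub>R EA"
    by (simp_all only: linear_diff[OF L] linear_add[OF L] linear_scale[OF L] LX LA)
       (simp_all add: prod_eq_iff algebra_simps)
  note e = this
  show "norm (L (fst (chamber_gradient X A i j c d)) - (1, 0)) \<le> 4 * \<eta>"
    unfolding chamber_gradient_def
    by (cases "c = i + j"; cases "d = i - j") (simp_all only: simp_thms if_True if_False fst_conv e n2 n4 n4' E)
  show "norm (L (snd (chamber_gradient X A i j c d)) - (0, 1)) \<le> 4 * \<eta>"
    unfolding chamber_gradient_def
    by (cases "c = i + j"; cases "d = i - j") (simp_all only: simp_thms if_True if_False snd_conv e n2 n4 n4' E)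
qed

text \<open>Along a segment the projected interpolation differs from the identity by a map that is Lipschitz
  on each chamber, hence on the whole segment.\<close>

lemma interpolation_projection:
  fixes X A :: "int \<Rightarrow> int \<Rightarrow> 'b::real_normed_vector"
  assumes L: "linear L" and \<eta>: "\<eta> \<ge> 0"
    and XA: "\<And>i j. \<bar>i - i0\<bar> \<le> 2 \<Longrightarrow> \<bar>j - j0\<bar> \<le> 2 \<Longrightarrow> norm (L (X i j) - c0 - (real_of_int i, real_of_int j)) \<le> \<eta>"
      "\<And>i j. \<bar>i - i0\<bar> \<le> 2 \<Longrightarrow> \<bar>j - j0\<bar> \<le> 2 \<Longrightarrow> norm (L (A i j) - c0 - (real_of_int i + 1/2, real_of_int j + 1/2)) \<le> \<eta>"
    and z: "z \<in> window i0 j0" "w \<in> window i0 j0"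
  shows "norm (L (interpolation X A w) - L (interpolation X A z) - (w - z)) \<le> 8 * \<eta> * norm (w - z)"
proof -
  let ?G = "interpolation X A"
  define g where "g \<tau> = z + \<tau> *\<^sub>R (w - z)" for \<tau>
  define f where "f \<tau> = L (?G (g \<tau>)) - g \<tau>" for \<tau>
  let ?M = "8 * \<eta> * norm (w - z)"
  have "?M-lipschitz_on {0..1} f"
  proof (rule lipschitz_on_closed_Union[OF _ _ finite_nearby_chambers[of i0 j0]])
    show "0 \<le> ?M" using \<eta> by simp
    have "g \<tau> \<in> window i0 j0" if "\<tau> \<in> {0..1}" for \<tau>
    proof -
      have "g \<tau> = (1 - \<tau>) *\<^sub>R z + \<tau> *\<^sub>R w" by (simp add: g_def algebra_simps)
      then show ?thesis using convexD[OF convex_window z, of "1 - \<tau>" \<tau>] that by simp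
    qed
    then show "{0..1} \<subseteq> (\<Union>I\<in>nearby_chambers i0 j0. g -` (case I of (i, j, c, d) \<Rightarrow> chamber i j c d))"
      using window_subset[of i0 j0] unfolding vimage_UN[symmetric] subset_iff vimage_eq by blast
    fix I assume I: "I \<in> nearby_chambers i0 j0"
    obtain i j c d where [simp]: "I = (i, j, c, d)" by (cases I)
    have "continuous_on UNIV g" unfolding g_def by (intro continuous_intros)
    then show "closed (g -` (case I of (i, j, c, d) \<Rightarrow> chamber i j c d))"
      by (simp add: closed_vimage closed_chamber)
    let ?a = "fst (chamber_gradient X A i j c d)" and ?b = "snd (chamber_gradient X A i j c d)"
    have ij: "\<bar>k - i0\<bar> \<le> 2" "\<bar>l - j0\<bar> \<le> 2" if "k \<in> {i, i + 1}" "l \<in> {j, j + 1}" for k l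
      using I that by (auto simp: nearby_chambers_def)
    have gX: "norm (L (X k l) - c0 - (real_of_int k, real_of_int l)) \<le> \<eta>" if "k \<in> {i, i + 1}" "l \<in> {j, j + 1}" for k l
      using that by (intro XA(1) ij)
    have gA: "norm (L (A i j) - c0 - (of_int i + 1/2, of_int j + 1/2)) \<le> \<eta>"
      using XA(2) ij[of i j] by simp
    have grad: "norm (L ?a - (1, 0)) \<le> 4 * \<eta>" "norm (L ?b - (0, 1)) \<le> 4 * \<eta>"
      by (rule chamber_gradient_projection[where c = c and d = d and X = X and A = A, OF L gX gA]; assumption)+
    show "?M-lipschitz_on (g -` (case I of (i, j, c, d) \<Rightarrow> chamber i j c d)) f"
    proof (rule lipschitz_onI)
      fix \<sigma> \<tau> assume "\<sigma> \<in> g -` (case I of (i, j, c, d) \<Rightarrow> chamber i j c d)" "\<tau> \<in> g -` (case I of (i, j, c, d) \<Rightarrow> chamber i j c d)"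
      then have st: "g \<sigma> \<in> chamber i j c d" "g \<tau> \<in> chamber i j c d" by auto
      have ci: "chamber_index i j c d" using I by (simp add: nearby_chambers_def)
      have "?G (g \<sigma>) - ?G (g \<tau>) = (fst (g \<sigma>) - fst (g \<tau>)) *\<^sub>R ?a + (snd (g \<sigma>) - snd (g \<tau>)) *\<^sub>R ?b"
        by (simp add: interpolation_affine[OF ci st(1)] interpolation_affine[OF ci st(2)] algebra_simps)
      then have "L (?G (g \<sigma>)) - L (?G (g \<tau>)) = (fst (g \<sigma>) - fst (g \<tau>)) *\<^sub>R L ?a + (snd (g \<sigma>) - snd (g \<tau>)) *\<^sub>R L ?b"
        by (metis linear_diff[OF L] linear_add[OF L] linear_scale[OF L])
      then have "f \<sigma> - f \<tau> = (fst (g \<sigma> - g \<tau>)) *\<^sub>R (L ?a - (1, 0)) + (snd (g \<sigma> - g \<tau>)) *\<^sub>R (L ?b - (0, 1))"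
        by (simp add: f_def prod_eq_iff algebra_simps)
      also have "norm \<dots> \<le> \<bar>fst (g \<sigma> - g \<tau>)\<bar> * norm (L ?a - (1, 0)) + \<bar>snd (g \<sigma> - g \<tau>)\<bar> * norm (L ?b - (0, 1))"
        using norm_triangle_ineq[of "(fst (g \<sigma> - g \<tau>)) *\<^sub>R (L ?a - (1, 0))" "(snd (g \<sigma> - g \<tau>)) *\<^sub>R (L ?b - (0, 1))"]
        by (simp only: norm_scaleR)
      also have "\<dots> \<le> norm (g \<sigma> - g \<tau>) * (4 * \<eta>) + norm (g \<sigma> - g \<tau>) * (4 * \<eta>)"
        by (intro add_mono mult_mono abs_fst_le_norm abs_snd_le_norm grad norm_ge_zero)
      also have "\<dots> = ?M * \<bar>\<sigma> - \<tau>\<bar>"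
      proof -
        have "g \<sigma> - g \<tau> = (\<sigma> - \<tau>) *\<^sub>R (w - z)" by (simp add: g_def algebra_simps)
        then show ?thesis by simp
      qed
      finally show "dist (f \<sigma>) (f \<tau>) \<le> ?M * dist \<sigma> \<tau>" by (simp add: dist_norm)
    qed (use \<eta> in simp)
  qed
  from lipschitz_onD[OF this, of 1 0] have "norm (f 1 - f 0) \<le> ?M" by (simp add: dist_norm)
  moreover have "f 1 - f 0 = L (?G w) - L (?G z) - (w - z)" by (simp add: f_def g_def)
  ultimately show ?thesis by simp
qed

text \<open>With errors 1/16 the projected interpolation differs from the identity by a map with
  Lipschitz constant 8/16, so two points with the same value coincide.\<close>

lemma interpolation_inj_on_window:
  fixes X A :: "int \<Rightarrow> int \<Rightarrow> 'b::real_normed_vector"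
  assumes L: "linear L"
    and XA: "\<And>i j. \<bar>i - i0\<bar> \<le> 2 \<Longrightarrow> \<bar>j - j0\<bar> \<le> 2 \<Longrightarrow> norm (L (X i j) - c0 - (real_of_int i, real_of_int j)) \<le> 1/16"
      "\<And>i j. \<bar>i - i0\<bar> \<le> 2 \<Longrightarrow> \<bar>j - j0\<bar> \<le> 2 \<Longrightarrow> norm (L (A i j) - c0 - (real_of_int i + 1/2, real_of_int j + 1/2)) \<le> 1/16"
  shows "inj_on (interpolation X A) (window i0 j0)"
proof (rule inj_onI)
  fix z w assume "z \<in> window i0 j0" "w \<in> window i0 j0" "interpolation X A z = interpolation X A w"
  then have "norm (w - z) \<le> 1/2 * norm (w - z)"
    using interpolation_projection[where z = z and w = w, OF L _ XA] by (simp add: norm_minus_commute)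
  then show "z = w" by simp
qed

text \<open>From the centre each coordinate changes by at most 1/2, and the gradients are at most 4
  \<eta>; this gives 1 + 2 + 2 times \<eta>, which is crude but sufficient.\<close>

lemma interpolation_near_vertices:
  fixes X A :: "int \<Rightarrow> int \<Rightarrow> 'b::real_normed_vector"
  assumes "\<And>k l. k \<in> {\<lfloor>fst z\<rfloor>, \<lfloor>fst z\<rfloor> + 1} \<Longrightarrow> l \<in> {\<lfloor>snd z\<rfloor>, \<lfloor>snd z\<rfloor> + 1} \<Longrightarrow> norm (X k l - y) \<le> \<eta>"
    and "norm (A \<lfloor>fst z\<rfloor> \<lfloor>snd z\<rfloor> - y) \<le> \<eta>"
  shows "norm (interpolation X A z - y) \<le> 5 * \<eta>"
proof -
  let ?i = "\<lfloor>fst z\<rfloor>" and ?j = "\<lfloor>snd z\<rfloor>"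
  obtain c d where cd: "chamber_index ?i ?j c d" "z \<in> chamber ?i ?j c d" using chamber_covers[of z] by blast
  have n2: "norm (x - x') \<le> 4 * \<eta>" if "norm (x - y) \<le> \<eta>" "norm (x' - y) \<le> \<eta>" for x x'
  proof -
    have "x - x' = (x - y) - (x' - y)" by simp
    then have "norm (x - x') \<le> norm (x - y) + norm (x' - y)" by (simp only: norm_triangle_ineq4)
    then show ?thesis using that norm_ge_zero[of "x - y"] by linarith
  qed
  have n4: "norm (2 *\<^sub>R a - x - x') \<le> 4 * \<eta>" if "norm (a - y) \<le> \<eta>" "norm (x - y) \<le> \<eta>" "norm (x' - y) \<le> \<eta>" for a x x'
  proof -
    have "2 *\<^sub>R a - x - x' = (a - y) + (a - y) - (x - y) - (x' - y)" by (simp add: scaleR_2)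
    then show ?thesis
      using that norm_triangle_ineq4[of "(a - y) + (a - y) - (x - y)" "x' - y"]
        norm_triangle_ineq4[of "(a - y) + (a - y)" "x - y"] norm_triangle_ineq[of "a - y" "a - y"] by (simp only:)
  qed
  have n4': "norm (x + x' - 2 *\<^sub>R a) \<le> 4 * \<eta>" if "norm (a - y) \<le> \<eta>" "norm (x - y) \<le> \<eta>" "norm (x' - y) \<le> \<eta>" for a x x'
  proof -
    have "x + x' - 2 *\<^sub>R a = - (2 *\<^sub>R a - x - x')" by simp
    then show ?thesis using n4[OF that] by (simp only: norm_minus_cancel)
  qed
  have X: "norm (X ?i ?j - y) \<le> \<eta>" "norm (X (?i + 1) ?j - y) \<le> \<eta>" "norm (X ?i (?j + 1) - y) \<le> \<eta>"
    "norm (X (?i + 1) (?j + 1) - y) \<le> \<eta>" using assms(1) by auto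
  have g: "norm (fst (chamber_gradient X A ?i ?j c d)) \<le> 4 * \<eta>" "norm (snd (chamber_gradient X A ?i ?j c d)) \<le> 4 * \<eta>"
    unfolding chamber_gradient_def
    by (cases "c = ?i + ?j"; cases "d = ?i - ?j"; simp only: if_True if_False fst_conv snd_conv simp_thms n2 n4 n4' X assms(2))+
  have u: "\<bar>fst z - of_int ?i - 1/2\<bar> \<le> 1/2" "\<bar>snd z - of_int ?j - 1/2\<bar> \<le> 1/2" by linarith+
  have "norm (interpolation X A z - y) = norm ((A ?i ?j - y) + (fst z - of_int ?i - 1/2) *\<^sub>R fst (chamber_gradient X A ?i ?j c d)
     + (snd z - of_int ?j - 1/2) *\<^sub>R snd (chamber_gradient X A ?i ?j c d))"
    unfolding interpolation_affine[OF cd] by (simp add: algebra_simps)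
  also have "\<dots> \<le> \<eta> + 1/2 * (4 * \<eta>) + 1/2 * (4 * \<eta>)"
    by (intro norm_triangle_mono assms(2); simp only: norm_scaleR; intro mult_mono u g; simp)
  finally show ?thesis by simp
qed

text \<open>Up to sign and order the gradient consists of the difference and the sum of P - A and Q
  - A, for a side with ends P, Q and apex A. Hence \<omega> of it is a multiple of \<omega>(P - A, Q
  - A).\<close>

lemma symplectic_form_chamber_gradient:
  assumes "chamber_index i j c d"
    "symplectic_form (X i j - A i j) (X (i + 1) j - A i j) = 0"
    "symplectic_form (X (i + 1) j - A i j) (X (i + 1) (j + 1) - A i j) = 0"
    "symplectic_form (X (i + 1) (j + 1) - A i j) (X i (j + 1) - A i j) = 0"
    "symplectic_form (X i (j + 1) - A i j) (X i j - A i j) = 0"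
  shows "symplectic_form (fst (chamber_gradient X A i j c d)) (snd (chamber_gradient X A i j c d)) = 0"
proof -
  have *: "symplectic_form (P - Q) (2 *\<^sub>R a - Q - P) = 0" "symplectic_form (P - Q) (P + Q - 2 *\<^sub>R a) = 0"
    "symplectic_form (2 *\<^sub>R a - Q - P) (P - Q) = 0" "symplectic_form (P + Q - 2 *\<^sub>R a) (P - Q) = 0"
    if "symplectic_form (P - a) (Q - a) = 0 \<or> symplectic_form (Q - a) (P - a) = 0"
    for P Q a :: "(real^'a) \<times> (real^'a)"
    using that symplectic_form_skew[of P Q] symplectic_form_skew[of P a] symplectic_form_skew[of Q a]
    by (auto simp: symplectic_simps algebra_simps)
  show ?thesis
    using assms(2-5) *[of "X (i + 1) j" "A i j" "X i j"] *[of "X (i + 1) (j + 1)" "A i j" "X (i + 1) j"]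
      *[of "X (i + 1) (j + 1)" "A i j" "X i (j + 1)"] *[of "X i (j + 1)" "A i j" "X i j"]
    unfolding chamber_gradient_def by (auto simp: add.commute)
qed

section \<open>The triangulation of the plane by chambers\<close>

lemma convex_chamber: "convex (chamber i j c d)"
proof -
  have lin: "linear (\<lambda>z::real \<times> real. fst z)" "linear (\<lambda>z::real \<times> real. snd z)"
    "linear (\<lambda>z::real \<times> real. fst z + snd z)" "linear (\<lambda>z::real \<times> real. fst z - snd z)"
    by (rule linearI; simp add: algebra_simps)+
  have "chamber i j c d = (fst -` {of_int i..of_int i + 1}) \<inter> (snd -` {of_int j..of_int j + 1})
      \<inter> ((\<lambda>z. fst z + snd z) -` {of_int c..of_int c + 1}) \<inter> ((\<lambda>z. fst z - snd z) -` {of_int d..of_int d + 1})"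
    by (auto simp: chamber_def)
  then show ?thesis
    by (simp only:) (intro convex_Int convex_linear_vimage lin convex_real_interval)
qed

text \<open>The witnesses in each case are the barycentric coordinates with respect to the cell
  centre and the two ends of its side. The determinant condition expresses that the triangle is not
  degenerate.\<close>

lemma chamber_convex_hull:
  assumes "chamber_index i j c d"
  obtains P Q R where "chamber i j c d = convex hull {P, Q, R}"
    "(fst Q - fst P) * (snd R - snd P) \<noteq> (snd Q - snd P) * (fst R - fst P)"
proof -
  define C where "C = (real_of_int i + 1/2, real_of_int j + 1/2)"
  define V where "V k l = (real_of_int i + k, real_of_int j + l)" for k l
  have hull: "chamber i j c d = convex hull {C, Q, R}"
    if "C \<in> chamber i j c d" "Q \<in> chamber i j c d" "R \<in> chamber i j c d"
      and w: "\<And>z. z \<in> chamber i j c d \<Longrightarrow> \<exists>\<alpha> \<beta> \<gamma>. 0 \<le> \<alpha> \<and> 0 \<le> \<beta> \<and> 0 \<le> \<gamma> \<and> \<alpha> + \<beta> + \<gamma> = 1 \<and> z = \<alpha> *\<^sub>R C + \<beta> *\<^sub>R Q + \<gamma> *\<^sub>R R"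
    for Q R
  proof
    show "convex hull {C, Q, R} \<subseteq> chamber i j c d"
      by (rule hull_minimal) (use that convex_chamber in auto)
    show "chamber i j c d \<subseteq> convex hull {C, Q, R}"
      unfolding convex_hull_3 using w by blast
  qed
  have cases: "c = i + j \<and> d = i - j \<or> c = i + j + 1 \<and> d = i - j \<or> c = i + j + 1 \<and> d = i - j - 1 \<or> c = i + j \<and> d = i - j - 1"
    using assms by (auto simp: chamber_index_def)
  have wt: "\<exists>\<alpha> \<beta> \<gamma>. 0 \<le> \<alpha> \<and> 0 \<le> \<beta> \<and> 0 \<le> \<gamma> \<and> \<alpha> + \<beta> + \<gamma> = 1 \<and> z = \<alpha> *\<^sub>R C + \<beta> *\<^sub>R Q + \<gamma> *\<^sub>R R"
    if "0 \<le> \<alpha>" "0 \<le> \<beta>" "0 \<le> \<gamma>" "\<alpha> + \<beta> + \<gamma> = 1" "z = \<alpha> *\<^sub>R C + \<beta> *\<^sub>R Q + \<gamma> *\<^sub>R R" for z Q R and \<alpha> \<beta> \<gamma> :: real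
    using that by blast
  from cases show thesis
  proof (elim disjE)
    assume cd: "c = i + j \<and> d = i - j"
    have "chamber i j c d = convex hull {C, V 0 0, V 1 0}"
    proof (rule hull)
      fix z assume "z \<in> chamber i j c d"
      then show "\<exists>\<alpha> \<beta> \<gamma>. 0 \<le> \<alpha> \<and> 0 \<le> \<beta> \<and> 0 \<le> \<gamma> \<and> \<alpha> + \<beta> + \<gamma> = 1 \<and> z = \<alpha> *\<^sub>R C + \<beta> *\<^sub>R V 0 0 + \<gamma> *\<^sub>R V 1 0"
        by (intro wt[of "2 * (snd z - j)" "1 - (fst z - i) - (snd z - j)" "(fst z - i) - (snd z - j)"])
          (use cd in \<open>auto simp: chamber_def C_def V_def prod_eq_iff algebra_simps\<close>)
    qed (use cd in \<open>auto simp: chamber_def C_def V_def\<close>)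
    then show thesis by (rule that) (simp add: C_def V_def)
  next
    assume cd: "c = i + j + 1 \<and> d = i - j"
    have "chamber i j c d = convex hull {C, V 1 0, V 1 1}"
    proof (rule hull)
      fix z assume "z \<in> chamber i j c d"
      then show "\<exists>\<alpha> \<beta> \<gamma>. 0 \<le> \<alpha> \<and> 0 \<le> \<beta> \<and> 0 \<le> \<gamma> \<and> \<alpha> + \<beta> + \<gamma> = 1 \<and> z = \<alpha> *\<^sub>R C + \<beta> *\<^sub>R V 1 0 + \<gamma> *\<^sub>R V 1 1"
        by (intro wt[of "2 * (1 - (fst z - i))" "(fst z - i) - (snd z - j)" "(fst z - i) + (snd z - j) - 1"])
          (use cd in \<open>auto simp: chamber_def C_def V_def prod_eq_iff algebra_simps\<close>)
    qed (use cd in \<open>auto simp: chamber_def C_def V_def\<close>)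
    then show thesis by (rule that) (simp add: C_def V_def)
  next
    assume cd: "c = i + j + 1 \<and> d = i - j - 1"
    have "chamber i j c d = convex hull {C, V 1 1, V 0 1}"
    proof (rule hull)
      fix z assume "z \<in> chamber i j c d"
      then show "\<exists>\<alpha> \<beta> \<gamma>. 0 \<le> \<alpha> \<and> 0 \<le> \<beta> \<and> 0 \<le> \<gamma> \<and> \<alpha> + \<beta> + \<gamma> = 1 \<and> z = \<alpha> *\<^sub>R C + \<beta> *\<^sub>R V 1 1 + \<gamma> *\<^sub>R V 0 1"
        by (intro wt[of "2 * (1 - (snd z - j))" "(fst z - i) + (snd z - j) - 1" "(snd z - j) - (fst z - i)"])
          (use cd in \<open>auto simp: chamber_def C_def V_def prod_eq_iff algebra_simps\<close>)
    qed (use cd in \<open>auto simp: chamber_def C_def V_def\<close>)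
    then show thesis by (rule that) (simp add: C_def V_def)
  next
    assume cd: "c = i + j \<and> d = i - j - 1"
    have "chamber i j c d = convex hull {C, V 0 1, V 0 0}"
    proof (rule hull)
      fix z assume "z \<in> chamber i j c d"
      then show "\<exists>\<alpha> \<beta> \<gamma>. 0 \<le> \<alpha> \<and> 0 \<le> \<beta> \<and> 0 \<le> \<gamma> \<and> \<alpha> + \<beta> + \<gamma> = 1 \<and> z = \<alpha> *\<^sub>R C + \<beta> *\<^sub>R V 0 1 + \<gamma> *\<^sub>R V 0 0"
        by (intro wt[of "2 * (fst z - i)" "(snd z - j) - (fst z - i)" "1 - (fst z - i) - (snd z - j)"])
          (use cd in \<open>auto simp: chamber_def C_def V_def prod_eq_iff algebra_simps\<close>)
    qed (use cd in \<open>auto simp: chamber_def C_def V_def\<close>)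
    then show thesis by (rule that) (simp add: C_def V_def)
  qed
qed

text \<open>Two integer unit slabs of the same function coincide, share one bounding hyperplane, or
  are disjoint. In the second case the hyperplane supports S.\<close>

lemma face_of_unit_slab:
  fixes S :: "'a::euclidean_space set" and f :: "'a \<Rightarrow> real" and n m :: int
  assumes S: "convex S" and f: "linear f" and n: "\<And>x. x \<in> S \<Longrightarrow> f x \<in> {of_int n..of_int n + 1}"
  shows "(S \<inter> f -` {of_int m..of_int m + 1 :: real}) face_of S"
proof -
  have fa: "adjoint f 1 \<bullet> x = f x" for x using adjoint_works[OF f, of x 1] by (simp add: inner_commute)
  consider "m = n" | "m = n + 1" | "m = n - 1" | "m \<ge> n + 2 \<or> m \<le> n - 2" by linarith
  then show ?thesis
  proof cases
    case 1
    then have "S \<inter> f -` {of_int m..of_int m + 1} = S" using n by auto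
    then show ?thesis using face_of_refl[OF S] by simp
  next
    case 2
    then have "S \<inter> f -` {of_int m..of_int m + 1} = S \<inter> {x. adjoint f 1 \<bullet> x = of_int n + 1}"
      using n by (force simp: fa)
    then show ?thesis using face_of_Int_supporting_hyperplane_le[where a = "adjoint f 1" and b = "of_int n + 1", OF S] n by (simp add: fa)
  next
    case 3
    then have "S \<inter> f -` {of_int m..of_int m + 1} = S \<inter> {x. adjoint f 1 \<bullet> x = of_int n}"
      using n by (force simp: fa)
    then show ?thesis using face_of_Int_supporting_hyperplane_ge[where a = "adjoint f 1" and b = "of_int n", OF S] n by (simp add: fa)
  next
    case 4
    then have "real_of_int m \<ge> of_int n + 2 \<or> real_of_int m \<le> of_int n - 2"
      by linarith
    then have "S \<inter> f -` {of_int m..of_int m + 1} = {}" using n by fastforce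
    then show ?thesis by simp
  qed
qed

text \<open>Linear coordinates of the plane in which the grid is the standard one. They transport
  the chambers to triangles adapted to an arbitrary lattice.\<close>

locale plane_coordinates =
  fixes \<phi> :: "real^2 \<Rightarrow> real \<times> real" and \<psi> :: "real \<times> real \<Rightarrow> real^2"
  assumes lin: "linear \<phi>" "linear \<psi>" and inverse: "\<And>z. \<phi> (\<psi> z) = z" "\<And>x. \<psi> (\<phi> x) = x"
begin

definition cell :: "int \<Rightarrow> int \<Rightarrow> int \<Rightarrow> int \<Rightarrow> (real^2) set" where
  "cell i j c d = \<phi> -` chamber i j c d"

text \<open>Taking all faces of the cells closes the family under faces at once and includes the
  empty simplex.\<close>

definition grid_triangulation :: "(real^2) set set" where
  "grid_triangulation = {S. \<exists>i j c d. chamber_index i j c d \<and> S face_of cell i j c d}"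

lemma convex_cell: "convex (cell i j c d)"
  unfolding cell_def by (rule convex_linear_vimage[OF lin(1) convex_chamber])

lemma linear_coordinates:
  "linear (\<lambda>x. fst (\<phi> x))" "linear (\<lambda>x. snd (\<phi> x))" "linear (\<lambda>x. fst (\<phi> x) + snd (\<phi> x))"
  "linear (\<lambda>x. fst (\<phi> x) - snd (\<phi> x))"
  by (rule linearI; simp add: linear_add[OF lin(1)] linear_scale[OF lin(1)] algebra_simps)+

lemma cell_simplex:
  assumes "chamber_index i j c d"
  obtains C where "\<not> affine_dependent C" "card C = 3" "finite C" "cell i j c d = convex hull C"
proof -
  obtain P Q R where PQR: "chamber i j c d = convex hull {P, Q, R}"
    and det: "(fst Q - fst P) * (snd R - snd P) \<noteq> (snd Q - snd P) * (fst R - fst P)"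
    using chamber_convex_hull[OF assms] .
  have inj: "\<psi> x = \<psi> y \<longleftrightarrow> x = y" for x y by (metis inverse(1))
  have "cell i j c d = \<psi> ` chamber i j c d"
  proof
    show "cell i j c d \<subseteq> \<psi> ` chamber i j c d"
    proof
      fix x assume "x \<in> cell i j c d"
      then show "x \<in> \<psi> ` chamber i j c d" by (intro image_eqI[of _ _ "\<phi> x"]) (auto simp: cell_def inverse)
    qed
  qed (auto simp: cell_def inverse)
  then have hull: "cell i j c d = convex hull {\<psi> P, \<psi> Q, \<psi> R}"
    by (simp add: PQR convex_hull_linear_image[OF lin(2)])
  have ne: "P \<noteq> Q" "P \<noteq> R" "Q \<noteq> R" using det by auto
  have "\<not> collinear {\<psi> P, \<psi> Q, \<psi> R}"
  proof
    assume "collinear {\<psi> P, \<psi> Q, \<psi> R}"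
    then obtain u s t where "\<psi> Q - \<psi> P = s *\<^sub>R u" "\<psi> R - \<psi> P = t *\<^sub>R u"
      unfolding collinear_def by blast
    then have "\<phi> (\<psi> Q - \<psi> P) = s *\<^sub>R \<phi> u" "\<phi> (\<psi> R - \<psi> P) = t *\<^sub>R \<phi> u"
      by (simp_all add: linear_scale[OF lin(1)])
    then have "Q - P = s *\<^sub>R \<phi> u" "R - P = t *\<^sub>R \<phi> u"
      by (simp_all add: linear_diff[OF lin(1)] inverse)
    then have "fst Q - fst P = s * fst (\<phi> u)" "snd Q - snd P = s * snd (\<phi> u)"
      "fst R - fst P = t * fst (\<phi> u)" "snd R - snd P = t * snd (\<phi> u)"
      by (simp_all add: prod_eq_iff)
    then show False using det by simp
  qed
  then have "\<not> affine_dependent {\<psi> P, \<psi> Q, \<psi> R}" using collinear_3_eq_affine_dependent by blast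
  moreover have "card {\<psi> P, \<psi> Q, \<psi> R} = 3" using ne by (simp add: inj)
  ultimately show thesis by (intro that[OF _ _ _ hull]) simp_all
qed

text \<open>A cell is an intersection of four integer slabs, so this reduces to
  \<open>face_of_unit_slab\<close> for each family of lines. No case distinction on the relative
  position of the cells is necessary.\<close>

lemma cell_Int_face:
  assumes "chamber_index i j c d"
  shows "(cell i j c d \<inter> cell i' j' c' d') face_of cell i j c d"
proof -
  let ?S = "cell i j c d"
  have eq: "?S \<inter> cell i' j' c' d' = (?S \<inter> (\<lambda>x. fst (\<phi> x)) -` {of_int i'..of_int i' + 1})
     \<inter> (?S \<inter> (\<lambda>x. snd (\<phi> x)) -` {of_int j'..of_int j' + 1})
     \<inter> (?S \<inter> (\<lambda>x. fst (\<phi> x) + snd (\<phi> x)) -` {of_int c'..of_int c' + 1})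
     \<inter> (?S \<inter> (\<lambda>x. fst (\<phi> x) - snd (\<phi> x)) -` {of_int d'..of_int d' + 1})"
    unfolding cell_def chamber_def by blast
  show ?thesis
    unfolding eq
    by (intro face_of_Int face_of_unit_slab[OF convex_cell] linear_coordinates; auto simp: cell_def chamber_def)
qed

text \<open>Lower-dimensional faces reduce to cells: S' cuts a face out of the intersection of the
  cells, which is itself a face of the cell of S.\<close>

lemma grid_face_Int:
  assumes S: "S face_of cell i j c d" and S': "S' face_of cell i' j' c' d'"
    and ix: "chamber_index i j c d" "chamber_index i' j' c' d'"
  shows "(S \<inter> S') face_of S"
proof -
  let ?T = "cell i j c d" and ?T' = "cell i' j' c' d'"
  have TT: "(?T \<inter> ?T') face_of ?T" "(?T' \<inter> ?T) face_of ?T'" using cell_Int_face ix by blast+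
  have sub: "S \<subseteq> ?T" "S' \<subseteq> ?T'" using S S' face_of_imp_subset by blast+
  have "(S' \<inter> (?T' \<inter> ?T)) face_of (?T' \<inter> ?T)"
    by (rule face_of_subset[OF face_of_Int[OF S' TT(2)]]) auto
  then have "(S' \<inter> (?T' \<inter> ?T)) face_of ?T" using TT(1) by (metis Int_commute face_of_trans)
  then have "(S \<inter> (S' \<inter> (?T' \<inter> ?T))) face_of ?T" by (rule face_of_Int[OF S])
  moreover have "S \<inter> (S' \<inter> (?T' \<inter> ?T)) = S \<inter> S'" using sub by blast
  ultimately show ?thesis using sub face_of_subset[of "S \<inter> S'" ?T S] by auto
qed

lemma continuous_coordinates: "continuous_on S \<phi>"
  using lin(1) by (rule linear_continuous_on[OF linear_conv_bounded_linear[THEN iffD1]])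

lemma plane_triangulation_grid: "plane_triangulation grid_triangulation"
  unfolding plane_triangulation_def
proof (intro conjI ballI allI impI)
  fix S assume "S \<in> grid_triangulation"
  then obtain i j c d where ix: "chamber_index i j c d" and S: "S face_of cell i j c d"
    unfolding grid_triangulation_def by blast
  obtain C where C: "\<not> affine_dependent C" "card C = 3" "finite C" "cell i j c d = convex hull C"
    using cell_simplex[OF ix] .
  then obtain D where D: "D \<subseteq> C" "S = convex hull D"
    using S face_of_convex_hull_affine_independent by metis
  then have "(int (card D) - 1) simplex S"
    unfolding simplex_def using affine_independent_subset[OF C(1) D(1)] by auto
  then show "\<exists>k. k simplex S" ..
next
  fix S T assume "T \<in> grid_triangulation \<and> S face_of T"
  then show "S \<in> grid_triangulation" unfolding grid_triangulation_def using face_of_trans by blast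
next
  fix S T assume "S \<in> grid_triangulation" "T \<in> grid_triangulation"
  then show "(S \<inter> T) face_of S" unfolding grid_triangulation_def using grid_face_Int by blast
next
  fix x
  let ?i = "\<lfloor>fst (\<phi> x)\<rfloor>" and ?j = "\<lfloor>snd (\<phi> x)\<rfloor>"
  let ?U = "\<phi> -` window ?i ?j"
  \<comment> \<open>Generous bounds for the indices of the cells that meet the window; the ranges of
    c and d follow from those of i and j by \<open>chamber_index\<close>.\<close>
  let ?I = "{?i - 2..?i + 2} \<times> {?j - 2..?j + 2} \<times> {?i + ?j - 4..?i + ?j + 5} \<times> {?i - ?j - 5..?i - ?j + 4}"
  have "{T \<in> grid_triangulation. T \<inter> ?U \<noteq> {}} \<subseteq> (\<Union>(i, j, c, d)\<in>{I \<in> ?I. case I of (i, j, c, d) \<Rightarrow> chamber_index i j c d}. {S. S face_of cell i j c d})"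
  proof
    fix T assume "T \<in> {T \<in> grid_triangulation. T \<inter> ?U \<noteq> {}}"
    then obtain i j c d y where ix: "chamber_index i j c d" and T: "T face_of cell i j c d" and y: "y \<in> T" "\<phi> y \<in> window ?i ?j"
      unfolding grid_triangulation_def by blast
    have "\<phi> y \<in> chamber i j c d" using y(1) face_of_imp_subset[OF T] by (auto simp: cell_def)
    then have "i \<in> {?i - 2..?i + 2}" "j \<in> {?j - 2..?j + 2}"
      using y(2) unfolding chamber_def window_def mem_Times_iff mem_Collect_eq atLeastAtMost_iff greaterThanLessThan_iff
      by linarith+
    moreover from this have "c \<in> {?i + ?j - 4..?i + ?j + 5}" "d \<in> {?i - ?j - 5..?i - ?j + 4}"
      using ix unfolding chamber_index_def by auto
    ultimately show "T \<in> (\<Union>(i, j, c, d)\<in>{I \<in> ?I. case I of (i, j, c, d) \<Rightarrow> chamber_index i j c d}. {S. S face_of cell i j c d})"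
      using ix T by blast
  qed
  moreover have "finite {S. S face_of cell i j c d}" if ix: "chamber_index i j c d" for i j c d
  proof -
    obtain C where "\<not> affine_dependent C" "card C = 3" "finite C" "cell i j c d = convex hull C"
      using cell_simplex[OF ix] .
    then show ?thesis by (intro finite_polytope_faces) (auto simp: polytope_def)
  qed
  then have "finite (\<Union>(i, j, c, d)\<in>{I \<in> ?I. case I of (i, j, c, d) \<Rightarrow> chamber_index i j c d}. {S. S face_of cell i j c d})"
    by (intro finite_UN_I) auto
  ultimately have "finite {T \<in> grid_triangulation. T \<inter> ?U \<noteq> {}}" by (rule finite_subset)
  moreover have "open ?U" using open_window continuous_coordinates by (simp add: open_vimage)
  moreover have "x \<in> ?U" using in_window by simp
  ultimately show "\<exists>U. open U \<and> x \<in> U \<and> finite {T \<in> grid_triangulation. T \<inter> U \<noteq> {}}" by blast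
next
  have "x \<in> \<Union>grid_triangulation" for x
  proof -
    obtain i j c d where "chamber_index i j c d" "\<phi> x \<in> chamber i j c d" using chamber_covers by blast
    then show ?thesis unfolding grid_triangulation_def cell_def
      using face_of_refl[OF convex_cell[unfolded cell_def]] by blast
  qed
  then show "\<Union>grid_triangulation = UNIV" by blast
qed

lemma grid_triangulation_translation:
  assumes "\<phi> \<gamma> = (of_int k, of_int l)" "S \<in> grid_triangulation"
  shows "(\<lambda>x. \<gamma> + x) ` S \<in> grid_triangulation"
proof -
  obtain i j c d where ix: "chamber_index i j c d" and S: "S face_of cell i j c d"
    using assms(2) unfolding grid_triangulation_def by blast
  have "(+) \<gamma> ` cell i j c d = cell (i + k) (j + l) (c + k + l) (d + k - l)"
  proof
    show "(+) \<gamma> ` cell i j c d \<subseteq> cell (i + k) (j + l) (c + k + l) (d + k - l)"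
      by (auto simp: cell_def chamber_def linear_add[OF lin(1)] assms(1))
    show "cell (i + k) (j + l) (c + k + l) (d + k - l) \<subseteq> (+) \<gamma> ` cell i j c d"
    proof
      fix x assume "x \<in> cell (i + k) (j + l) (c + k + l) (d + k - l)"
      then have "x - \<gamma> \<in> cell i j c d"
        by (auto simp: cell_def chamber_def linear_diff[OF lin(1)] assms(1))
      then show "x \<in> (+) \<gamma> ` cell i j c d" by (rule rev_image_eqI) simp
    qed
  qed
  moreover have "((+) \<gamma> ` S) face_of ((+) \<gamma> ` cell i j c d)" using S by simp
  moreover have "chamber_index (i + k) (j + l) (c + k + l) (d + k - l)"
    using ix by (auto simp: chamber_index_def)
  ultimately show ?thesis unfolding grid_triangulation_def by auto
qed

lemma cell_affine:
  assumes "chamber_index i j c d" "x \<in> cell i j c d"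
  shows "interpolation X A (\<phi> x) = (A i j - (of_int i + 1/2) *\<^sub>R fst (chamber_gradient X A i j c d)
      - (of_int j + 1/2) *\<^sub>R snd (chamber_gradient X A i j c d))
    + (fst (\<phi> x) *\<^sub>R fst (chamber_gradient X A i j c d) + snd (\<phi> x) *\<^sub>R snd (chamber_gradient X A i j c d))"
  using interpolation_affine[OF assms(1), of "\<phi> x" X A] assms(2)
  by (simp add: cell_def algebra_simps)

lemma subordinate_grid: "subordinate grid_triangulation (interpolation X A \<circ> \<phi>)"
  unfolding subordinate_def
proof (intro conjI ballI plane_triangulation_grid)
  fix T assume "T \<in> triangles grid_triangulation"
  then obtain i j c d where ix: "chamber_index i j c d" and T: "T \<subseteq> cell i j c d"
    unfolding triangles_def grid_triangulation_def using face_of_imp_subset by blast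
  let ?a = "fst (chamber_gradient X A i j c d)" and ?b = "snd (chamber_gradient X A i j c d)"
  let ?L = "\<lambda>x. fst (\<phi> x) *\<^sub>R ?a + snd (\<phi> x) *\<^sub>R ?b"
  have "linear ?L"
    by (rule linearI) (simp_all add: linear_add[OF lin(1)] linear_scale[OF lin(1)] algebra_simps)
  moreover have "(interpolation X A \<circ> \<phi>) x
      = ?L x + (A i j - (of_int i + 1/2) *\<^sub>R ?a - (of_int j + 1/2) *\<^sub>R ?b)" if "x \<in> T" for x
    using cell_affine[OF ix subsetD[OF T that], of X A] by (simp only: o_apply add.commute)
  ultimately show "affine_map_on T (interpolation X A \<circ> \<phi>)"
    unfolding affine_map_on_def by blast
qed

lemma interpolation_isotropic:
  assumes iso: "\<And>i j. symplectic_form (X i j - A i j) (X (i + 1) j - A i j) = 0"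
    "\<And>i j. symplectic_form (X (i + 1) j - A i j) (X (i + 1) (j + 1) - A i j) = 0"
    "\<And>i j. symplectic_form (X (i + 1) (j + 1) - A i j) (X i (j + 1) - A i j) = 0"
    "\<And>i j. symplectic_form (X i (j + 1) - A i j) (X i j - A i j) = 0"
    and T: "T \<in> triangles grid_triangulation" "x \<in> interior T"
  shows "pullback symplectic_form (interpolation X A \<circ> \<phi>) x u v = 0"
proof -
  obtain i j c d where ix: "chamber_index i j c d" and T': "T \<subseteq> cell i j c d"
    using T(1) unfolding triangles_def grid_triangulation_def using face_of_imp_subset by blast
  define a where "a = fst (chamber_gradient X A i j c d)"
  define b where "b = snd (chamber_gradient X A i j c d)"
  have ab: "symplectic_form a b = 0"
    unfolding a_def b_def by (rule symplectic_form_chamber_gradient[where X = X and A = A, OF ix iso])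
  define D where "D x = fst (\<phi> x) *\<^sub>R a + snd (\<phi> x) *\<^sub>R b" for x
  define r where "r = A i j - (of_int i + 1/2) *\<^sub>R a - (of_int j + 1/2) *\<^sub>R b"
  have "linear D" unfolding D_def
    by (rule linearI) (simp_all add: linear_add[OF lin(1)] linear_scale[OF lin(1)] algebra_simps)
  then have "(D has_derivative D) (at x)" by (rule linear_imp_has_derivative)
  from has_derivative_add[OF has_derivative_const this]
  have "((\<lambda>x. r + D x) has_derivative D) (at x)" by simp
  moreover have "r + D y = (interpolation X A \<circ> \<phi>) y" if "y \<in> interior T" for y
  proof -
    have "y \<in> cell i j c d" using that T' interior_subset by blast
    from cell_affine[OF ix this, of X A] show ?thesis by (simp add: r_def D_def a_def b_def)
  qed
  ultimately have "((interpolation X A \<circ> \<phi>) has_derivative D) (at x)"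
    by (rule has_derivative_transform_within_open[OF _ open_interior T(2)])
  then have "frechet_derivative (interpolation X A \<circ> \<phi>) (at x) = D"
    by (rule frechet_derivative_at[symmetric])
  then show ?thesis
    using ab symplectic_form_skew[of b a] by (simp add: pullback_def D_def symplectic_simps)
qed

end

section \<open>Uniformized tori\<close>

text \<open>The sheets over the image of an evenly covered set W are the sheets over W.\<close>

lemma covering_space_homeomorphism:
  assumes cov: "covering_space C p S" and hom: "homeomorphism S T f g"
  shows "covering_space C (f \<circ> p) T"
  unfolding covering_space_def
proof (intro conjI ballI)
  have pC: "continuous_on C p" "p ` C = S" using cov by (auto simp: covering_space_def)
  have f: "continuous_on S f" "f ` S = T" "continuous_on T g" "g ` T = S"
    "\<And>x. x \<in> S \<Longrightarrow> g (f x) = x" "\<And>y. y \<in> T \<Longrightarrow> f (g y) = y"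
    using hom by (auto simp: homeomorphism_def)
  show "continuous_on C (f \<circ> p)" using pC f(1) by (intro continuous_on_compose) auto
  show "(f \<circ> p) ` C = T" unfolding image_comp[symmetric] pC(2) f(2) ..
  fix y assume y: "y \<in> T"
  then have "g y \<in> S" using f(4) by auto
  then obtain W v where W: "g y \<in> W" "openin (top_of_set S) W" "\<Union>v = C \<inter> p -` W"
    "\<forall>u\<in>v. openin (top_of_set C) u" "pairwise disjnt v" "\<forall>u\<in>v. \<exists>q. homeomorphism u W p q"
    using cov unfolding covering_space_def by metis
  have WS: "W \<subseteq> S" using openin_imp_subset[OF W(2)] .
  have "openin (top_of_set T) (f ` W)"
    by (rule homeomorphism_imp_open_map[OF hom W(2)])
  moreover have "y \<in> f ` W" using W(1) f(6)[OF y] by (metis imageI)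
  moreover have "C \<inter> (f \<circ> p) -` (f ` W) = C \<inter> p -` W"
  proof -
    have "p x \<in> W" if x: "x \<in> C" "f (p x) \<in> f ` W" for x
    proof -
      obtain w where "w \<in> W" "f (p x) = f w" using x(2) by auto
      moreover have "p x \<in> S" using x(1) pC(2) by auto
      ultimately show ?thesis using f(5) WS by (metis subsetD)
    qed
    then show ?thesis by auto
  qed
  moreover have "\<exists>q. homeomorphism u (f ` W) (f \<circ> p) q" if "u \<in> v" for u
  proof -
    obtain q where "homeomorphism u W p q" using W(6) \<open>u \<in> v\<close> by blast
    moreover have "homeomorphism W (f ` W) f g"
      by (rule homeomorphism_of_subsets[OF hom WS]) (use f WS in auto)
    ultimately show ?thesis using homeomorphism_compose by blast
  qed
  ultimately show "\<exists>W. y \<in> W \<and> openin (top_of_set T) W \<and>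
      (\<exists>v. \<Union>v = C \<inter> (f \<circ> p) -` W \<and> (\<forall>u\<in>v. openin (top_of_set C) u) \<and> pairwise disjnt v \<and>
         (\<forall>u\<in>v. \<exists>q. homeomorphism u W (f \<circ> p) q))"
    using W(3-5) by (intro exI[of _ "f ` W"] conjI exI[of _ v]) auto
qed

text \<open>The lifting theorems of the library need a covering of a subset of a normed space, which is why the
  covering of the surface is transported to the standard torus.\<close>

lemma deck_transformation_exists:
  fixes p :: "real^2 \<Rightarrow> 's::topological_space" and T :: "'b::real_normed_vector set"
  assumes cov: "covering_space UNIV p S" and hom: "homeomorphism S T f g" and eq: "p z = p w"
  shows "\<exists>h\<in>deck_transformations p. h z = w"
proof -
  let ?q = "f \<circ> p"
  have cq: "covering_space UNIV ?q T" by (rule covering_space_homeomorphism[OF cov hom])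
  have qc: "continuous_on UNIV ?q" and qT: "?q \<in> UNIV \<rightarrow> T"
    using cq by (auto simp: covering_space_def)
  \<comment> \<open>The plane is simply connected, so the covering lifts through itself with any
    prescribed value in the fibre. Lifting from z to w and back gives mutually inverse maps, by
    uniqueness of lifts.\<close>
  have lift: "\<exists>k. continuous_on UNIV k \<and> k x = y \<and> (\<forall>t. ?q (k t) = ?q t)" if "p x = p y" for x y
  proof -
    have xy: "?q x = ?q y" using that by simp
    have sc: "simply_connected (UNIV :: (real^2) set)" by (rule convex_imp_simply_connected) simp
    obtain k where "continuous_on UNIV k" "k \<in> UNIV \<rightarrow> UNIV" "k x = y" "\<And>t. t \<in> UNIV \<Longrightarrow> ?q (k t) = ?q t"
      by (rule covering_space_lift_strong[OF cq UNIV_I UNIV_I sc locally_path_connected_UNIV qc qT xy]) blast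
    then show ?thesis by blast
  qed
  obtain h where h: "continuous_on UNIV h" "h z = w" "\<And>t. ?q (h t) = ?q t" using lift[OF eq] by blast
  obtain k where k: "continuous_on UNIV k" "k w = z" "\<And>t. ?q (k t) = ?q t" using lift[OF eq[symmetric]] by blast
  have hk: "continuous_on UNIV (h \<circ> k)" "continuous_on UNIV (k \<circ> h)"
    using h(1) k(1) continuous_on_subset by (blast intro: continuous_on_compose)+
  have "(h \<circ> k) x = id x" for x
    by (rule covering_space_lift_unique[OF cq, of "h \<circ> k" w id UNIV ?q]) (use h k hk qc qT in auto)
  moreover have "(k \<circ> h) x = id x" for x
    by (rule covering_space_lift_unique[OF cq, of "k \<circ> h" z id UNIV ?q]) (use h k hk qc qT in auto)
  ultimately have "homeomorphism UNIV UNIV h k"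
    using h(1) k(1) unfolding homeomorphism_def by (auto simp: surj_def) metis+
  moreover have "p \<circ> h = p"
  proof
    fix t
    have "p t \<in> S" "p (h t) \<in> S" using cov by (auto simp: covering_space_def)
    then show "(p \<circ> h) t = p t"
      using h(3)[of t] hom by (metis homeomorphism_apply1 o_apply)
  qed
  ultimately have "h \<in> deck_transformations p" unfolding deck_transformations_def by blast
  then show ?thesis using h(2) by blast
qed

text \<open>Needed to push an open set of injectivity from the plane down to the surface.\<close>

lemma covering_image_open:
  fixes p :: "real^2 \<Rightarrow> 's::topological_space" and T :: "'b::real_normed_vector set"
  assumes cov: "covering_space UNIV p S" and hom: "homeomorphism S T f g" and U: "open U"
  shows "openin (top_of_set S) (p ` U)"
proof -
  have "openin (top_of_set T) ((f \<circ> p) ` U)"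
    by (rule covering_space_open_map[OF covering_space_homeomorphism[OF cov hom]]) (use U in simp)
  then have "openin (top_of_set S) (g ` ((f \<circ> p) ` U))"
    using homeomorphism_imp_open_map[OF homeomorphism_symD[OF hom]] by blast
  moreover have "g ` ((f \<circ> p) ` U) = p ` U"
  proof -
    have "g (f (p x)) = p x" for x
      using cov hom homeomorphism_apply1 by (fastforce simp: covering_space_def)
    then show ?thesis by (simp add: image_comp)
  qed
  ultimately show ?thesis by simp
qed

lemma diffeomorphic_imp_homeomorphism:
  assumes "diffeomorphic S A T B"
  obtains f g where "homeomorphism S T f g"
proof -
  obtain f g where fg: "smooth_map S A T B f" "smooth_map T B S A g" "\<forall>x\<in>S. g (f x) = x" "\<forall>y\<in>T. f (g y) = y"
    using assms unfolding diffeomorphic_def by blast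
  then have "homeomorphism S T f g"
    unfolding smooth_map_def by (intro homeomorphismI) auto
  then show thesis by (rule that)
qed

lemma smooth_on_derivative:
  assumes "smooth_on X f"
  shows "\<And>x. x \<in> X \<Longrightarrow> (f has_derivative frechet_derivative f (at x)) (at x)"
    and "\<And>v. continuous_on X (\<lambda>x. frechet_derivative f (at x) v)"
proof -
  have "higher_differentiable_on X f (Suc 0)" using assms by (simp only: smooth_on_def)
  then show "\<And>x. x \<in> X \<Longrightarrow> (f has_derivative frechet_derivative f (at x)) (at x)"
    "\<And>v. continuous_on X (\<lambda>x. frechet_derivative f (at x) v)"
    by (simp_all add: frechet_derivative_works)
qed

text \<open>Near each point the map factors as Q after P, the expressions of l and p in one chart;
  the chain rule carries over derivative, continuity and isotropy.\<close>

lemma smooth_isotropic_pullback: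
  fixes l :: "'s::topological_space \<Rightarrow> (real^'n) \<times> (real^'n)" and p :: "real^2 \<Rightarrow> 's"
  assumes S: "smooth_surface S A" and l: "smooth_function A l" "isotropic A l"
    and p: "smooth_map UNIV plane_atlas S A p"
  shows "\<And>x. ((l \<circ> p) has_derivative frechet_derivative (l \<circ> p) (at x)) (at x)"
    and "\<And>v. continuous_on UNIV (\<lambda>x. frechet_derivative (l \<circ> p) (at x) v)"
    and "\<And>x u v. pullback symplectic_form (l \<circ> p) x u v = 0"
proof -
  have local: "\<exists>V. open V \<and> z \<in> V \<and> (\<forall>x\<in>V. ((l \<circ> p) has_derivative frechet_derivative (l \<circ> p) (at x)) (at x)) \<and>
      (\<forall>v. continuous_on V (\<lambda>x. frechet_derivative (l \<circ> p) (at x) v)) \<and>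
      (\<forall>x\<in>V. \<forall>u v. pullback symplectic_form (l \<circ> p) x u v = 0)" for z
  proof -
    have pS: "continuous_on UNIV p" "p z \<in> S" using p by (auto simp: smooth_map_def)
    then obtain U \<phi> where U: "(U, \<phi>) \<in> A" "p z \<in> U" using S unfolding smooth_surface_def by blast
    have Uo: "openin (top_of_set S) U" "open (\<phi> ` U)" and inj: "inj_on \<phi> U"
      using S U(1) unfolding smooth_surface_def
      by (fastforce simp: homeomorphism_def intro: inj_on_inverseI)+
    define V where "V = p -` U"
    define P where "P = \<phi> \<circ> p"
    define Q where "Q = l \<circ> inv_into U \<phi>"
    have "openin (top_of_set UNIV) (UNIV \<inter> p -` U)"
      by (rule continuous_openin_preimage[OF pS(1) _ Uo(1)]) (use p in \<open>auto simp: smooth_map_def\<close>)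
    then have V: "open V" "z \<in> V" using U(2) by (simp_all add: V_def)
    have "smooth_on (id ` (UNIV \<inter> p -` U)) (\<phi> \<circ> p \<circ> inv_into UNIV id)"
      using p U(1) unfolding smooth_map_def plane_atlas_def by blast
    then have sP: "smooth_on V P" by (simp add: V_def P_def)
    have sQ: "smooth_on (\<phi> ` U) Q" using l(1) U(1) unfolding smooth_function_def Q_def by blast
    have PV: "P x \<in> \<phi> ` U" if "x \<in> V" for x using that by (simp add: P_def V_def)
    have lp: "(Q \<circ> P) x = (l \<circ> p) x" if "x \<in> V" for x
      using that inj by (simp add: Q_def P_def V_def)
    have der: "((l \<circ> p) has_derivative (frechet_derivative Q (at (P x)) \<circ> frechet_derivative P (at x))) (at x)"
      if x: "x \<in> V" for x
    proof -
      have "((Q \<circ> P) has_derivative (frechet_derivative Q (at (P x)) \<circ> frechet_derivative P (at x))) (at x)"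
        by (rule diff_chain_at[OF smooth_on_derivative(1)[OF sP x] smooth_on_derivative(1)[OF sQ PV[OF x]]])
      then show ?thesis by (rule has_derivative_transform_within_open[OF _ V(1) x lp])
    qed
    have fd: "frechet_derivative (l \<circ> p) (at x) = frechet_derivative Q (at (P x)) \<circ> frechet_derivative P (at x)"
      if "x \<in> V" for x
      by (rule frechet_derivative_at[symmetric, OF der[OF that]])
    \<comment> \<open>Smoothness of Q gives continuity of its derivative in a fixed direction, but
      here the direction varies with the point; hence the expansion in the standard basis.\<close>
    have expand: "frechet_derivative Q (at y) w = (\<Sum>i\<in>UNIV. w$i *\<^sub>R frechet_derivative Q (at y) (axis i 1))"
      if "y \<in> \<phi> ` U" for y w
    proof -
      have L: "linear (frechet_derivative Q (at y))"
        using smooth_on_derivative(1)[OF sQ that] has_derivative_linear by blast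
      have "(\<Sum>i\<in>UNIV. w$i *\<^sub>R axis i 1) = w"
        using basis_expansion[of w] by (simp only: scalar_mult_eq_scaleR)
      then have "frechet_derivative Q (at y) w = frechet_derivative Q (at y) (\<Sum>i\<in>UNIV. w$i *\<^sub>R axis i 1)"
        by simp
      then show ?thesis by (simp add: linear_sum[OF L] linear_scale[OF L])
    qed
    have contP: "continuous_on V P"
      by (meson V(1) continuous_at_imp_continuous_on has_derivative_continuous smooth_on_derivative(1)[OF sP])
    have "continuous_on V (\<lambda>x. frechet_derivative (l \<circ> p) (at x) v)" for v
    proof -
      have "continuous_on V (\<lambda>x. \<Sum>i\<in>UNIV. (frechet_derivative P (at x) v)$i *\<^sub>R frechet_derivative Q (at (P x)) (axis i 1))"
        by (intro continuous_on_sum continuous_on_scaleR continuous_on_component smooth_on_derivative(2)[OF sP]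
            continuous_on_compose2[OF smooth_on_derivative(2)[OF sQ] contP]) (use PV in auto)
      then show ?thesis
        by (rule continuous_on_eq) (simp add: fd expand[OF PV])
    qed
    moreover have "pullback symplectic_form (l \<circ> p) x u v = 0" if "x \<in> V" for x u v
    proof -
      have "pullback symplectic_form Q (P x) u' v' = 0" for u' v'
        using l(2) U(1) PV[OF that] unfolding isotropic_def Q_def by blast
      then show ?thesis by (simp add: pullback_def fd[OF that])
    qed
    moreover have "((l \<circ> p) has_derivative frechet_derivative (l \<circ> p) (at x)) (at x)" if "x \<in> V" for x
      using der[OF that] fd[OF that] by simp
    ultimately show ?thesis using V by (intro exI[of _ V]) simp
  qed
  show "((l \<circ> p) has_derivative frechet_derivative (l \<circ> p) (at x)) (at x)" for x
    using local[of x] by blast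
  show "pullback symplectic_form (l \<circ> p) x u v = 0" for x u v
    using local[of x] by blast
  show "continuous_on UNIV (\<lambda>x. frechet_derivative (l \<circ> p) (at x) v)" for v
  proof (rule continuous_at_imp_continuous_on, rule ballI)
    fix z :: "real^2"
    obtain V where "open V" "z \<in> V" "continuous_on V (\<lambda>x. frechet_derivative (l \<circ> p) (at x) v)"
      using local[of z] by blast
    then show "isCont (\<lambda>x. frechet_derivative (l \<circ> p) (at x) v) z"
      by (simp add: continuous_on_eq_continuous_at)
  qed
qed

text \<open>Cramer's rule with the determinant D of a and b. Inner products with the dual basis are
  the lattice coordinates.\<close>

lemma dual_basis:
  fixes a b :: "real^2"
  assumes "independent {a, b}" "a \<noteq> b"
  obtains a' b' where "a \<bullet> a' = 1" "a \<bullet> b' = 0" "b \<bullet> a' = 0" "b \<bullet> b' = 1"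
    "\<And>z. z = (z \<bullet> a') *\<^sub>R a + (z \<bullet> b') *\<^sub>R b"
proof -
  define D where "D = a$1 * b$2 - a$2 * b$1"
  have "b \<notin> span {a}" "a \<noteq> 0"
    using assms independent_insert[of b "{a}"] dependent_zero[of "{a, b}"] by (auto simp: insert_commute)
  have D: "D \<noteq> 0"
  proof
    assume "D = 0"
    then have *: "a$1 * b$2 = a$2 * b$1" by (simp add: D_def)
    have "\<exists>k. b = k *\<^sub>R a"
    proof (cases "a$1 = 0")
      case True
      then have "a$2 \<noteq> 0" using \<open>a \<noteq> 0\<close> by (auto simp: vec_eq_iff forall_2)
      then show ?thesis using * True by (intro exI[of _ "b$2 / a$2"]) (auto simp: vec_eq_iff forall_2)
    next
      case False
      then show ?thesis using * by (intro exI[of _ "b$1 / a$1"]) (auto simp: vec_eq_iff forall_2 field_simps)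
    qed
    then show False using \<open>b \<notin> span {a}\<close> by (auto simp: span_singleton)
  qed
  define a' where "a' = (vector [b$2 / D, - b$1 / D] :: real^2)"
  define b' where "b' = (vector [- a$2 / D, a$1 / D] :: real^2)"
  have inner: "z \<bullet> a' = (z$1 * b$2 - z$2 * b$1) / D" "z \<bullet> b' = (z$2 * a$1 - z$1 * a$2) / D" for z
    using D by (simp_all add: inner_vec_def sum_2 a'_def b'_def field_simps)
  show thesis
  proof (rule that[of a' b'])
    show "a \<bullet> a' = 1" "a \<bullet> b' = 0" "b \<bullet> a' = 0" "b \<bullet> b' = 1"
      using D by (simp_all add: inner D_def[symmetric]) (simp add: D_def mult.commute)
    show "z = (z \<bullet> a') *\<^sub>R a + (z \<bullet> b') *\<^sub>R b" for z
      unfolding vec_eq_iff forall_2 using D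
      by (simp add: inner divide_simps) (simp add: D_def algebra_simps)
  qed
qed

lemma interpolation_periodic:
  assumes "\<And>i j. X (i + k) (j + l) = X i j" "\<And>i j. A (i + k) (j + l) = A i j"
  shows "interpolation X A (z + (of_int k, of_int l)) = interpolation X A z"
proof -
  have X: "X (i + k + 1) (j + l) = X (i + 1) j" "X (i + k) (j + l + 1) = X i (j + 1)"
    "X (i + k + 1) (j + l + 1) = X (i + 1) (j + 1)" for i j
    using assms(1)[of "i + 1" j] assms(1)[of i "j + 1"] assms(1)[of "i + 1" "j + 1"] by (simp_all add: add_ac)
  have "fst (z + (of_int k, of_int l)) = fst z + of_int k" "snd (z + (of_int k, of_int l)) = snd z + of_int l" by simp_all
  moreover have "fst z + of_int k - of_int (\<lfloor>fst z\<rfloor> + k) = fst z - of_int \<lfloor>fst z\<rfloor>"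
    "snd z + of_int l - of_int (\<lfloor>snd z\<rfloor> + l) = snd z - of_int \<lfloor>snd z\<rfloor>" by simp_all
  ultimately show ?thesis
    by (simp only: interpolation_def cell_interpolation_def floor_add_int[symmetric] X assms)
qed

theorem theorem1:
  fixes \<Sigma> :: "'s::topological_space set"
    and A :: "'s atlas"
    and l :: "'s \<Rightarrow> (real^'n) \<times> (real^'n)"
    and p :: "real^2 \<Rightarrow> 's"
    and \<Gamma> :: "(real^2) set"
  assumes "CARD('n) \<ge> 2"
    and "smooth_surface \<Sigma> A"
    and "diffeomorphic \<Sigma> A torus torus_atlas"
    and "smooth_immersion A l"
    and "isotropic A l"
    and "uniformization \<Sigma> A l p \<Gamma>"
  shows "\<forall>\<epsilon>>0. \<exists>l'. pl_isotropic p \<Gamma> l' \<and>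
           (\<forall>x\<in>\<Sigma>. norm (l x - l' x) \<le> \<epsilon>) \<and>
           (CARD('n) \<ge> 3 \<longrightarrow> (\<forall>x\<in>\<Sigma>. pl_immersion_at \<Sigma> l' x)) \<and>
           (CARD('n) = 2 \<longrightarrow>
              (\<exists>\<C>. finite \<C> \<and> (\<forall>C\<in>\<C>. embedded_circle \<Sigma> C) \<and>
                 (\<forall>x\<in>\<Sigma> - \<Union>\<C>. pl_immersion_at \<Sigma> l' x)))"
proof (intro allI impI)
  fix \<epsilon> :: real assume "\<epsilon> > 0"
  have p: "smooth_map UNIV plane_atlas \<Sigma> A p" and cov: "covering_space UNIV p \<Sigma>"
    and conf: "\<And>z. \<exists>c>0. \<forall>u v. pullback (\<bullet>) (l \<circ> p) z u v = c * (u \<bullet> v)"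
    and "plane_lattice \<Gamma>" and deck: "deck_transformations p = {(\<lambda>z. \<gamma> + z) | \<gamma>. \<gamma> \<in> \<Gamma>}"
    using assms(6) unfolding uniformization_def conformal_covering_def by auto
  obtain a b where ab: "a \<noteq> b" "independent {a, b}"
    and \<Gamma>: "\<Gamma> = {of_int i *\<^sub>R a + of_int j *\<^sub>R b | i j. True}"
    using \<open>plane_lattice \<Gamma>\<close> unfolding plane_lattice_def by auto
  obtain a' b' where dual: "a \<bullet> a' = 1" "a \<bullet> b' = 0" "b \<bullet> a' = 0" "b \<bullet> b' = 1"
    and dual_eq: "\<And>z. z = (z \<bullet> a') *\<^sub>R a + (z \<bullet> b') *\<^sub>R b"
    by (fact dual_basis[OF ab(2,1)])
  obtain f g where hom: "homeomorphism \<Sigma> torus f g"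
    by (rule diffeomorphic_imp_homeomorphism[OF assms(3)])
  have p_eq: "p (\<gamma> + z) = p z" if "\<gamma> \<in> \<Gamma>" for \<gamma> z
  proof -
    have "(\<lambda>z. \<gamma> + z) \<in> deck_transformations p" using that by (auto simp: deck)
    then have "p \<circ> (\<lambda>z. \<gamma> + z) = p" by (simp add: deck_transformations_def)
    then show ?thesis by (metis o_apply)
  qed
  \<comment> \<open>Together with \<open>p_eq\<close>: the fibres of p are exactly the orbits of the
    lattice.\<close>
  have fibre: "\<exists>\<gamma>\<in>\<Gamma>. w = \<gamma> + z" if "p z = p w" for z w
    using deck_transformation_exists[OF cov hom that] unfolding deck by auto

  define F where "F = l \<circ> p"
  define dF where "dF x = frechet_derivative F (at x)" for x
  have l: "smooth_function A l" using assms(4) by (simp add: smooth_immersion_def)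
  note pullback_facts = smooth_isotropic_pullback[OF assms(2) l assms(5) p, folded F_def]
  have der: "(F has_derivative dF x) (at x)" for x using pullback_facts(1) by (simp add: dF_def)
  have dF_cont: "continuous_on UNIV (\<lambda>x. dF x v)" for v using pullback_facts(2) by (simp add: dF_def)
  have iso: "symplectic_form (dF x u) (dF x v) = 0" for x u v
    using pullback_facts(3) by (simp add: dF_def pullback_def)
  have lin_dF: "linear (dF x)" for x using der has_derivative_linear by blast
  have F_per: "F (\<gamma> + z) = F z" if "\<gamma> \<in> \<Gamma>" for \<gamma> z using p_eq[OF that] by (simp add: F_def)
  have dF_per: "dF (\<gamma> + z) = dF z" if "\<gamma> \<in> \<Gamma>" for \<gamma> z
  proof -
    have "((\<lambda>z. \<gamma> + z) has_derivative (\<lambda>v. v)) (at z)" by (auto intro!: derivative_eq_intros)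
    from has_derivative_compose[OF this der] have "(F has_derivative dF (\<gamma> + z)) (at z)"
      by (simp add: F_per[OF that])
    then show ?thesis unfolding dF_def by (rule frechet_derivative_at)
  qed
  \<comment> \<open>The conformal factor, read off from the single direction a; in this form its
    continuity and periodicity come from those of dF.\<close>
  define c where "c x = dF x a \<bullet> dF x a / (a \<bullet> a)" for x
  have "a \<noteq> 0" using dual(1) by auto
  have conf': "c x > 0 \<and> dF x u \<bullet> dF x v = c x * (u \<bullet> v)" for x u v
  proof -
    obtain k where k: "k > 0" "\<And>u v. dF x u \<bullet> dF x v = k * (u \<bullet> v)"
      using conf[of x] by (auto simp: pullback_def dF_def F_def)
    then show ?thesis using \<open>a \<noteq> 0\<close> by (simp add: c_def)
  qed

  define T where "T z = fst z *\<^sub>R a + snd z *\<^sub>R b" for z :: "real \<times> real"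
  define e1 where "e1 z = dF (T z) a" for z
  define e2 where "e2 z = dF (T z) b" for z
  \<comment> \<open>For the complex structure J, conformality gives \<omega>(dF u, J dF v) = c (u
    \<bullet> v). So J applied to the images of the dual basis, divided by c, is conjugate to
    \<open>e1\<close>, \<open>e2\<close>; and \<omega>(f1, f2) = 0 because J preserves \<omega>.
    These fields are periodic because only dF enters.\<close>
  define f1 where "f1 z = (1 / c (T z)) *\<^sub>R complex_structure (dF (T z) a')" for z
  define f2 where "f2 z = (1 / c (T z)) *\<^sub>R complex_structure (dF (T z) b')" for z
  have T_lin: "linear T" unfolding T_def by (rule linearI) (simp_all add: algebra_simps)
  have T_cont: "continuous_on UNIV T" unfolding T_def by (intro continuous_intros)
  have T_shift: "T (x + (of_int i, of_int j)) = (of_int i *\<^sub>R a + of_int j *\<^sub>R b) + T x" for x and i j :: int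
    by (simp add: T_def algebra_simps)
  have in_\<Gamma>: "of_int i *\<^sub>R a + of_int j *\<^sub>R b \<in> \<Gamma>" for i j :: int using \<Gamma> by blast
  have dFT_cont: "continuous_on UNIV (\<lambda>z. dF (T z) v)" for v
    by (rule continuous_on_compose2[OF dF_cont T_cont]) simp
  have c_cont: "continuous_on UNIV (\<lambda>z. c (T z))"
    unfolding c_def using \<open>a \<noteq> 0\<close> by (intro continuous_intros dFT_cont) auto
  have J_cont: "continuous_on UNIV (\<lambda>z. complex_structure (dF (T z) v))" for v
    unfolding complex_structure_def by (intro continuous_intros dFT_cont)
  have c_pos: "c x > 0" for x using conf' by blast
  interpret periodic_isotropic "F \<circ> T" e1 e2 f1 f2
  proof
    fix x :: "real \<times> real"
    have "((F \<circ> T) has_derivative (dF (T x) \<circ> T)) (at x)"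
      by (rule diff_chain_at[OF linear_imp_has_derivative[OF T_lin] der])
    moreover have "dF (T x) \<circ> T = (\<lambda>v. fst v *\<^sub>R e1 x + snd v *\<^sub>R e2 x)"
      by (auto simp: T_def e1_def e2_def linear_add[OF lin_dF] linear_scale[OF lin_dF])
    ultimately show "((F \<circ> T) has_derivative (\<lambda>v. fst v *\<^sub>R e1 x + snd v *\<^sub>R e2 x)) (at x)" by simp
    have J: "complex_structure u \<bullet> v = symplectic_form u v" for u v :: "(real^'n) \<times> (real^'n)"
      by (simp add: complex_structure_def symplectic_form_def inner_prod_def)
    show "symplectic_frame (e1 x) (e2 x) (f1 x) (f2 x)"
      using conf'[of "T x"] iso[of "T x"] c_pos[of "T x"]
      by (simp add: symplectic_frame_def e1_def e2_def f1_def f2_def symplectic_simps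
          symplectic_form_complex_structure(1) J dual)
    fix i j :: int
    show "(F \<circ> T) (x + (of_int i, of_int j)) = (F \<circ> T) x"
      "e1 (x + (of_int i, of_int j)) = e1 x" "e2 (x + (of_int i, of_int j)) = e2 x"
      "f1 (x + (of_int i, of_int j)) = f1 x" "f2 (x + (of_int i, of_int j)) = f2 x"
      by (simp_all add: e1_def e2_def f1_def f2_def c_def T_shift F_per[OF in_\<Gamma>] dF_per[OF in_\<Gamma>])
  next
    show "continuous_on UNIV e1" "continuous_on UNIV e2" unfolding e1_def e2_def by (rule dFT_cont)+
    show "continuous_on UNIV f1" "continuous_on UNIV f2"
      unfolding f1_def f2_def using c_pos
      by (intro continuous_on_scaleR continuous_on_divide continuous_on_const c_cont J_cont; metis less_irrefl)+
  qed

  \<comment> \<open>The vertices around a point are within 2 \<eta> of its image and interpolation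
    costs a factor 5, whence \<epsilon>/10; 1/16 is the bound required for injectivity.\<close>
  define \<eta> where "\<eta> = min (\<epsilon> / 10) (1/16)"
  have \<eta>: "\<eta> > 0" "10 * \<eta> \<le> \<epsilon>" "\<eta> \<le> 1/16" using \<open>\<epsilon> > 0\<close> by (auto simp: \<eta>_def)
  obtain h :: real and m :: int and X Y :: "int \<Rightarrow> int \<Rightarrow> (real^'n) \<times> (real^'n)" where
    h: "h > 0" "h * of_int m = 1"
    and per: "\<And>i j k l. X (i + m * k) (j + m * l) = X i j" "\<And>i j k l. Y (i + m * k) (j + m * l) = Y i j"
    and XY: "\<And>i j. symplectic_form (X i j - Y i j) (X (i + 1) j - Y i j) = 0"
    "\<And>i j. symplectic_form (X (i + 1) j - Y i j) (X (i + 1) (j + 1) - Y i j) = 0"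
    "\<And>i j. symplectic_form (X (i + 1) (j + 1) - Y i j) (X i (j + 1) - Y i j) = 0"
    "\<And>i j. symplectic_form (X i (j + 1) - Y i j) (X i j - Y i j) = 0"
    and near: "\<And>i j. norm (X i j - (F \<circ> T) (h * of_int i, h * of_int j)) \<le> \<eta>"
    "\<And>i j. norm (Y i j - (F \<circ> T) (cell_centre h i j)) \<le> \<eta>"
    "\<And>z w. norm (z - w) \<le> 2 * h \<Longrightarrow> norm ((F \<circ> T) z - (F \<circ> T) w) \<le> \<eta>"
    and proj: "\<And>i0 j0. \<exists>L c. linear L \<and> (\<forall>i j. \<bar>i - i0\<bar> \<le> 2 \<longrightarrow> \<bar>j - j0\<bar> \<le> 2 \<longrightarrow>
       norm (L (X i j) - c - (real_of_int i, real_of_int j)) \<le> \<eta> \<and>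
       norm (L (Y i j) - c - (real_of_int i + 1/2, real_of_int j + 1/2)) \<le> \<eta>)"
    by (fact grid_approximation[OF \<eta>(1)])
  \<comment> \<open>Lattice coordinates in units of h: the grid becomes the integer grid, and
    lattice translations become shifts by multiples of m.\<close>
  define \<phi> where "\<phi> x = (1 / h) *\<^sub>R (x \<bullet> a', x \<bullet> b')" for x
  define \<psi> where "\<psi> z = T (h *\<^sub>R z)" for z
  interpret plane_coordinates \<phi> \<psi>
  proof (rule plane_coordinates.intro)
    show "linear \<phi>" unfolding \<phi>_def by (rule linearI) (simp_all add: algebra_simps add_divide_distrib)
    show "linear \<psi>" unfolding \<psi>_def T_def by (rule linearI) (simp_all add: algebra_simps)
    show "\<phi> (\<psi> z) = z" for z
      using h(1) by (simp add: \<phi>_def \<psi>_def T_def inner_add_left dual prod_eq_iff)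
    show "\<psi> (\<phi> x) = x" for x
      using h(1) dual_eq[of x] by (simp add: \<phi>_def \<psi>_def T_def)
  qed
  define G where "G = interpolation X Y \<circ> \<phi>"
  have \<phi>_\<Gamma>: "\<exists>k l. \<phi> \<gamma> = (of_int (m * k), of_int (m * l))" if "\<gamma> \<in> \<Gamma>" for \<gamma>
  proof -
    obtain k l :: int where kl: "\<gamma> = of_int k *\<^sub>R a + of_int l *\<^sub>R b" using \<open>\<gamma> \<in> \<Gamma>\<close> \<Gamma> by blast
    have "1 / h = of_int m" using h by (simp add: field_simps)
    then have "\<phi> \<gamma> = (of_int (m * k), of_int (m * l))"
      by (simp add: \<phi>_def kl inner_add_left dual)
    then show ?thesis by blast
  qed
  have G_per: "G (\<gamma> + z) = G z" if \<gamma>: "\<gamma> \<in> \<Gamma>" for \<gamma> z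
  proof -
    obtain k l where "\<phi> \<gamma> = (of_int (m * k), of_int (m * l))" using \<phi>_\<Gamma>[OF \<gamma>] by blast
    then have "\<phi> (\<gamma> + z) = \<phi> z + (of_int (m * k), of_int (m * l))"
      by (simp add: linear_add[OF lin(1)] add.commute)
    then show ?thesis unfolding G_def o_apply
      by (simp only:) (rule interpolation_periodic; rule per)
  qed
  \<comment> \<open>The choice of a preimage does not matter, since G is constant on the
    fibres.\<close>
  define l' where "l' y = G (SOME z. p z = y)" for y
  have l'p: "l' (p z) = G z" for z
  proof -
    have "p (SOME w. p w = p z) = p z" by (rule someI[of _ z]) simp
    then obtain \<gamma> where "\<gamma> \<in> \<Gamma>" "(SOME w. p w = p z) = \<gamma> + z" using fibre by metis
    then show ?thesis by (simp add: l'_def G_per)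
  qed
  then have l'p': "l' \<circ> p = G" by auto
  have p_surj: "\<exists>z. x = p z" if "x \<in> \<Sigma>" for x using cov that by (auto simp: covering_space_def)

  have G_cont: "continuous_on UNIV G"
    unfolding G_def by (intro continuous_on_compose continuous_coordinates continuous_on_subset[OF interpolation_continuous]) simp
  have sub: "subordinate grid_triangulation G" unfolding G_def by (rule subordinate_grid)
  have "pl_isotropic p \<Gamma> l'"
    unfolding pl_isotropic_def pl_on_surface_def piecewise_linear_def l'p'
  proof (intro conjI exI[of _ grid_triangulation] G_cont sub ballI allI)
    show "translation_invariant \<Gamma> grid_triangulation"
      unfolding translation_invariant_def using grid_triangulation_translation \<phi>_\<Gamma> by metis
    show "pullback symplectic_form G x u v = 0" if "S \<in> triangles grid_triangulation" "x \<in> interior S" for S x u v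
      unfolding G_def by (rule interpolation_isotropic[where X = X and A = Y, OF XY that])
  qed
  moreover have "norm (l x - l' x) \<le> \<epsilon>" if x: "x \<in> \<Sigma>" for x
  proof -
    obtain z where z: "x = p z" using p_surj[OF x] by blast
    define w where "w = \<phi> z"
    have Fw: "(F \<circ> T) (h *\<^sub>R w) = l x" using inverse(2)[of z] by (simp add: z w_def F_def \<psi>_def)
    have dist: "norm (V - l x) \<le> 2 * \<eta>"
      if "norm (V - (F \<circ> T) (h *\<^sub>R v)) \<le> \<eta>" "\<bar>fst v - fst w\<bar> \<le> 1" "\<bar>snd v - snd w\<bar> \<le> 1" for V v
    proof -
      have "norm (v - w) \<le> 2"
        using norm_Pair_le[of "fst v - fst w" "snd v - snd w"] that(2,3) by (simp add: minus_prod_def)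
      then have "norm (h *\<^sub>R v - h *\<^sub>R w) \<le> 2 * h"
        using h(1) by (simp add: scaleR_diff_right[symmetric] mult.commute del: scaleR_diff_right)
      from near(3)[OF this] have "norm ((F \<circ> T) (h *\<^sub>R v) - l x) \<le> \<eta>" by (simp only: Fw)
      then show ?thesis
        using that(1) norm_triangle_ineq[of "V - (F \<circ> T) (h *\<^sub>R v)" "(F \<circ> T) (h *\<^sub>R v) - l x"] by simp
    qed
    have "norm (X k j - l x) \<le> 2 * \<eta>"
      if "k \<in> {\<lfloor>fst w\<rfloor>, \<lfloor>fst w\<rfloor> + 1}" "j \<in> {\<lfloor>snd w\<rfloor>, \<lfloor>snd w\<rfloor> + 1}" for k j
    proof (rule dist[of _ "(of_int k, of_int j)"])
      show "norm (X k j - (F \<circ> T) (h *\<^sub>R (of_int k, of_int j))) \<le> \<eta>" using near(1)[of k j] by simp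
      show "\<bar>fst (of_int k, of_int j) - fst w\<bar> \<le> 1" "\<bar>snd (of_int k, of_int j) - snd w\<bar> \<le> 1"
        using that by (auto; linarith)+
    qed
    moreover have "norm (Y \<lfloor>fst w\<rfloor> \<lfloor>snd w\<rfloor> - l x) \<le> 2 * \<eta>"
    proof (rule dist[of _ "(of_int \<lfloor>fst w\<rfloor> + 1/2, of_int \<lfloor>snd w\<rfloor> + 1/2)"])
      show "norm (Y \<lfloor>fst w\<rfloor> \<lfloor>snd w\<rfloor> - (F \<circ> T) (h *\<^sub>R (of_int \<lfloor>fst w\<rfloor> + 1/2, of_int \<lfloor>snd w\<rfloor> + 1/2))) \<le> \<eta>"
        using near(2)[of "\<lfloor>fst w\<rfloor>" "\<lfloor>snd w\<rfloor>"] by (simp add: cell_centre_def)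
      show "\<bar>fst (of_int \<lfloor>fst w\<rfloor> + 1/2, of_int \<lfloor>snd w\<rfloor> + 1/2) - fst w\<bar> \<le> 1"
        "\<bar>snd (of_int \<lfloor>fst w\<rfloor> + 1/2, of_int \<lfloor>snd w\<rfloor> + 1/2) - snd w\<bar> \<le> 1"
        by (simp; linarith)+
    qed
    ultimately have "norm (interpolation X Y w - l x) \<le> 5 * (2 * \<eta>)"
      by (rule interpolation_near_vertices)
    then show ?thesis using \<eta>(2) l'p[of z] by (simp add: z G_def w_def norm_minus_commute)
  qed
  moreover have imm: "pl_immersion_at \<Sigma> l' x" if x: "x \<in> \<Sigma>" for x
  proof -
    obtain z where z: "x = p z" using p_surj[OF x] by blast
    \<comment> \<open>The projection used for injectivity depends on the cell that contains the
      point, so the conclusion is local.\<close>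
    let ?i = "\<lfloor>fst (\<phi> z)\<rfloor>" and ?j = "\<lfloor>snd (\<phi> z)\<rfloor>"
    let ?W = "\<phi> -` window ?i ?j"
    obtain L c where L: "linear L"
      "\<And>i j. \<bar>i - ?i\<bar> \<le> 2 \<Longrightarrow> \<bar>j - ?j\<bar> \<le> 2 \<Longrightarrow> norm (L (X i j) - c - (real_of_int i, real_of_int j)) \<le> \<eta>"
      "\<And>i j. \<bar>i - ?i\<bar> \<le> 2 \<Longrightarrow> \<bar>j - ?j\<bar> \<le> 2 \<Longrightarrow> norm (L (Y i j) - c - (real_of_int i + 1/2, real_of_int j + 1/2)) \<le> \<eta>"
      using proj[of ?i ?j] by blast
    have inj: "inj_on (interpolation X Y) (window ?i ?j)"
      by (rule interpolation_inj_on_window[where L = L and ?c0.0 = c, OF L(1)]; rule order_trans[OF _ \<eta>(3)]; rule L; assumption)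
    have "inj_on l' (p ` ?W)"
    proof (rule inj_onI, elim imageE)
      fix y y' u u' assume eq: "l' y = l' y'" and y: "y = p u" "u \<in> ?W" "y' = p u'" "u' \<in> ?W"
      then have "interpolation X Y (\<phi> u) = interpolation X Y (\<phi> u')" using l'p by (simp add: G_def)
      then have "\<phi> u = \<phi> u'" using inj y by (auto dest: inj_onD)
      then show "y = y'" using y inverse(2) by metis
    qed
    moreover have "openin (top_of_set \<Sigma>) (p ` ?W)"
      by (rule covering_image_open[OF cov hom]) (use open_window continuous_coordinates in \<open>simp add: open_vimage\<close>)
    moreover have "x \<in> p ` ?W" using z in_window by auto
    ultimately show ?thesis unfolding pl_immersion_at_def by blast
  qed
  ultimately show "\<exists>l'. pl_isotropic p \<Gamma> l' \<and>
           (\<forall>x\<in>\<Sigma>. norm (l x - l' x) \<le> \<epsilon>) \<and>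
           (CARD('n) \<ge> 3 \<longrightarrow> (\<forall>x\<in>\<Sigma>. pl_immersion_at \<Sigma> l' x)) \<and>
           (CARD('n) = 2 \<longrightarrow>
              (\<exists>\<C>. finite \<C> \<and> (\<forall>C\<in>\<C>. embedded_circle \<Sigma> C) \<and>
                 (\<forall>x\<in>\<Sigma> - \<Union>\<C>. pl_immersion_at \<Sigma> l' x)))"
    \<comment> \<open>The map is an immersion at every point for each admissible n, so the empty
      family of circles serves in the case n = 2.\<close>
    by (intro exI[of _ l'] conjI impI ballI exI[of _ "{}"]) auto
qed

end
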